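(* Let $(\mathbb{M}^d,\mathbb{M})$ be one of the following pairs of compact two-point homogeneous spaces, where in each case $\mathbb{M}$ is isometrically embedded in $\mathbb{M}^d$: (i) $\mathbb{M}^d=S^d$ with $d\geq 3$, and $\mathbb{M}=S^{d-2}$; (ii) $\mathbb{M}^d=\mathbb{P}^d(\mathbb{R})$ with $d\geq 3$, and $\mathbb{M}=\mathbb{P}^{d-2}(\mathbb{R})$; (iii) $\mathbb{M}^d=\mathbb{P}^d(\mathbb{C})$ with $d\geq 4$ ($d$ even), and $\mathbb{M}=\mathbb{P}^{d-2}(\mathbb{C})$; (iv) $\mathbb{M}^d=\mathbb{P}^d(\mathbb{H})$ with $d\geq 8$ ($d$ a multiple of $4$), and $\mathbb{M}=\mathbb{P}^{d/2-2}(\mathbb{C})$ when $d\in 8\mathbb{Z}_++8$, while $\mathbb{M}=\mathbb{P}^{d/2}(\mathbb{C})$ when $d\in 8\mathbb{Z}_++12$; (v) $\mathbb{M}^d=\mathbb{P}^{16}(Cay)$ ($d=16$), and $\mathbb{M}=S^2$. If $K$ is a continuous, positive definite and zonal kernel on $\mathbb{M}^d$, then the radial part $K_r^d$ of $K$ is continuously differentiable on $(-1,1)$, and there exist functions $f_1,f_2$, which are the radial parts of two continuous, positive definite and zonal kernels on $\mathbb{M}$, such that $$(1-t^2)(K_r^d)'(t)=f_1(t)-f_2(t),\quad t\in(-1,1).$$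
   Context: $\mathbb{Z}_+=\{0,1,2,\ldots\}$. Superscripts denote real dimension. The compact two-point homogeneous spaces are the unit spheres $S^d$ ($d=1,2,\ldots$), the real projective spaces $\mathbb{P}^d(\mathbb{R})$ ($d=2,3,\ldots$), the complex projective spaces $\mathbb{P}^d(\mathbb{C})$ ($d=4,6,\ldots$), the quaternionic projective spaces $\mathbb{P}^d(\mathbb{H})$ ($d=8,12,\ldots$) and the Cayley projective plane $\mathbb{P}^{16}(Cay)$. In the low-dimensional cases, $\mathbb{P}^1(\mathbb{R})$ is identified, up to scaling of the metric, with the circle $S^1$, and $\mathbb{P}^2(\mathbb{C})$ with the sphere $S^2$. Each such space $\mathbb{M}$ carries its geodesic distance $|xy|$, rescaled so that the maximal distance between two points is $2\pi$ (so $\cos(|xy|/2)$ ranges over $[-1,1]$), and a group of motions (isometries) $G$ which takes any pair of points $(x,y)$ to $(z,w)$ whenever $|xy|=|zw|$. Isometric embeddings refer to these rescaled distances. A kernel is a function $K:\mathbb{M}\times\mathbb{M}\to\mathbb{R}$. It is positive definite if $\sum_{\mu,\nu=1}^n c_\mu c_\nu K(x_\mu,x_\nu)\geq 0$ for every positive integer $n$, all distinct points $x_1,\ldots,x_n\in\mathbb{M}$ and all real scalars $c_1,\ldots,c_n$. It is zonal (isotropic) if $K(x,y)=K(Ax,Ay)$ for all $x,y\in\mathbb{M}$ and $A\in G$. A zonal kernel can be written as $K(x,y)=K_r(\cos(|xy|/2))$ for a unique function $K_r:[-1,1]\to\mathbb{R}$, called the radial (or isotropic) part of $K$; it is denoted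 $K_r^d$ when the space is $\mathbb{M}^d$. By Gangolli's theorem, a continuous zonal kernel $K$ on a space $\mathbb{M}^d$ of dimension $d$ is positive definite if and only if $K_r^d(t)=\sum_{k=0}^\infty a_k P_k^{(d-2)/2,\beta}(t)$ for $t\in[-1,1]$, with all $a_k\geq 0$ and $\sum_k a_kP_k^{(d-2)/2,\beta}(1)<\infty$, where $P_k^{\alpha,\beta}$ is the Jacobi polynomial of degree $k$ and $\beta=(d-2)/2,\,-1/2,\,0,\,1,\,3$ for spheres, real, complex, quaternionic projective spaces and the Cayley plane, respectively. *)

theory Defs
  imports "HOL-Analysis.Analysis" "HOL-Algebra.Bij"
begin

section \<open>Scalars\<close>

text \<open>Quaternions and octonions by Cayley--Dickson doubling; the pair \<open>(a, b)\<close> of complex numbers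
  is the quaternion \<open>a + b j\<close>. As products of real inner product spaces, both types already carry
  the Euclidean inner product and norm of \<open>R^4\<close> and \<open>R^8\<close>.\<close>

type_synonym quaternion = "complex \<times> complex"

definition quat_mult :: "quaternion \<Rightarrow> quaternion \<Rightarrow> quaternion" where
  "quat_mult p q = (fst p * fst q - cnj (snd q) * snd p, snd q * fst p + snd p * cnj (fst q))"

definition quat_cnj :: "quaternion \<Rightarrow> quaternion" where
  "quat_cnj p = (cnj (fst p), - snd p)"

type_synonym octonion = "quaternion \<times> quaternion"

definition oct_mult :: "octonion \<Rightarrow> octonion \<Rightarrow> octonion" where
  "oct_mult x y =
    (quat_mult (fst x) (fst y) - quat_mult (quat_cnj (snd y)) (snd x),
     quat_mult (snd y) (fst x) + quat_mult (snd x) (quat_cnj (fst y)))"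

definition oct_cnj :: "octonion \<Rightarrow> octonion" where
  "oct_cnj x = (quat_cnj (fst x), - snd x)"

definition oct_one :: octonion where
  "oct_one = ((1, 0), (0, 0))"


section \<open>Models of the compact two-point homogeneous spaces\<close>

text \<open>The vector space \<open>F^(n+1)\<close> is realised by the functions supported on \<open>{0..n}\<close>; its inner
  product is the real one, that is, the real part of the Hermitian product.\<close>

definition coordinate_vectors :: "nat \<Rightarrow> (nat \<Rightarrow> 'f::real_inner) set" where
  "coordinate_vectors n = {u. \<forall>i>n. u i = 0}"

definition dot :: "nat \<Rightarrow> (nat \<Rightarrow> 'f::real_inner) \<Rightarrow> (nat \<Rightarrow> 'f) \<Rightarrow> real" where
  "dot n u v = (\<Sum>i\<le>n. u i \<bullet> v i)"

definition unit_vectors :: "nat \<Rightarrow> (nat \<Rightarrow> 'f::real_inner) set" where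
  "unit_vectors n = {u \<in> coordinate_vectors n. dot n u u = 1}"

text \<open>All distances are geodesic distances rescaled to have maximum \<open>2 * pi\<close>. On the sphere this
  doubles the angle.\<close>

definition sphere_dist :: "nat \<Rightarrow> (nat \<Rightarrow> real) \<Rightarrow> (nat \<Rightarrow> real) \<Rightarrow> real" where
  "sphere_dist n u v = 2 * arccos (dot n u v)"

text \<open>The projective space of (right) lines in \<open>F^(n+1)\<close>. The geodesic distance of two lines is the
  smallest angle between their unit vectors (the distance of the fibres of the Hopf fibration of
  the unit sphere); it is at most \<open>pi / 2\<close>, which explains the factor 4.\<close>

definition line :: "('f \<Rightarrow> 'f \<Rightarrow> 'f) \<Rightarrow> (nat \<Rightarrow> 'f) \<Rightarrow> (nat \<Rightarrow> 'f) set" where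
  "line mul u = {(\<lambda>i. mul (u i) a) | a. True}"

definition projective_points ::
    "('f::real_inner \<Rightarrow> 'f \<Rightarrow> 'f) \<Rightarrow> nat \<Rightarrow> (nat \<Rightarrow> 'f) set set" where
  "projective_points mul n = {line mul u | u. u \<in> coordinate_vectors n \<and> u \<noteq> (\<lambda>i. 0)}"

definition projective_dist ::
    "nat \<Rightarrow> (nat \<Rightarrow> 'f::real_inner) set \<Rightarrow> (nat \<Rightarrow> 'f) set \<Rightarrow> real" where
  "projective_dist n L L' =
    4 * (INF (u, v) \<in> (L \<inter> unit_vectors n) \<times> (L' \<inter> unit_vectors n). arccos (dot n u v))"

text \<open>The Cayley plane as the set of primitive idempotents of the Albert algebra: the Hermitian
  octonionic 3 by 3 matrices with \<open>x x = x\<close> and trace 1. For such matrices \<open>x \<bullet> y\<close> is the trace of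
  the Jordan product of \<open>x\<close> and \<open>y\<close>, the squared cosine of the angle between \<open>x\<close> and \<open>y\<close>.\<close>

definition Cayley_points :: "(octonion ^ 3 ^ 3) set" where
  "Cayley_points = {x.
     (\<forall>i j. x $ j $ i = oct_cnj (x $ i $ j)) \<and>
     (\<forall>i j. (\<Sum>k\<in>UNIV. oct_mult (x $ i $ k) (x $ k $ j)) = x $ i $ j) \<and>
     (\<Sum>i\<in>UNIV. x $ i $ i) = oct_one}"

definition Cayley_dist :: "octonion ^ 3 ^ 3 \<Rightarrow> octonion ^ 3 ^ 3 \<Rightarrow> real" where
  "Cayley_dist x y = 4 * arccos (sqrt (x \<bullet> y))"


section \<open>The spaces up to isometry\<close>

definition isometric_to :: "'a metric \<Rightarrow> 'b set \<Rightarrow> ('b \<Rightarrow> 'b \<Rightarrow> real) \<Rightarrow> bool" where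
  "isometric_to X S \<delta> \<longleftrightarrow>
    (\<exists>\<phi>. bij_betw \<phi> (mspace X) S \<and>
         (\<forall>x\<in>mspace X. \<forall>y\<in>mspace X. mdist X x y = \<delta> (\<phi> x) (\<phi> y)))"

definition isometric_embedding :: "'a metric \<Rightarrow> 'b metric \<Rightarrow> ('a \<Rightarrow> 'b) \<Rightarrow> bool" where
  "isometric_embedding X Y \<iota> \<longleftrightarrow>
    \<iota> ` mspace X \<subseteq> mspace Y \<and>
    (\<forall>x\<in>mspace X. \<forall>y\<in>mspace X. mdist Y (\<iota> x) (\<iota> y) = mdist X x y)"

text \<open>The parameter \<open>d\<close> is always the real dimension.\<close>

definition unit_sphere :: "nat \<Rightarrow> 'a metric \<Rightarrow> bool" where
  "unit_sphere d X \<longleftrightarrow> isometric_to X (unit_vectors d) (sphere_dist d)"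

definition real_projective_space :: "nat \<Rightarrow> 'a metric \<Rightarrow> bool" where
  "real_projective_space d X \<longleftrightarrow>
    isometric_to X (projective_points ((*) :: real \<Rightarrow> real \<Rightarrow> real) d) (projective_dist d)"

definition complex_projective_space :: "nat \<Rightarrow> 'a metric \<Rightarrow> bool" where
  "complex_projective_space d X \<longleftrightarrow> 2 dvd d \<and>
    isometric_to X (projective_points ((*) :: complex \<Rightarrow> complex \<Rightarrow> complex) (d div 2))
      (projective_dist (d div 2))"

definition quaternionic_projective_space :: "nat \<Rightarrow> 'a metric \<Rightarrow> bool" where
  "quaternionic_projective_space d X \<longleftrightarrow> 4 dvd d \<and>
    isometric_to X (projective_points quat_mult (d div 4)) (projective_dist (d div 4))"

definition Cayley_plane :: "'a metric \<Rightarrow> bool" where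
  "Cayley_plane X \<longleftrightarrow> isometric_to X Cayley_points Cayley_dist"


section \<open>Groups of motions and kernels\<close>

definition motion_group :: "'a metric \<Rightarrow> ('a \<Rightarrow> 'a) set \<Rightarrow> bool" where
  "motion_group X G \<longleftrightarrow>
    subgroup G (BijGroup (mspace X)) \<and>
    (\<forall>A\<in>G. \<forall>x\<in>mspace X. \<forall>y\<in>mspace X. mdist X (A x) (A y) = mdist X x y) \<and>
    (\<forall>x\<in>mspace X. \<forall>y\<in>mspace X. \<forall>z\<in>mspace X. \<forall>w\<in>mspace X.
       mdist X x y = mdist X z w \<longrightarrow> (\<exists>A\<in>G. A x = z \<and> A y = w))"

definition continuous_kernel :: "'a metric \<Rightarrow> ('a \<Rightarrow> 'a \<Rightarrow> real) \<Rightarrow> bool" where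
  "continuous_kernel X K \<longleftrightarrow>
    continuous_map (prod_topology (mtopology_of X) (mtopology_of X)) euclideanreal
      (\<lambda>(x, y). K x y)"

definition positive_definite_kernel :: "'a metric \<Rightarrow> ('a \<Rightarrow> 'a \<Rightarrow> real) \<Rightarrow> bool" where
  "positive_definite_kernel X K \<longleftrightarrow>
    (\<forall>n>0. \<forall>(x :: nat \<Rightarrow> 'a) (c :: nat \<Rightarrow> real).
       inj_on x {1..n} \<and> x ` {1..n} \<subseteq> mspace X \<longrightarrow>
       (\<Sum>\<mu>=1..n. \<Sum>\<nu>=1..n. c \<mu> * c \<nu> * K (x \<mu>) (x \<nu>)) \<ge> 0)"

definition zonal_kernel :: "'a metric \<Rightarrow> ('a \<Rightarrow> 'a) set \<Rightarrow> ('a \<Rightarrow> 'a \<Rightarrow> real) \<Rightarrow> bool" where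
  "zonal_kernel X G K \<longleftrightarrow> (\<forall>A\<in>G. \<forall>x\<in>mspace X. \<forall>y\<in>mspace X. K x y = K (A x) (A y))"

text \<open>The unique function on \<open>[-1, 1]\<close> (extended by \<open>undefined\<close>) that represents a zonal kernel.\<close>

definition radial_part :: "'a metric \<Rightarrow> ('a \<Rightarrow> 'a \<Rightarrow> real) \<Rightarrow> real \<Rightarrow> real" where
  "radial_part X K =
    (THE f. f \<in> extensional {-1..1} \<and>
            (\<forall>x\<in>mspace X. \<forall>y\<in>mspace X. K x y = f (cos (mdist X x y / 2))))"

end

theory Submission
  imports Defs
begin

text \<open>Write \<open>t\<close> for the cosine of half the distance, or for its affine image in \<open>[0, 1]\<close> on a
  projective space, and let \<open>a\<close> be its least value. For a fixed and a random point, it has a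
  density proportional to some \<open>\<omega>(t)\<close> on the big space and to some \<open>\<omega>'(t)\<close> on the small one; let
  \<open>\<pi>\<^sub>n\<close> and \<open>\<pi>'\<^sub>k\<close> be the monic orthogonal polynomials. The theorem follows from an integration
  by parts. Put \<open>L p = (\<alpha> (t - a) - \<beta> (1 - t)) p - (1 - t) (t - a) p'\<close>. The constants \<open>\<alpha>, \<beta> \<ge> 0\<close>
  can be chosen such that \<open>\<omega>' L p = - ((1 - t) (t - a) \<omega>' p)'\<close>, and
  \<open>(1 - t) (t - a) \<omega>' = \<kappa> \<rho> \<omega>\<close>, where \<open>\<rho>\<close> is \<open>1\<close> or \<open>t\<close>. Hence \<open>\<integral> (L p) q \<omega>' = \<kappa> \<integral> \<rho> p q' \<omega>\<close>.
  For \<open>q = \<pi>'\<^sub>k\<close> this shows that \<open>q'\<close> is orthogonal to lower degrees with respect to \<open>\<rho> \<omega>\<close>, and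
  then that the right hand side is nonnegative for every \<open>p = \<pi>\<^sub>n\<close> (\<open>coefficient_nonneg\<close>): the
  expansion of \<open>L \<pi>\<^sub>n\<close> in the \<open>\<pi>'\<^sub>k\<close> has nonnegative coefficients, so that \<open>L \<pi>\<^sub>n\<close> is positive
  definite on the small space.

  A continuous positive definite \<open>K\<close> is a uniformly convergent series \<open>\<Sum> b\<^sub>n \<pi>\<^sub>n\<close> with \<open>b\<^sub>n \<ge> 0\<close>
  (\<open>gangolli_expansion\<close>). The series \<open>F = \<Sum> b\<^sub>n L \<pi>\<^sub>n\<close> converges uniformly, because a positive
  definite function is largest at \<open>1\<close> and \<open>L \<pi>\<^sub>n\<close> is a constant multiple of \<open>\<pi>\<^sub>n\<close> there. Solving
  for the derivative termwise shows that \<open>K\<close> is differentiable with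
  \<open>(1 - t) (t - a) K' = f\<^sub>1 - f\<^sub>2\<close> for \<open>f\<^sub>1 = (\<alpha> + \<beta>) (t - a) K\<close> and \<open>f\<^sub>2 = F + \<beta> (1 - a) K\<close>,
  both positive definite on a space contained in both spaces of the pair
  (\<open>derivative_expansion\<close>, \<open>derivative_split\<close>).

  The pairs are the spheres \<open>S\<^sup>d, S\<^sup>d\<^sup>-\<^sup>2\<close>, the complex projective spaces of complex dimensions
  \<open>n, n - 1\<close>, and the quaternionic projective space of quaternionic dimension \<open>n\<close> with the
  complex one of complex dimension \<open>2 n - 1\<close>; the last pair is followed by a restriction to the
  given smaller complex projective space. A kernel on a real projective space is an even kernel
  on the sphere. The Cayley plane contains a four-dimensional sphere (in a projective line), to
  which the case of spheres applies.

  The expansion needs no representation theory. Its only analytic input is that each space has,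
  for every degree \<open>J\<close>, finitely many nodes with nonnegative weights which integrate zonal
  polynomials of degree at most \<open>J\<close> exactly and convolve zonal polynomials to zonal polynomials
  (\<open>exact_cubature\<close>). Convolving \<open>\<pi>\<^sub>n\<close> with itself gives a multiple of \<open>\<pi>\<^sub>n\<close>, which is therefore
  a sum of kernels \<open>g(x) g(y)\<close>. On spheres the nodes come from products of Gauss--Hermite
  quadratures: they are exact for the Gaussian law, and for homogeneous forms of one even
  degree, projecting the nodes onto the sphere only changes the weights; lower degrees follow
  with the Laplacian (\<open>unit_cubature\<close>). On projective spaces the sphere upstairs provides the
  nodes.\<close>

section \<open>Positive definite kernels and Schur multipliers\<close>

text \<open>Points may repeat, so that pulling back along a map that is not injective is immediate.\<close>

definition posdef :: "'p set \<Rightarrow> ('p \<Rightarrow> 'p \<Rightarrow> real) \<Rightarrow> bool" where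
  "posdef S k \<longleftrightarrow> (\<forall>n (x :: nat \<Rightarrow> 'p) (c :: nat \<Rightarrow> real).
     (\<forall>i<n. x i \<in> S) \<longrightarrow> 0 \<le> (\<Sum>i<n. \<Sum>j<n. c i * c j * k (x i) (x j)))"

lemma posdefD:
  fixes x :: "nat \<Rightarrow> 'p"
  assumes "posdef S k" "\<And>i. i < n \<Longrightarrow> x i \<in> S"
  shows "0 \<le> (\<Sum>i<n. \<Sum>j<n. c i * c j * k (x i) (x j))"
  using assms unfolding posdef_def by blast

lemma posdefI:
  assumes "\<And>n (x :: nat \<Rightarrow> 'p) (c :: nat \<Rightarrow> real). (\<And>i. i < n \<Longrightarrow> x i \<in> S) \<Longrightarrow>
             0 \<le> (\<Sum>i<n. \<Sum>j<n. c i * c j * k (x i) (x j))"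
  shows "posdef S k"
  unfolding posdef_def using assms by blast

lemma posdef_cong:
  assumes "\<And>x y. x \<in> S \<Longrightarrow> y \<in> S \<Longrightarrow> k x y = l x y"
  shows "posdef S k \<longleftrightarrow> posdef S l"
proof -
  have "(\<Sum>i<n. \<Sum>j<n. c i * c j * k (x i) (x j)) = (\<Sum>i<n. \<Sum>j<n. c i * c j * l (x i) (x j))"
    if "\<forall>i<n. x i \<in> S" for n and x :: "nat \<Rightarrow> 'a" and c :: "nat \<Rightarrow> real"
    using that by (intro sum.cong) (auto simp: assms)
  then show ?thesis unfolding posdef_def by simp
qed

lemma posdef_image:
  assumes "posdef S k" "e ` T \<subseteq> S"
  shows "posdef T (\<lambda>x y. k (e x) (e y))"
proof (rule posdefI)
  fix n and x :: "nat \<Rightarrow> 'b" and c :: "nat \<Rightarrow> real"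
  assume "\<And>i. i < n \<Longrightarrow> x i \<in> T"
  then show "0 \<le> (\<Sum>i<n. \<Sum>j<n. c i * c j * k (e (x i)) (e (x j)))"
    using posdefD[OF assms(1), of n "\<lambda>i. e (x i)" c] assms(2) by blast
qed

lemma posdef_add:
  assumes "posdef S k" "posdef S l"
  shows "posdef S (\<lambda>x y. k x y + l x y)"
proof (rule posdefI)
  fix n and x :: "nat \<Rightarrow> 'a" and c :: "nat \<Rightarrow> real"
  assume x: "\<And>i. i < n \<Longrightarrow> x i \<in> S"
  show "0 \<le> (\<Sum>i<n. \<Sum>j<n. c i * c j * (k (x i) (x j) + l (x i) (x j)))"
    using posdefD[OF assms(1) x, where c = c] posdefD[OF assms(2) x, where c = c]
    by (simp add: distrib_left sum.distrib)
qed

lemma posdef_scale: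
  assumes "posdef S k" "0 \<le> a"
  shows "posdef S (\<lambda>x y. a * k x y)"
proof (rule posdefI)
  fix n and x :: "nat \<Rightarrow> 'a" and c :: "nat \<Rightarrow> real"
  assume x: "\<And>i. i < n \<Longrightarrow> x i \<in> S"
  have "(\<Sum>i<n. \<Sum>j<n. c i * c j * (a * k (x i) (x j))) = a * (\<Sum>i<n. \<Sum>j<n. c i * c j * k (x i) (x j))"
    by (simp add: sum_distrib_left algebra_simps)
  then show "0 \<le> (\<Sum>i<n. \<Sum>j<n. c i * c j * (a * k (x i) (x j)))"
    using posdefD[OF assms(1) x, where c = c] assms(2) by simp
qed

lemma posdef_zero: "posdef S (\<lambda>x y. 0)"
  by (rule posdefI) simp

lemma posdef_sum:
  assumes "\<And>i. i \<in> A \<Longrightarrow> posdef S (k i)"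
  shows "posdef S (\<lambda>x y. \<Sum>i\<in>A. k i x y)"
  using assms
proof (induction A rule: infinite_finite_induct)
  case (insert i A)
  then show ?case using posdef_add[of S "k i" "\<lambda>x y. \<Sum>i\<in>A. k i x y"] by simp
qed (simp_all add: posdef_zero)

lemma posdef_limit:
  assumes "\<And>m. posdef S (k m)" "\<And>x y. x \<in> S \<Longrightarrow> y \<in> S \<Longrightarrow> (\<lambda>m. k m x y) \<longlonglongrightarrow> l x y"
  shows "posdef S l"
proof (rule posdefI)
  fix n and x :: "nat \<Rightarrow> 'a" and c :: "nat \<Rightarrow> real"
  assume x: "\<And>i. i < n \<Longrightarrow> x i \<in> S"
  have "(\<lambda>m. \<Sum>i<n. \<Sum>j<n. c i * c j * k m (x i) (x j)) \<longlonglongrightarrow> (\<Sum>i<n. \<Sum>j<n. c i * c j * l (x i) (x j))"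
    by (intro tendsto_intros assms) (auto intro: x)
  moreover have "0 \<le> (\<Sum>i<n. \<Sum>j<n. c i * c j * k m (x i) (x j))" for m
    by (rule posdefD[OF assms(1) x])
  ultimately show "0 \<le> (\<Sum>i<n. \<Sum>j<n. c i * c j * l (x i) (x j))"
    by (meson LIMSEQ_le_const)
qed

lemma posdef_bound:
  assumes "posdef S k" "x \<in> S" "y \<in> S" "k x y = k y x"
  shows "2 * \<bar>k x y\<bar> \<le> k x x + k y y" "0 \<le> k x x"
proof -
  \<comment> \<open>Two points with coefficients 1 and s.\<close>
  have *: "0 \<le> k x x + k y y + 2 * (s * k x y)" if "s = 1 \<or> s = -1" for s
  proof -
    define p where "p i = (if i = (0::nat) then x else y)" for i
    define c where "c i = (if i = (0::nat) then 1 else s)" for i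
    have "0 \<le> (\<Sum>i<Suc (Suc 0). \<Sum>j<Suc (Suc 0). c i * c j * k (p i) (p j))"
      using assms by (intro posdefD) (auto simp: p_def)
    also have "\<dots> = k x x + k y y + 2 * (s * k x y)"
      using assms(4) that unfolding sum.lessThan_Suc by (auto simp: p_def c_def)
    finally show ?thesis .
  qed
  show "2 * \<bar>k x y\<bar> \<le> k x x + k y y"
    using *[of 1] *[of "-1"] by (simp add: abs_le_iff)
  show "0 \<le> k x x"
    using posdefD[OF assms(1), of "Suc 0" "\<lambda>_. x" "\<lambda>_. 1"] assms(2) by (simp add: lessThan_Suc)
qed

text \<open>Closure under products is immediate from this definition, whereas the Schur product
  theorem for \<open>posdef\<close> would require a spectral decomposition. All positive definite polynomials
  below turn out to be Schur multipliers, because they are sums of kernels \<open>g(x) g(y)\<close>.\<close>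

definition schur_multiplier :: "'p set \<Rightarrow> ('p \<Rightarrow> 'p \<Rightarrow> real) \<Rightarrow> bool" where
  "schur_multiplier S m \<longleftrightarrow> (\<forall>k. posdef S k \<longrightarrow> posdef S (\<lambda>x y. m x y * k x y))"

lemma schur_multiplier_cong:
  assumes "\<And>x y. x \<in> S \<Longrightarrow> y \<in> S \<Longrightarrow> k x y = l x y"
  shows "schur_multiplier S k \<longleftrightarrow> schur_multiplier S l"
  unfolding schur_multiplier_def
proof (intro all_cong imp_cong refl)
  fix h :: "'a \<Rightarrow> 'a \<Rightarrow> real"
  show "posdef S (\<lambda>x y. k x y * h x y) \<longleftrightarrow> posdef S (\<lambda>x y. l x y * h x y)"
    by (rule posdef_cong) (simp add: assms)
qed

lemma schur_multiplier_add:
  "schur_multiplier S k \<Longrightarrow> schur_multiplier S l \<Longrightarrow> schur_multiplier S (\<lambda>x y. k x y + l x y)"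
  unfolding schur_multiplier_def distrib_right by (intro allI impI posdef_add) blast+

lemma schur_multiplier_mult:
  assumes "schur_multiplier S k" "schur_multiplier S l"
  shows "schur_multiplier S (\<lambda>x y. k x y * l x y)"
  using assms unfolding schur_multiplier_def by (simp add: mult.assoc)

lemma schur_multiplier_const: "0 \<le> a \<Longrightarrow> schur_multiplier S (\<lambda>x y. a)"
  unfolding schur_multiplier_def by (intro allI impI posdef_scale)

lemma schur_multiplier_power:
  "schur_multiplier S k \<Longrightarrow> schur_multiplier S (\<lambda>x y. k x y ^ n)"
proof (induction n)
  case (Suc n)
  then show ?case using schur_multiplier_mult[of S k "\<lambda>x y. k x y ^ n"] by simp
qed (simp add: schur_multiplier_const)

lemma posdef_one: "posdef S (\<lambda>x y. 1)"
proof (rule posdefI)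
  fix n and x :: "nat \<Rightarrow> 'a" and c :: "nat \<Rightarrow> real"
  have "(\<Sum>i<n. \<Sum>j<n. c i * c j * 1) = (\<Sum>i<n. c i)\<^sup>2"
    by (simp add: power2_eq_square sum_product)
  then show "0 \<le> (\<Sum>i<n. \<Sum>j<n. c i * c j * 1)" by simp
qed

lemma schur_multiplier_posdef: "schur_multiplier S m \<Longrightarrow> posdef S m"
  unfolding schur_multiplier_def using posdef_one by fastforce

lemma schur_multiplier_feature: "schur_multiplier S (\<lambda>x y. f x * f y)"
  unfolding schur_multiplier_def
proof (intro allI impI posdefI)
  fix k :: "'a \<Rightarrow> 'a \<Rightarrow> real" and n and x :: "nat \<Rightarrow> 'a" and c :: "nat \<Rightarrow> real"
  assume k: "posdef S k" and x: "\<And>i. i < n \<Longrightarrow> x i \<in> S"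
  show "0 \<le> (\<Sum>i<n. \<Sum>j<n. c i * c j * (f (x i) * f (x j) * k (x i) (x j)))"
    using posdefD[OF k x, where c = "\<lambda>i. c i * f (x i)"] by (simp add: algebra_simps)
qed

lemma schur_multiplier_sum:
  assumes "finite A" "\<And>i. i \<in> A \<Longrightarrow> schur_multiplier S (k i)"
  shows "schur_multiplier S (\<lambda>x y. \<Sum>i\<in>A. k i x y)"
  using assms
proof (induction A rule: finite_induct)
  case empty
  show ?case unfolding sum.empty by (rule schur_multiplier_const) simp
next
  case (insert i A)
  then show ?case using schur_multiplier_add[of S "k i" "\<lambda>x y. \<Sum>i\<in>A. k i x y"] by simp
qed

section \<open>Means over a space with exact cubatures\<close>

lemma polynomial_approximation:
  fixes f :: "real \<Rightarrow> real"
  assumes "continuous_on {a..b} f" "0 < e"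
  obtains p :: "real poly" where "\<And>t. t \<in> {a..b} \<Longrightarrow> \<bar>f t - poly p t\<bar> < e"
proof -
  obtain g where g: "real_polynomial_function g" "\<And>t. t \<in> {a..b} \<Longrightarrow> \<bar>f t - g t\<bar> < e"
    by (rule Stone_Weierstrass_real_polynomial_function[OF compact_Icc assms]) (rule that)
  obtain c n where "g = (\<lambda>x. \<Sum>i\<le>n. c i * x ^ i)"
    using g(1) unfolding real_polynomial_function_iff_sum by (elim exE) (rule that)
  then have "poly (\<Sum>i\<le>n. monom (c i) i) t = g t" for t by (simp add: poly_sum poly_monom)
  then show ?thesis using g(2) by (intro that[of "\<Sum>i\<le>n. monom (c i) i"]) metis
qed

text \<open>The cosine is \<open>\<tau>\<close> and \<open>\<Lambda>\<close> the mean of a function of the cosine from a fixed to a random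
  point. The last condition carries the symmetry of the space: the convolution of two zonal
  polynomials is zonal, and its degree is bounded by both degrees, as it is a polynomial of
  these degrees in the two points.\<close>

definition exact_cubature ::
    "'p set \<Rightarrow> ('p \<Rightarrow> 'p \<Rightarrow> real) \<Rightarrow> ((real \<Rightarrow> real) \<Rightarrow> real) \<Rightarrow> nat \<Rightarrow> nat \<Rightarrow> (nat \<Rightarrow> real) \<Rightarrow> (nat \<Rightarrow> 'p) \<Rightarrow> bool"
  where "exact_cubature S \<tau> \<Lambda> J N w y \<longleftrightarrow>
    (\<forall>i<N. 0 \<le> w i \<and> y i \<in> S) \<and>
    (\<forall>p x. degree p \<le> J \<longrightarrow> x \<in> S \<longrightarrow> (\<Sum>i<N. w i * poly p (\<tau> x (y i))) = \<Lambda> (poly p)) \<and>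
    (\<forall>p q. degree p + degree q \<le> J \<longrightarrow> (\<exists>r. degree r \<le> min (degree p) (degree q) \<and>
      (\<forall>x\<in>S. \<forall>z\<in>S. (\<Sum>i<N. w i * (poly p (\<tau> x (y i)) * poly q (\<tau> (y i) z))) = poly r (\<tau> x z))))"

lemma exact_cubatureD:
  assumes "exact_cubature S \<tau> \<Lambda> J N w y"
  shows "i < N \<Longrightarrow> 0 \<le> w i" "i < N \<Longrightarrow> y i \<in> S"
    and "degree p \<le> J \<Longrightarrow> x \<in> S \<Longrightarrow> (\<Sum>i<N. w i * poly p (\<tau> x (y i))) = \<Lambda> (poly p)"
    and "degree p + degree q \<le> J \<Longrightarrow> \<exists>r. degree r \<le> min (degree p) (degree q) \<and>
      (\<forall>x\<in>S. \<forall>z\<in>S. (\<Sum>i<N. w i * (poly p (\<tau> x (y i)) * poly q (\<tau> (y i) z))) = poly r (\<tau> x z))"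
  using assms unfolding exact_cubature_def by simp_all

text \<open>The symmetry group of the space enters only through the existence of cubatures. The
  interval of values of the cosine is \<open>[a, 1]\<close>, with \<open>a = -1\<close> for spheres and \<open>a = 0\<close> for
  projective spaces.\<close>

locale averaged_space =
  fixes S :: "'p set" and \<tau> :: "'p \<Rightarrow> 'p \<Rightarrow> real" and a :: real and \<Lambda> :: "(real \<Rightarrow> real) \<Rightarrow> real"
  assumes a_less: "a < 1"
    and \<tau>_sym: "\<And>x y. x \<in> S \<Longrightarrow> y \<in> S \<Longrightarrow> \<tau> x y = \<tau> y x"
    and \<tau>_refl: "\<And>x. x \<in> S \<Longrightarrow> \<tau> x x = 1"
    and \<tau>_range: "\<And>x y. x \<in> S \<Longrightarrow> y \<in> S \<Longrightarrow> \<tau> x y \<in> {a..1}"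
    and \<tau>_surj: "\<And>t. t \<in> {a..1} \<Longrightarrow> \<exists>x\<in>S. \<exists>y\<in>S. \<tau> x y = t"
    and \<Lambda>_linear: "\<And>f g u v. continuous_on {a..1} f \<Longrightarrow> continuous_on {a..1} g \<Longrightarrow>
          \<Lambda> (\<lambda>t. u * f t + v * g t) = u * \<Lambda> f + v * \<Lambda> g"
    and \<Lambda>_nonneg: "\<And>f. continuous_on {a..1} f \<Longrightarrow> (\<And>t. t \<in> {a..1} \<Longrightarrow> 0 \<le> f t) \<Longrightarrow> 0 \<le> \<Lambda> f"
    and \<Lambda>_pos: "\<And>f t. continuous_on {a..1} f \<Longrightarrow> (\<And>t. t \<in> {a..1} \<Longrightarrow> 0 \<le> f t) \<Longrightarrow>
          t \<in> {a..1} \<Longrightarrow> 0 < f t \<Longrightarrow> 0 < \<Lambda> f"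
    and cubature: "\<And>J. \<exists>N w y. exact_cubature S \<tau> \<Lambda> J N w y"
begin

lemma one_mem [simp]: "1 \<in> {a..1}" using a_less by simp

lemma \<Lambda>_diff:
  "continuous_on {a..1} f \<Longrightarrow> continuous_on {a..1} g \<Longrightarrow> \<Lambda> (\<lambda>t. f t - g t) = \<Lambda> f - \<Lambda> g"
  using \<Lambda>_linear[of f g 1 "-1"] by simp

lemma \<Lambda>_add:
  "continuous_on {a..1} f \<Longrightarrow> continuous_on {a..1} g \<Longrightarrow> \<Lambda> (\<lambda>t. f t + g t) = \<Lambda> f + \<Lambda> g"
  using \<Lambda>_linear[of f g 1 1] by simp

lemma \<Lambda>_scale: "continuous_on {a..1} f \<Longrightarrow> \<Lambda> (\<lambda>t. u * f t) = u * \<Lambda> f"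
  using \<Lambda>_linear[of f f u 0] by simp

lemma \<Lambda>_mono:
  assumes "continuous_on {a..1} f" "continuous_on {a..1} g" "\<And>t. t \<in> {a..1} \<Longrightarrow> f t \<le> g t"
  shows "\<Lambda> f \<le> \<Lambda> g"
  using \<Lambda>_nonneg[of "\<lambda>t. g t - f t"] \<Lambda>_diff[of g f] assms by (auto intro: continuous_intros)

abbreviation mass :: real where "mass \<equiv> \<Lambda> (\<lambda>t. 1)"

lemma mass_pos: "0 < mass"
  using a_less by (intro \<Lambda>_pos[of _ 1]) auto

lemma \<Lambda>_abs_le:
  assumes "continuous_on {a..1} f" "\<And>t. t \<in> {a..1} \<Longrightarrow> \<bar>f t\<bar> \<le> e"
  shows "\<bar>\<Lambda> f\<bar> \<le> e * mass"
proof -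
  have "\<Lambda> (\<lambda>t. e * 1) = e * mass" "\<Lambda> (\<lambda>t. (-e) * 1) = (-e) * mass"
    by (rule \<Lambda>_scale, simp)+
  moreover have "\<Lambda> f \<le> \<Lambda> (\<lambda>t. e * 1)" "\<Lambda> (\<lambda>t. (-e) * 1) \<le> \<Lambda> f"
    using assms by (intro \<Lambda>_mono; force simp: abs_le_iff)+
  ultimately show ?thesis by (simp add: abs_le_iff)
qed

lemma \<Lambda>_sum:
  assumes "\<And>k. k \<in> A \<Longrightarrow> continuous_on {a..1} (f k)"
  shows "\<Lambda> (\<lambda>t. \<Sum>k\<in>A. f k t) = (\<Sum>k\<in>A. \<Lambda> (f k))"
  using assms
proof (induction A rule: infinite_finite_induct)
  case empty
  show ?case using \<Lambda>_scale[of "\<lambda>t. 0" 0] by simp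
next
  case (insert x F)
  then show ?case by (simp add: \<Lambda>_add continuous_on_sum)
next
  case (infinite A)
  show ?case using infinite \<Lambda>_scale[of "\<lambda>t. 0" 0] by simp
qed

lemma cont_poly [continuous_intros]: "continuous_on {a..1} (poly p)"
  by (intro continuous_intros)

lemma \<Lambda>_square_pos:
  assumes "p \<noteq> 0" shows "0 < \<Lambda> (poly (p * p))"
proof -
  have "infinite {a..1}" using a_less by (simp add: infinite_Icc)
  then have "\<not> {a..1} \<subseteq> {t. poly p t = 0}" using poly_roots_finite[OF assms] finite_subset by blast
  then obtain t where "t \<in> {a..1}" "poly p t \<noteq> 0" by blast
  then show ?thesis
    by (intro \<Lambda>_pos[of _ t]) (auto intro: continuous_intros simp: zero_less_mult_iff)
qed

text \<open>If \<open>f\<close> is a polynomial, the double sum over the nodes of a cubature, with its weights as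
  coefficients, equals \<open>\<Lambda> f\<close> times the mass. Continuous functions are approximated by
  polynomials.\<close>

lemma posdef_mean_nonneg:
  assumes f: "continuous_on {a..1} f" and pd: "posdef S (\<lambda>x y. f (\<tau> x y))"
  shows "0 \<le> \<Lambda> f"
proof (rule field_le_epsilon)
  fix e' :: real assume "0 < e'"
  define e where "e = e' / (2 * mass)"
  have e: "0 < e" "2 * e * mass = e'" using \<open>0 < e'\<close> mass_pos by (simp_all add: e_def)
  obtain p where p: "\<And>t. t \<in> {a..1} \<Longrightarrow> \<bar>f t - poly p t\<bar> < e"
    using polynomial_approximation[OF f e(1)] by blast
  obtain N w y where E: "exact_cubature S \<tau> \<Lambda> (degree p) N w y" using cubature by blast
  have w: "\<And>i. i < N \<Longrightarrow> 0 \<le> w i \<and> y i \<in> S"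
    and m: "\<And>q x. degree q \<le> degree p \<Longrightarrow> x \<in> S \<Longrightarrow> (\<Sum>i<N. w i * poly q (\<tau> x (y i))) = \<Lambda> (poly q)"
    using exact_cubatureD[OF E] by auto
  obtain x0 where x0: "x0 \<in> S" using \<tau>_surj[OF one_mem] by blast
  have "poly (1 :: real poly) = (\<lambda>t. 1)" by (simp add: fun_eq_iff)
  then have W: "(\<Sum>i<N. w i) = mass" using m[of 1 x0] x0 by simp
  have "0 \<le> (\<Sum>i<N. \<Sum>j<N. w i * w j * f (\<tau> (y i) (y j)))"
    using w by (intro posdefD[OF pd]) auto
  also have "\<dots> \<le> (\<Sum>i<N. \<Sum>j<N. w i * w j * (poly p (\<tau> (y i) (y j)) + e))"
    using w p \<tau>_range by (intro sum_mono mult_left_mono) (force simp: abs_less_iff)+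
  also have "\<dots> = (\<Sum>i<N. w i * ((\<Sum>j<N. w j * poly p (\<tau> (y i) (y j))) + e * (\<Sum>j<N. w j)))"
    by (simp add: sum.distrib sum_distrib_left algebra_simps)
  also have "\<dots> = (\<Sum>i<N. w i * (\<Lambda> (poly p) + e * mass))"
    using m w W by (intro sum.cong) auto
  also have "\<dots> = mass * (\<Lambda> (poly p) + e * mass)" by (simp add: W flip: sum_distrib_right)
  finally have "0 \<le> \<Lambda> (poly p) + e * mass" using mass_pos by (simp add: zero_le_mult_iff)
  moreover have "\<bar>\<Lambda> (\<lambda>t. poly p t - f t)\<bar> \<le> e * mass"
    using p f by (intro \<Lambda>_abs_le) (auto intro!: continuous_intros simp: abs_minus_commute less_imp_le)
  then have "\<bar>\<Lambda> (poly p) - \<Lambda> f\<bar> \<le> e * mass" using \<Lambda>_diff[OF cont_poly f] by simp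
  ultimately show "0 \<le> \<Lambda> f + e'" using e(2) by linarith
qed

section \<open>Orthogonal polynomials as positive definite kernels\<close>

lemma \<Lambda>_poly_add: "\<Lambda> (poly (p + q)) = \<Lambda> (poly p) + \<Lambda> (poly q)"
  using \<Lambda>_add[OF cont_poly cont_poly] by (simp add: poly_add[abs_def])

lemma \<Lambda>_poly_smult: "\<Lambda> (poly (smult u p)) = u * \<Lambda> (poly p)"
  using \<Lambda>_scale[OF cont_poly] by (simp add: poly_smult[abs_def])

lemma \<Lambda>_poly_zero: "\<Lambda> (poly 0) = 0"
  using \<Lambda>_poly_smult[of 0 0] by simp

lemma \<Lambda>_poly_diff: "\<Lambda> (poly (p - q)) = \<Lambda> (poly p) - \<Lambda> (poly q)"
  using \<Lambda>_poly_add[of "p - q" q] by simp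

lemma \<Lambda>_poly_sum: "\<Lambda> (poly (\<Sum>k\<in>A. f k)) = (\<Sum>k\<in>A. \<Lambda> (poly (f k)))"
  by (induction A rule: infinite_finite_induct) (simp_all only: sum.infinite sum.empty sum.insert \<Lambda>_poly_zero \<Lambda>_poly_add not_False_eq_True)

definition orthogonal_poly :: "nat \<Rightarrow> real poly \<Rightarrow> bool" where
  "orthogonal_poly n p \<longleftrightarrow> degree p = n \<and> coeff p n = 1 \<and> (\<forall>q. degree q < n \<longrightarrow> \<Lambda> (poly (p * q)) = 0)"

lemma orthogonal_polyD:
  "orthogonal_poly n p \<Longrightarrow> degree q < n \<Longrightarrow> \<Lambda> (poly (p * q)) = 0"
  "orthogonal_poly n p \<Longrightarrow> degree q < n \<Longrightarrow> \<Lambda> (poly (q * p)) = 0"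
  unfolding orthogonal_poly_def by (auto simp: mult.commute)

lemma orthogonal_poly_nonzero: "orthogonal_poly n p \<Longrightarrow> p \<noteq> 0"
  unfolding orthogonal_poly_def by (metis coeff_0 zero_neq_one)

text \<open>Subtracting a multiple of \<open>p n\<close> removes the term of degree \<open>n\<close>.\<close>

lemma monic_expansion:
  assumes "\<And>k. k \<le> n \<Longrightarrow> degree (p k) = k \<and> coeff (p k) k = (1 :: real)" "degree q \<le> n"
  obtains c where "q = (\<Sum>k\<le>n. smult (c k) (p k))"
proof -
  have "\<exists>c. q = (\<Sum>k\<le>n. smult (c k) (p k))"
    using assms
  proof (induction n arbitrary: q)
    case 0
    have "p 0 = 1" using 0(1)[of 0] by (intro poly_eqI) (auto simp: coeff_eq_0 coeff_pCons one_pCons split: nat.splits)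
    moreover have "q = smult (coeff q 0) 1" using 0(2)
      by (intro poly_eqI) (auto simp: coeff_eq_0 coeff_pCons one_pCons split: nat.splits)
    ultimately show ?case by (intro exI[of _ "coeff q"]) simp
  next
    case (Suc n)
    define r where "r = q - smult (coeff q (Suc n)) (p (Suc n))"
    have "degree r \<le> Suc n" unfolding r_def
      using Suc.prems(1)[of "Suc n"] Suc.prems(2) by (intro degree_diff_le) auto
    moreover have "coeff r (Suc n) = 0" using Suc.prems(1)[of "Suc n"] by (simp add: r_def)
    ultimately have "degree r \<le> n"
      by (metis coeff_0 degree_0 le_SucE le_zero_eq leading_coeff_0_iff nat_le_linear)
    then obtain c where "r = (\<Sum>k\<le>n. smult (c k) (p k))" using Suc.IH[of r] Suc.prems(1) by auto
    then have "q = (\<Sum>k\<le>Suc n. smult ((c(Suc n := coeff q (Suc n))) k) (p k))"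
      by (simp add: r_def algebra_simps)
    then show ?case by blast
  qed
  then show ?thesis using that by blast
qed

text \<open>Gram--Schmidt applied to the monomials.\<close>

lemma orthogonal_poly_exists: "\<exists>p. orthogonal_poly n p"
proof (induction n rule: less_induct)
  case (less n)
  define P where "P k = (SOME p. orthogonal_poly k p)" for k
  have P: "orthogonal_poly k (P k)" if "k < n" for k
    unfolding P_def using less[OF that] by (rule someI_ex)
  have "\<exists>p. degree p = n \<and> coeff p n = 1 \<and> (\<forall>k<n. \<Lambda> (poly (p * P k)) = 0)"
  proof -
    define X where "X = (monom 1 n :: real poly)"
    define r where "r = (\<Sum>j<n. smult (\<Lambda> (poly (X * P j)) / \<Lambda> (poly (P j * P j))) (P j))"
    have deg: "degree r < n \<or> r = 0"
    proof (cases n)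
      case (Suc m)
      have "degree r \<le> m" unfolding r_def
        using P Suc by (intro degree_sum_le) (auto intro: order_trans[OF degree_smult_le] simp: orthogonal_poly_def)
      then show ?thesis using Suc by simp
    qed (simp add: r_def)
    have "degree X = n" "coeff X n = 1" by (simp_all add: X_def degree_monom_eq)
    have r0: "coeff r n = 0" using deg by (auto intro: coeff_eq_0)
    have c: "coeff (X - r) n = 1" using \<open>coeff X n = 1\<close> r0 by simp
    moreover have "degree (X - r) \<le> n" using deg \<open>degree X = n\<close> by (intro degree_diff_le) auto
    ultimately have "degree (X - r) = n" by (metis le_antisym le_degree zero_neq_one)
    moreover have "\<Lambda> (poly ((X - r) * P k)) = 0" if k: "k < n" for k
    proof -
      have "\<Lambda> (poly (r * P k)) = (\<Sum>j<n. \<Lambda> (poly (X * P j)) / \<Lambda> (poly (P j * P j)) * \<Lambda> (poly (P j * P k)))"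
        unfolding r_def by (simp add: sum_distrib_right \<Lambda>_poly_sum \<Lambda>_poly_smult)
      also have "\<dots> = (\<Sum>j<n. if j = k then \<Lambda> (poly (X * P k)) else 0)"
      proof (intro sum.cong refl)
        fix j assume "j \<in> {..<n}"
        have "\<Lambda> (poly (P j * P k)) = 0" if "j \<noteq> k"
          using that P[OF k] P[of j] \<open>j \<in> {..<n}\<close> orthogonal_polyD[of j "P j" "P k"] orthogonal_polyD[of k "P k" "P j"]
          by (cases j k rule: linorder_cases) (auto simp: orthogonal_poly_def)
        moreover have "\<Lambda> (poly (P k * P k)) \<noteq> 0"
          using \<Lambda>_square_pos[OF orthogonal_poly_nonzero[OF P[OF k]]] by simp
        ultimately show "\<Lambda> (poly (X * P j)) / \<Lambda> (poly (P j * P j)) * \<Lambda> (poly (P j * P k)) =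
            (if j = k then \<Lambda> (poly (X * P k)) else 0)" by auto
      qed
      also have "\<dots> = \<Lambda> (poly (X * P k))" using k by simp
      finally show ?thesis by (simp add: left_diff_distrib \<Lambda>_poly_diff)
    qed
    ultimately show ?thesis using c by blast
  qed
  then obtain p where p: "degree p = n" "coeff p n = 1" "\<And>k. k < n \<Longrightarrow> \<Lambda> (poly (p * P k)) = 0" by blast
  have "\<Lambda> (poly (p * q)) = 0" if q: "degree q < n" for q
  proof -
    obtain c where "q = (\<Sum>k\<le>degree q. smult (c k) (P k))"
      using P q by (elim monic_expansion[of "degree q" P q, rotated -1]) (auto simp: orthogonal_poly_def)
    then have "\<Lambda> (poly (p * q)) = \<Lambda> (poly (\<Sum>k\<le>degree q. smult (c k) (p * P k)))"
      by (metis (no_types, lifting) mult_smult_right sum.cong sum_distrib_left)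
    also have "\<dots> = 0" using p(3) q by (simp add: \<Lambda>_poly_sum \<Lambda>_poly_smult)
    finally show ?thesis .
  qed
  with p show ?case unfolding orthogonal_poly_def by blast
qed

definition \<pi> :: "nat \<Rightarrow> real poly" where
  "\<pi> n = (SOME p. orthogonal_poly n p)"

lemma \<pi>_orthogonal: "orthogonal_poly n (\<pi> n)"
  unfolding \<pi>_def using orthogonal_poly_exists by (rule someI_ex)

lemma \<pi>_degree [simp]: "degree (\<pi> n) = n" and \<pi>_monic [simp]: "coeff (\<pi> n) n = 1"
  using \<pi>_orthogonal unfolding orthogonal_poly_def by auto

lemma \<pi>_nonzero [simp]: "\<pi> n \<noteq> 0"
  using orthogonal_poly_nonzero[OF \<pi>_orthogonal] .

lemma \<pi>_low: "degree q < n \<Longrightarrow> \<Lambda> (poly (\<pi> n * q)) = 0" "degree q < n \<Longrightarrow> \<Lambda> (poly (q * \<pi> n)) = 0"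
  using orthogonal_polyD[OF \<pi>_orthogonal] by auto

definition h where "h n = \<Lambda> (poly (\<pi> n * \<pi> n))"

lemma h_pos: "0 < h n"
  unfolding h_def by (simp add: \<Lambda>_square_pos)

lemma \<pi>_ortho: "\<Lambda> (poly (\<pi> m * \<pi> n)) = (if m = n then h n else 0)"
  using \<pi>_low[of "\<pi> m" n] \<pi>_low[of "\<pi> n" m] unfolding h_def by (cases m n rule: linorder_cases) auto

lemma \<pi>_top: "degree q \<le> n \<Longrightarrow> \<Lambda> (poly (q * \<pi> n)) = coeff q n * h n"
proof -
  assume q: "degree q \<le> n"
  obtain c where c: "q = (\<Sum>k\<le>n. smult (c k) (\<pi> k))"
    using q by (elim monic_expansion[of n \<pi> q, rotated -1]) auto
  have "\<Lambda> (poly (q * \<pi> n)) = (\<Sum>k\<le>n. c k * (if k = n then h n else 0))"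
    unfolding c by (simp add: sum_distrib_right \<Lambda>_poly_sum \<Lambda>_poly_smult \<pi>_ortho)
  moreover have "coeff q n = (\<Sum>k\<le>n. c k * coeff (\<pi> k) n)" unfolding c by (simp add: coeff_sum)
  moreover have "\<dots> = (\<Sum>k\<le>n. if k = n then c n else 0)"
    by (intro sum.cong) (auto simp: coeff_eq_0)
  ultimately show ?thesis by (simp add: if_distrib[of "\<lambda>x. _ * x"] cong: if_cong)
qed

lemma poly_expansion:
  assumes "degree q \<le> n"
  shows "q = (\<Sum>k\<le>n. smult (\<Lambda> (poly (q * \<pi> k)) / h k) (\<pi> k))"
proof -
  obtain c where c: "q = (\<Sum>k\<le>n. smult (c k) (\<pi> k))"
    using assms by (elim monic_expansion[of n \<pi> q, rotated -1]) auto
  have "\<Lambda> (poly (q * \<pi> k)) = c k * h k" if "k \<le> n" for k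
  proof -
    have "\<Lambda> (poly (q * \<pi> k)) = (\<Sum>j\<le>n. c j * (if j = k then h k else 0))"
      unfolding c by (simp add: sum_distrib_right \<Lambda>_poly_sum \<Lambda>_poly_smult \<pi>_ortho)
    then show ?thesis using that by (simp add: if_distrib[of "\<lambda>x. _ * x"] cong: if_cong)
  qed
  then have "smult (c k) (\<pi> k) = smult (\<Lambda> (poly (q * \<pi> k)) / h k) (\<pi> k)" if "k \<le> n" for k
    using that h_pos[of k] by simp
  then show ?thesis using c by (metis (no_types, lifting) atMost_iff sum.cong)
qed

text \<open>The convolution of \<open>\<pi> n\<close> with itself is a polynomial \<open>R\<close> of degree at most \<open>n\<close>. It is
  orthogonal to lower degrees: by associativity, pairing it with \<open>q\<close> pairs \<open>\<pi> n\<close> with the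
  convolution of \<open>\<pi> n\<close> and \<open>q\<close>, which has degree at most that of \<open>q\<close>. So \<open>R\<close> is a multiple of
  \<open>\<pi> n\<close>; written as a sum over the nodes it is a sum of kernels \<open>g(x) g(y)\<close>. The sign of the
  factor is not determined yet.\<close>

lemma convolution_square:
  obtains l where "l \<noteq> 0" "schur_multiplier S (\<lambda>x y. l * poly (\<pi> n) (\<tau> x y))"
    "l * poly (\<pi> n) 1 = h n"
proof -
  obtain N w y where E: "exact_cubature S \<tau> \<Lambda> (2 * n) N w y" using cubature by blast
  note w = exact_cubatureD(1)[OF E] and y = exact_cubatureD(2)[OF E]
    and mean = exact_cubatureD(3)[OF E] and conv = exact_cubatureD(4)[OF E]
  obtain R where R: "degree R \<le> n" and
    R_eq: "\<And>x z. x \<in> S \<Longrightarrow> z \<in> S \<Longrightarrow> (\<Sum>i<N. w i * (poly (\<pi> n) (\<tau> x (y i)) * poly (\<pi> n) (\<tau> (y i) z))) = poly R (\<tau> x z)"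
    using conv[of "\<pi> n" "\<pi> n"] by auto
  obtain x0 where x0: "x0 \<in> S" using \<tau>_surj[OF one_mem] by blast
  have low: "\<Lambda> (poly (R * q)) = 0" if q: "degree q < n" for q
  proof -
    obtain T where T: "degree T \<le> degree q" and
      T_eq: "\<And>x z. x \<in> S \<Longrightarrow> z \<in> S \<Longrightarrow> (\<Sum>i<N. w i * (poly (\<pi> n) (\<tau> x (y i)) * poly q (\<tau> (y i) z))) = poly T (\<tau> x z)"
      using conv[of "\<pi> n" q] q by auto
    have "\<Lambda> (poly (R * q)) = (\<Sum>j<N. w j * (poly R (\<tau> x0 (y j)) * poly q (\<tau> x0 (y j))))"
      using mean[of "R * q" x0] x0 R q degree_mult_le[of R q] by simp
    also have "\<dots> = (\<Sum>j<N. \<Sum>i<N. w j * (w i * (poly (\<pi> n) (\<tau> x0 (y i)) * poly (\<pi> n) (\<tau> (y i) (y j)))) * poly q (\<tau> x0 (y j)))"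
      using R_eq[OF x0 y] by (simp flip: R_eq[OF x0 y] add: sum_distrib_left sum_distrib_right mult.assoc)
    also have "\<dots> = (\<Sum>i<N. \<Sum>j<N. w j * (w i * (poly (\<pi> n) (\<tau> x0 (y i)) * poly (\<pi> n) (\<tau> (y i) (y j)))) * poly q (\<tau> x0 (y j)))"
      by (rule sum.swap)
    also have "\<dots> = (\<Sum>i<N. w i * poly (\<pi> n) (\<tau> x0 (y i)) * (\<Sum>j<N. w j * (poly (\<pi> n) (\<tau> (y i) (y j)) * poly q (\<tau> (y j) x0))))"
      using x0 y \<tau>_sym[OF x0 y] by (auto intro!: sum.cong simp: sum_distrib_left)
    also have "\<dots> = (\<Sum>i<N. w i * poly (\<pi> n * T) (\<tau> x0 (y i)))"
      using T_eq[OF y x0] \<tau>_sym[OF x0 y] by (intro sum.cong) auto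
    also have "\<dots> = \<Lambda> (poly (\<pi> n * T))"
      using T q degree_mult_le[of "\<pi> n" T] by (intro mean x0) auto
    also have "\<dots> = 0" using \<pi>_low[of T n] T q by simp
    finally show ?thesis .
  qed
  define l where "l = coeff R n"
  have Rl: "R = smult l (\<pi> n)"
  proof -
    have "degree R \<le> n" by (rule R)
    then have "R = (\<Sum>k\<le>n. smult (\<Lambda> (poly (R * \<pi> k)) / h k) (\<pi> k))" by (rule poly_expansion)
    also have "\<dots> = (\<Sum>k\<le>n. if k = n then smult l (\<pi> n) else 0)"
      using low \<pi>_top[OF R] h_pos[of n] by (intro sum.cong) (auto simp: l_def)
    finally show ?thesis by simp
  qed
  have R1: "poly R 1 = h n"
  proof -
    have "poly R 1 = poly R (\<tau> x0 x0)" using \<tau>_refl[OF x0] by simp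
    also have "\<dots> = (\<Sum>i<N. w i * poly (\<pi> n * \<pi> n) (\<tau> x0 (y i)))"
      using R_eq[OF x0 x0] \<tau>_sym[OF x0 y] by simp
    also have "\<dots> = h n"
      unfolding h_def using degree_mult_le[of "\<pi> n" "\<pi> n"] by (intro mean x0) auto
    finally show ?thesis .
  qed
  show thesis
  proof (rule that)
    show "l * poly (\<pi> n) 1 = h n" using R1 Rl by simp
    then show "l \<noteq> 0" using h_pos[of n] by auto
    have "schur_multiplier S (\<lambda>x z. \<Sum>i<N. (sqrt (w i) * poly (\<pi> n) (\<tau> x (y i))) * (sqrt (w i) * poly (\<pi> n) (\<tau> z (y i))))"
      by (intro schur_multiplier_sum schur_multiplier_feature finite_lessThan)
    also have "?this \<longleftrightarrow> schur_multiplier S (\<lambda>x z. l * poly (\<pi> n) (\<tau> x z))"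
    proof (intro schur_multiplier_cong)
      fix x z assume xz: "x \<in> S" "z \<in> S"
      have "(\<Sum>i<N. (sqrt (w i) * poly (\<pi> n) (\<tau> x (y i))) * (sqrt (w i) * poly (\<pi> n) (\<tau> z (y i)))) =
            (\<Sum>i<N. w i * (poly (\<pi> n) (\<tau> x (y i)) * poly (\<pi> n) (\<tau> (y i) z)))"
      proof (intro sum.cong refl)
        fix i assume "i \<in> {..<N}"
        then have "sqrt (w i) * sqrt (w i) = w i" "\<tau> z (y i) = \<tau> (y i) z"
          using w \<tau>_sym[OF xz(2) y] by auto
        then show "(sqrt (w i) * poly (\<pi> n) (\<tau> x (y i))) * (sqrt (w i) * poly (\<pi> n) (\<tau> z (y i))) =
            w i * (poly (\<pi> n) (\<tau> x (y i)) * poly (\<pi> n) (\<tau> (y i) z))"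
          by (metis (no_types, lifting) mult.assoc mult.left_commute)
      qed
      then show "(\<Sum>i<N. (sqrt (w i) * poly (\<pi> n) (\<tau> x (y i))) * (sqrt (w i) * poly (\<pi> n) (\<tau> z (y i)))) = l * poly (\<pi> n) (\<tau> x z)"
        using R_eq[OF xz] Rl by simp
    qed
    finally show "schur_multiplier S (\<lambda>x y. l * poly (\<pi> n) (\<tau> x y))" .
  qed
qed

lemma schur_multiplier_divide:
  assumes "schur_multiplier S (\<lambda>x y. l * k x y)" "0 < l"
  shows "schur_multiplier S k"
  using schur_multiplier_mult[OF schur_multiplier_const[of "1 / l"] assms(1)] assms(2) by simp

text \<open>\<open>\<pi> 1\<close> is \<open>t - c\<close>, where the mean \<open>c\<close> of \<open>t\<close> lies strictly between \<open>a\<close> and \<open>1\<close>. As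
  \<open>1 - c > 0\<close>, the factor of \<open>convolution_square\<close> is positive for \<open>n = 1\<close>, and \<open>t - a\<close> exceeds
  \<open>t - c\<close> by a positive constant.\<close>

lemma linear_multiplier: "schur_multiplier S (\<lambda>x y. \<tau> x y - a)"
proof -
  have p1: "\<pi> 1 = [:coeff (\<pi> 1) 0, 1:]"
    using \<pi>_degree[of 1] \<pi>_monic[of 1] by (intro poly_eqI) (auto simp: coeff_pCons coeff_eq_0 split: nat.splits)
  define b where "b = coeff (\<pi> 1) 0"
  have p1: "poly (\<pi> 1) t = t + b" for t using p1 unfolding b_def by (metis add.commute mult.right_neutral poly_0 poly_pCons mult_zero_right add_0)
  have id: "continuous_on {a..1} (\<lambda>t. t)" by simp
  have "poly (\<pi> 1 * 1) = (\<lambda>t. t + b * 1)" using p1 by (simp add: fun_eq_iff)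
  then have "0 = \<Lambda> (\<lambda>t. t + b * 1)" using \<pi>_low(1)[of 1 1] by simp
  also have "\<dots> = \<Lambda> (\<lambda>t. t) + b * mass" using \<Lambda>_scale[of "\<lambda>t. 1" b] by (subst \<Lambda>_add) auto
  finally have b: "\<Lambda> (\<lambda>t. t) = - b * mass" by simp
  have "0 < \<Lambda> (\<lambda>t. 1 - t)" "0 < \<Lambda> (\<lambda>t. t - a)"
    using a_less by (intro \<Lambda>_pos[of _ a] \<Lambda>_pos[of _ 1]; auto intro!: continuous_intros)+
  then have "0 < mass * (1 + b)" "0 < mass * (- b - a)"
    using \<Lambda>_diff[of "\<lambda>t. 1" "\<lambda>t. t"] \<Lambda>_diff[of "\<lambda>t. t" "\<lambda>t. a * 1"] \<Lambda>_scale[of "\<lambda>t. 1" a] b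
    by (auto simp: algebra_simps)
  then have b: "0 < 1 + b" "0 < - b - a" using mass_pos by (simp_all add: zero_less_mult_iff)
  obtain l where l: "schur_multiplier S (\<lambda>x y. l * poly (\<pi> 1) (\<tau> x y))" "l * poly (\<pi> 1) 1 = h 1"
    by (rule convolution_square)
  have "0 < l * (1 + b)" using l(2) h_pos[of 1] p1 by simp
  then have "0 < l" using b by (simp add: zero_less_mult_iff)
  then have "schur_multiplier S (\<lambda>x y. (\<tau> x y + b))"
    using schur_multiplier_divide[OF l(1)] p1 by simp
  then have "schur_multiplier S (\<lambda>x y. (\<tau> x y + b) + (- b - a))"
    using b by (intro schur_multiplier_add[of S "\<lambda>x y. \<tau> x y + b" "\<lambda>x y. - b - a"] schur_multiplier_const) auto
  then show ?thesis by simp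
qed

text \<open>The factor in \<open>convolution_square\<close> is positive: its multiple of \<open>\<pi> n\<close>, multiplied by
  \<open>(t - a)^n\<close>, is positive definite and so has nonnegative mean, and the mean of \<open>(t - a)^n \<pi> n\<close>
  is the positive \<open>h n\<close>.\<close>

lemma \<pi>_multiplier: "schur_multiplier S (\<lambda>x y. poly (\<pi> n) (\<tau> x y))"
proof -
  obtain l where l: "l \<noteq> 0" "schur_multiplier S (\<lambda>x y. l * poly (\<pi> n) (\<tau> x y))"
    by (rule convolution_square)
  have "posdef S (\<lambda>x y. poly (smult l (\<pi> n) * [:-a, 1:] ^ n) (\<tau> x y))"
    using schur_multiplier_posdef[OF schur_multiplier_mult[OF l(2) schur_multiplier_power[OF linear_multiplier, of n]]]
    by (simp add: poly_power mult.assoc)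
  then have "0 \<le> \<Lambda> (poly (smult l (\<pi> n) * [:-a, 1:] ^ n))"
    by (intro posdef_mean_nonneg cont_poly)
  also have "\<dots> = l * \<Lambda> (poly ([:-a, 1:] ^ n * \<pi> n))"
    by (simp add: \<Lambda>_poly_smult mult.commute)
  also have "\<Lambda> (poly ([:-a, 1:] ^ n * \<pi> n)) = h n"
    using \<pi>_top[of "[:-a, 1:] ^ n" n] by (simp add: degree_linear_power coeff_linear_power)
  finally have "0 < l" using l(1) h_pos[of n] by (simp add: zero_le_mult_iff)
  then show ?thesis using schur_multiplier_divide[OF l(2)] by simp
qed

lemma \<pi>_bound:
  assumes "t \<in> {a..1}" shows "\<bar>poly (\<pi> n) t\<bar> \<le> poly (\<pi> n) 1"
proof -
  obtain x y where xy: "x \<in> S" "y \<in> S" "\<tau> x y = t" using \<tau>_surj[OF assms] by blast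
  show ?thesis
    using posdef_bound(1)[OF schur_multiplier_posdef[OF \<pi>_multiplier[of n]] xy(1,2)] xy \<tau>_sym \<tau>_refl by simp
qed

section \<open>Expansion of a positive definite function\<close>

lemma \<Lambda>_mult_abs_le:
  assumes "continuous_on {a..1} f" "continuous_on {a..1} g"
    "\<And>t. t \<in> {a..1} \<Longrightarrow> \<bar>f t\<bar> \<le> e" "\<And>t. t \<in> {a..1} \<Longrightarrow> \<bar>g t\<bar> \<le> b"
  shows "\<bar>\<Lambda> (\<lambda>t. f t * g t)\<bar> \<le> e * b * mass"
proof (rule \<Lambda>_abs_le)
  show "continuous_on {a..1} (\<lambda>t. f t * g t)" by (intro continuous_intros assms)
  fix t assume t: "t \<in> {a..1}"
  have "0 \<le> e" using assms(3)[OF t] by linarith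
  then show "\<bar>f t * g t\<bar> \<le> e * b" using assms(3,4)[OF t] by (simp add: abs_mult mult_mono)
qed

lemma continuous_bound:
  fixes f :: "real \<Rightarrow> real"
  assumes "continuous_on {a..1} f"
  obtains B where "\<And>t. t \<in> {a..1} \<Longrightarrow> \<bar>f t\<bar> \<le> B" "0 < B"
proof -
  have "bounded (f ` {a..1})" using assms by (intro compact_imp_bounded compact_continuous_image) auto
  then obtain B where "0 < B" "\<forall>x\<in>f ` {a..1}. norm x \<le> B" using bounded_pos by blast
  then show ?thesis using that[of B] by auto
qed

text \<open>Polynomials are dense, so \<open>D\<close> is orthogonal to itself.\<close>

lemma orthogonal_to_all_imp_zero:
  assumes D: "continuous_on {a..1} D" and orth: "\<And>n. \<Lambda> (\<lambda>t. D t * poly (\<pi> n) t) = 0" and t: "t \<in> {a..1}"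
  shows "D t = 0"
proof -
  have q: "\<Lambda> (\<lambda>t. D t * poly q t) = 0" for q
  proof -
    define c where "c k = \<Lambda> (poly (q * \<pi> k)) / h k" for k
    have "poly q = poly (\<Sum>k\<le>degree q. smult (c k) (\<pi> k))"
      using poly_expansion[of q "degree q"] unfolding c_def by simp
    then have "(\<lambda>t. D t * poly q t) = (\<lambda>t. \<Sum>k\<le>degree q. c k * (D t * poly (\<pi> k) t))"
      by (simp add: poly_sum sum_distrib_left algebra_simps)
    then have "\<Lambda> (\<lambda>t. D t * poly q t) = \<Lambda> (\<lambda>t. \<Sum>k\<le>degree q. c k * (D t * poly (\<pi> k) t))" by simp
    also have "\<dots> = (\<Sum>k\<le>degree q. \<Lambda> (\<lambda>t. c k * (D t * poly (\<pi> k) t)))"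
      by (intro \<Lambda>_sum continuous_intros D)
    also have "\<dots> = (\<Sum>k\<le>degree q. c k * \<Lambda> (\<lambda>t. D t * poly (\<pi> k) t))"
      by (intro sum.cong \<Lambda>_scale continuous_intros D refl)
    finally show ?thesis using orth by simp
  qed
  obtain B where B: "\<And>t. t \<in> {a..1} \<Longrightarrow> \<bar>D t\<bar> \<le> B" "0 < B" using continuous_bound[OF D] by blast
  have "\<Lambda> (\<lambda>t. D t * D t) \<le> 0"
  proof (rule field_le_epsilon)
    fix e :: real assume "0 < e"
    define d where "d = e / (B * mass)"
    have d: "0 < d" "B * d * mass = e" using \<open>0 < e\<close> B(2) mass_pos by (simp_all add: d_def)
    obtain p where p: "\<And>t. t \<in> {a..1} \<Longrightarrow> \<bar>D t - poly p t\<bar> < d"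
      using polynomial_approximation[OF D d(1)] by blast
    have "\<bar>\<Lambda> (\<lambda>t. D t * (D t - poly p t))\<bar> \<le> B * d * mass"
      using p B by (intro \<Lambda>_mult_abs_le continuous_intros D) (auto intro: less_imp_le)
    moreover have "\<Lambda> (\<lambda>t. D t * (D t - poly p t)) = \<Lambda> (\<lambda>t. D t * D t) - \<Lambda> (\<lambda>t. D t * poly p t)"
      unfolding right_diff_distrib by (intro \<Lambda>_diff continuous_intros D)
    ultimately show "\<Lambda> (\<lambda>t. D t * D t) \<le> 0 + e" using q d by simp
  qed
  moreover have "0 < \<Lambda> (\<lambda>t. D t * D t)" if "D t \<noteq> 0"
  proof (rule \<Lambda>_pos[of _ t])
    show "0 < D t * D t" using that by (metis not_real_square_gt_zero)
  qed (use t in \<open>auto intro!: continuous_intros D\<close>)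
  ultimately show ?thesis by fastforce
qed

text \<open>As \<open>j\<close> grows, the functions \<open>(t - a)^j\<close> concentrate their mass at \<open>1\<close>: away from \<open>1\<close> they
  are at most \<open>q^j\<close>, while their mean is at least a constant times \<open>r^j\<close> for some \<open>r > q\<close>. If
  \<open>f\<close> were negative at \<open>1\<close>, its mean against them would eventually be negative.\<close>

lemma diagonal_nonneg:
  assumes f: "continuous_on {a..1} f" and pos: "\<And>j. 0 \<le> \<Lambda> (\<lambda>t. f t * (t - a) ^ j)"
  shows "0 \<le> f 1"
proof (rule ccontr)
  assume "\<not> 0 \<le> f 1"
  define e where "e = - f 1 / 2"
  have e: "0 < e" using \<open>\<not> 0 \<le> f 1\<close> by (simp add: e_def)
  obtain d0 where d0: "0 < d0" "\<And>t. t \<in> {a..1} \<Longrightarrow> dist t 1 < d0 \<Longrightarrow> dist (f t) (f 1) < e"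
    using f e one_mem unfolding continuous_on_iff by metis
  define d where "d = min 1 (min (d0 / 2) ((1 - a) / 2))"
  have d: "0 < d" "d < d0" "a < 1 - d" "d \<le> 1" using d0(1) a_less by (auto simp: d_def min_def field_simps)
  have near: "f t \<le> - e" if "t \<in> {a..1}" "1 - d \<le> t" for t
    using d0(2)[of t] that d by (auto simp: dist_real_def e_def abs_less_iff)
  obtain B where B: "\<And>t. t \<in> {a..1} \<Longrightarrow> \<bar>f t\<bar> \<le> B" "0 < B" using continuous_bound[OF f] by blast
  define q where "q = 1 - d - a"
  define r where "r = 1 - d / 2 - a"
  have qr: "0 < q" "q < r" using d by (auto simp: q_def r_def)
  \<comment> \<open>A continuous minorant of the indicator of a smaller neighbourhood of 1.\<close>
  define g where "g t = max 0 (t - (1 - d / 2))" for t :: real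
  have g: "continuous_on {a..1} g" unfolding g_def by (intro continuous_intros)
  have g_pos: "0 < \<Lambda> g" using d a_less
    by (intro \<Lambda>_pos[of _ 1] g) (auto simp: g_def)
  have g_le: "r ^ j * g t \<le> (t - a) ^ j" if t: "t \<in> {a..1}" for j t
  proof (cases "t \<le> 1 - d / 2")
    case True
    then show ?thesis using t by (simp add: g_def max_def)
  next
    case False
    have "r ^ j \<le> (t - a) ^ j" using False qr by (intro power_mono) (auto simp: r_def)
    moreover have "0 \<le> g t" "g t \<le> 1" using t d a_less False unfolding g_def
      by (auto simp: max_def)
    moreover have "0 \<le> (t - a) ^ j" using t by simp
    ultimately show ?thesis using mult_mono[of "r ^ j" "(t - a) ^ j" "g t" 1] by simp
  qed
  have cp: "continuous_on {a..1} (\<lambda>t. (t - a) ^ j)" for j by (intro continuous_intros)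
  have ineq: "e * (r ^ j * \<Lambda> g) \<le> (B + e) * q ^ j * mass" for j
  proof -
    have "f t * (t - a) ^ j \<le> (- e) * (t - a) ^ j + ((B + e) * q ^ j) * 1" if t: "t \<in> {a..1}" for t
    proof (cases "1 - d \<le> t")
      case True
      have "f t * (t - a) ^ j \<le> (- e) * (t - a) ^ j" using near[OF t True] t by (intro mult_right_mono) auto
      moreover have "0 \<le> (B + e) * q ^ j" using B e qr by simp
      ultimately show ?thesis by linarith
    next
      case False
      have "f t \<le> B" using B(1)[OF t] by (simp add: abs_le_iff)
      then have "f t * (t - a) ^ j \<le> B * (t - a) ^ j" using t by (intro mult_right_mono) auto
      moreover have "(t - a) ^ j \<le> q ^ j" using False t by (intro power_mono) (auto simp: q_def)
      then have "(B + e) * (t - a) ^ j \<le> (B + e) * q ^ j" using B e by (intro mult_left_mono) auto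
      ultimately show ?thesis by (simp add: algebra_simps)
    qed
    then have "\<Lambda> (\<lambda>t. f t * (t - a) ^ j) \<le> \<Lambda> (\<lambda>t. (- e) * (t - a) ^ j + ((B + e) * q ^ j) * 1)"
      by (intro \<Lambda>_mono continuous_intros f) auto
    also have "\<dots> = (- e) * \<Lambda> (\<lambda>t. (t - a) ^ j) + ((B + e) * q ^ j) * mass"
      by (rule \<Lambda>_linear) (intro cp continuous_intros)+
    finally have "e * \<Lambda> (\<lambda>t. (t - a) ^ j) \<le> (B + e) * q ^ j * mass" using pos[of j] by simp
    moreover have "\<Lambda> (\<lambda>t. r ^ j * g t) \<le> \<Lambda> (\<lambda>t. (t - a) ^ j)"
      using g_le by (intro \<Lambda>_mono cp continuous_intros g)
    then have "r ^ j * \<Lambda> g \<le> \<Lambda> (\<lambda>t. (t - a) ^ j)" by (simp add: \<Lambda>_scale[OF g])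
    then have "e * (r ^ j * \<Lambda> g) \<le> e * \<Lambda> (\<lambda>t. (t - a) ^ j)" using e by (intro mult_left_mono) auto
    ultimately show ?thesis by linarith
  qed
  have "e * \<Lambda> g \<le> (B + e) * mass * (q / r) ^ j" for j
    using ineq[of j] qr by (simp add: field_simps)
  moreover have "(\<lambda>j. (B + e) * mass * (q / r) ^ j) \<longlonglongrightarrow> (B + e) * mass * 0"
    using qr by (intro tendsto_intros LIMSEQ_realpow_zero) auto
  ultimately have "e * \<Lambda> g \<le> (B + e) * mass * 0" by (meson LIMSEQ_le_const)
  moreover have "0 < e * \<Lambda> g" using e g_pos by simp
  ultimately show False by simp
qed

text \<open>The Fourier coefficients \<open>b n\<close> are nonnegative because \<open>\<pi> n\<close> is a Schur multiplier and
  positive definite functions have nonnegative mean. The remainder \<open>K - P N\<close> of the Fourier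
  series has nonnegative coefficients as well, and so have the powers of \<open>t - a\<close>; by
  \<open>diagonal_nonneg\<close> the remainder is nonnegative at \<open>1\<close>, which bounds the partial sums at \<open>1\<close>.
  As \<open>\<pi> n\<close> is largest at \<open>1\<close>, the series converges uniformly. Its sum has the same Fourier
  coefficients as \<open>K\<close>.\<close>

lemma gangolli_expansion:
  assumes K: "continuous_on {a..1} K" and pd: "posdef S (\<lambda>x y. K (\<tau> x y))"
  obtains b where "\<And>n. 0 \<le> b n" "summable (\<lambda>n. b n * poly (\<pi> n) 1)"
    "\<And>t. t \<in> {a..1} \<Longrightarrow> (\<lambda>n. b n * poly (\<pi> n) t) sums K t"
proof -
  define b where "b n = \<Lambda> (\<lambda>t. K t * poly (\<pi> n) t) / h n" for n
  have cK: "continuous_on {a..1} (\<lambda>t. K t * poly q t)" for q by (intro continuous_intros K)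
  have K_nonneg: "0 \<le> \<Lambda> (\<lambda>t. K t * poly (\<pi> n) t)" for n
    using \<pi>_multiplier[of n] pd unfolding schur_multiplier_def
    by (intro posdef_mean_nonneg cK) (simp add: mult.commute)
  have b: "0 \<le> b n" for n unfolding b_def using K_nonneg[of n] h_pos[of n] by simp
  define P where "P N = (\<Sum>n<N. smult (b n) (\<pi> n))" for N
  have P_coef: "\<Lambda> (poly (P N * \<pi> m)) = (if m < N then \<Lambda> (\<lambda>t. K t * poly (\<pi> m) t) else 0)" for N m
  proof -
    have "\<Lambda> (poly (P N * \<pi> m)) = (\<Sum>n<N. b n * (if n = m then h m else 0))"
      unfolding P_def by (simp add: sum_distrib_right \<Lambda>_poly_sum \<Lambda>_poly_smult \<pi>_ortho)
    also have "\<dots> = (if m < N then b m * h m else 0)"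
      by (simp add: if_distrib[of "\<lambda>x. _ * x"] cong: if_cong)
    finally show ?thesis using h_pos[of m] by (simp add: b_def)
  qed
  have rest: "\<Lambda> (\<lambda>t. (K t - poly (P N) t) * poly (\<pi> m) t) = (if m < N then 0 else \<Lambda> (\<lambda>t. K t * poly (\<pi> m) t))" for N m
  proof -
    have "(\<lambda>t. (K t - poly (P N) t) * poly (\<pi> m) t) = (\<lambda>t. K t * poly (\<pi> m) t - poly (P N * \<pi> m) t)"
      by (simp add: left_diff_distrib)
    then show ?thesis using \<Lambda>_diff[OF cK[of "\<pi> m"] cont_poly[of "P N * \<pi> m"]] P_coef[of N m] by simp
  qed
  \<comment> \<open>The remainder and \<open>(t - a)^j\<close> both have nonnegative coefficients, so their product has
    nonnegative mean.\<close>
  have partial: "poly (P N) 1 \<le> K 1" for N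
  proof -
    have "0 \<le> K 1 - poly (P N) 1"
    proof (rule diagonal_nonneg)
      show "continuous_on {a..1} (\<lambda>t. K t - poly (P N) t)" by (intro continuous_intros K)
      fix j
      define q where "q = [:-a, 1:] ^ j"
      define c where "c k = \<Lambda> (poly (q * \<pi> k)) / h k" for k
      have "posdef S (\<lambda>x y. poly (q * \<pi> k) (\<tau> x y))" for k
        using schur_multiplier_posdef[OF schur_multiplier_mult[OF schur_multiplier_power[OF linear_multiplier, of j] \<pi>_multiplier[of k]]]
        by (simp add: q_def poly_power)
      then have c: "0 \<le> c k" for k unfolding c_def
        using posdef_mean_nonneg[OF cont_poly[of "q * \<pi> k"]] h_pos[of k] by simp
      have "poly q = poly (\<Sum>k\<le>degree q. smult (c k) (\<pi> k))"
        using poly_expansion[of q "degree q"] unfolding c_def by simp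
      moreover have "poly q = (\<lambda>t. (t - a) ^ j)" by (simp add: q_def poly_power fun_eq_iff)
      ultimately have "(\<lambda>t. (K t - poly (P N) t) * (t - a) ^ j) =
          (\<lambda>t. \<Sum>k\<le>degree q. c k * ((K t - poly (P N) t) * poly (\<pi> k) t))"
        by (simp add: fun_eq_iff poly_sum sum_distrib_left mult.left_commute)
      then have "\<Lambda> (\<lambda>t. (K t - poly (P N) t) * (t - a) ^ j) =
          \<Lambda> (\<lambda>t. \<Sum>k\<le>degree q. c k * ((K t - poly (P N) t) * poly (\<pi> k) t))" by simp
      also have "\<dots> = (\<Sum>k\<le>degree q. \<Lambda> (\<lambda>t. c k * ((K t - poly (P N) t) * poly (\<pi> k) t)))"
        by (intro \<Lambda>_sum continuous_intros K)
      also have "\<dots> = (\<Sum>k\<le>degree q. c k * \<Lambda> (\<lambda>t. (K t - poly (P N) t) * poly (\<pi> k) t))"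
        by (intro sum.cong \<Lambda>_scale continuous_intros K refl)
      also have "\<dots> \<ge> 0" using rest K_nonneg c by (intro sum_nonneg mult_nonneg_nonneg) auto
      finally show "0 \<le> \<Lambda> (\<lambda>t. (K t - poly (P N) t) * (t - a) ^ j)" .
    qed
    then show ?thesis by simp
  qed
  define M where "M n = b n * poly (\<pi> n) 1" for n
  have M: "0 \<le> M n" for n
    unfolding M_def using b[of n] \<pi>_bound[OF one_mem, of n] by (intro mult_nonneg_nonneg) linarith+
  have sM: "summable M"
  proof (rule bounded_imp_summable[OF M])
    fix N
    have "(\<Sum>n\<le>N. M n) = poly (P (Suc N)) 1"
      by (simp add: P_def M_def poly_sum lessThan_Suc_atMost)
    then show "(\<Sum>n\<le>N. M n) \<le> K 1" using partial by simp
  qed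
  have le_M: "norm (b n * poly (\<pi> n) t) \<le> M n" if "t \<in> {a..1}" for n t
    unfolding M_def using b[of n] \<pi>_bound[OF that, of n] by (simp add: abs_mult mult_left_mono)
  define F where "F t = (\<Sum>n. b n * poly (\<pi> n) t)" for t
  have P_eq: "(\<Sum>n<N. b n * poly (\<pi> n) t) = poly (P N) t" for N t by (simp add: P_def poly_sum)
  have unif: "uniform_limit {a..1} (\<lambda>N. poly (P N)) F sequentially"
    using Weierstrass_m_test[of "{a..1}" "\<lambda>n t. b n * poly (\<pi> n) t" M, OF le_M sM]
    unfolding F_def[abs_def] P_eq .
  have F: "continuous_on {a..1} F"
    by (rule uniform_limit_theorem[OF _ unif]) (auto intro!: always_eventually continuous_intros)
  have "K t - F t = 0" if t: "t \<in> {a..1}" for t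
  proof (rule orthogonal_to_all_imp_zero[OF _ _ t])
    show "continuous_on {a..1} (\<lambda>t. K t - F t)" by (intro continuous_intros K F)
    fix m
    obtain B where B: "\<And>t. t \<in> {a..1} \<Longrightarrow> \<bar>poly (\<pi> m) t\<bar> \<le> B" "0 < B"
      using continuous_bound[OF cont_poly[of "\<pi> m"]] by blast
    have "\<bar>\<Lambda> (\<lambda>t. (K t - F t) * poly (\<pi> m) t)\<bar> \<le> 0"
    proof (rule field_le_epsilon)
      fix e' :: real assume "0 < e'"
      define e where "e = e' / (B * mass)"
      have e: "0 < e" "e * B * mass = e'" using \<open>0 < e'\<close> B(2) mass_pos by (simp_all add: e_def)
      have "eventually (\<lambda>N. \<forall>t\<in>{a..1}. dist (poly (P N) t) (F t) < e) sequentially"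
        using uniform_limitD[OF unif e(1)] .
      then obtain N0 where N0: "\<And>N. N \<ge> N0 \<Longrightarrow> \<forall>t\<in>{a..1}. dist (poly (P N) t) (F t) < e"
        unfolding eventually_sequentially by blast
      define N where "N = max N0 (Suc m)"
      have N: "\<And>t. t \<in> {a..1} \<Longrightarrow> \<bar>poly (P N) t - F t\<bar> < e" "m < N"
        using N0[of N] by (auto simp: N_def dist_real_def)
      have "(\<lambda>t. (K t - F t) * poly (\<pi> m) t) =
          (\<lambda>t. (K t - poly (P N) t) * poly (\<pi> m) t + (poly (P N) t - F t) * poly (\<pi> m) t)"
        by (simp add: algebra_simps)
      then have "\<Lambda> (\<lambda>t. (K t - F t) * poly (\<pi> m) t) = \<Lambda> (\<lambda>t. (K t - poly (P N) t) * poly (\<pi> m) t) +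
          \<Lambda> (\<lambda>t. (poly (P N) t - F t) * poly (\<pi> m) t)"
        using \<Lambda>_add[of "\<lambda>t. (K t - poly (P N) t) * poly (\<pi> m) t" "\<lambda>t. (poly (P N) t - F t) * poly (\<pi> m) t"]
        by (simp add: continuous_intros K F)
      also have "\<dots> = \<Lambda> (\<lambda>t. (poly (P N) t - F t) * poly (\<pi> m) t)" using rest[of N m] N(2) by simp
      finally have "\<bar>\<Lambda> (\<lambda>t. (K t - F t) * poly (\<pi> m) t)\<bar> = \<bar>\<Lambda> (\<lambda>t. (poly (P N) t - F t) * poly (\<pi> m) t)\<bar>" by simp
      also have "\<dots> \<le> e * B * mass"
        using N B by (intro \<Lambda>_mult_abs_le continuous_intros F) (auto intro: less_imp_le)
      finally show "\<bar>\<Lambda> (\<lambda>t. (K t - F t) * poly (\<pi> m) t)\<bar> \<le> 0 + e'" using e by simp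
    qed
    then show "\<Lambda> (\<lambda>t. (K t - F t) * poly (\<pi> m) t) = 0" by simp
  qed
  moreover have "(\<lambda>n. b n * poly (\<pi> n) t) sums F t" if "t \<in> {a..1}" for t
    unfolding F_def by (intro summable_sums summable_comparison_test[OF _ sM] exI[of _ 0] allI impI le_M[OF that])
  ultimately show thesis using that[of b] b sM unfolding M_def[abs_def] by simp
qed

end

section \<open>The derivative on a pair of spaces\<close>

text \<open>In terms of the densities \<open>\<omega>\<close> of \<open>\<Lambda>\<close> and \<open>\<omega>'\<close> of \<open>\<Lambda>'\<close>, the assumption \<open>pearson\<close> says that
  \<open>(\<alpha> (t - a) - \<beta> (1 - t)) \<omega>'\<close> is the negative derivative of \<open>(1 - t) (t - a) \<omega>'\<close>, a Pearson
  equation integrated against polynomials, and \<open>weight\<close> says that \<open>(1 - t) (t - a) \<omega>'\<close> equals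
  \<open>\<kappa> (r\<^sub>0 + r\<^sub>1 t) \<omega>\<close>. Stating both for means of polynomials allows them to be verified on
  moments.\<close>

locale space_pair =
  X: averaged_space S \<tau> a \<Lambda> + Y: averaged_space S' \<tau>' a \<Lambda>'
  for S :: "'p set" and \<tau> and a and \<Lambda> and S' :: "'q set" and \<tau>' and \<Lambda>' +
  fixes \<alpha> \<beta> r\<^sub>0 r\<^sub>1 \<kappa> :: real
  assumes \<kappa>_pos: "0 < \<kappa>" and r1_nonneg: "0 \<le> r\<^sub>1"
    and rho_nonneg: "\<And>t. t \<in> {a..1} \<Longrightarrow> 0 \<le> r\<^sub>0 + r\<^sub>1 * t"
    and pearson: "\<And>p. \<Lambda>' (poly ([:- \<alpha> * a - \<beta>, \<alpha> + \<beta>:] * p - [:- a, 1 + a, -1:] * pderiv p)) = 0"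
    and weight: "\<And>p. \<Lambda>' (poly ([:- a, 1 + a, -1:] * p)) = \<kappa> * \<Lambda> (poly ([:r\<^sub>0, r\<^sub>1:] * p))"
begin

definition L :: "real poly \<Rightarrow> real poly" where
  "L p = [:- \<alpha> * a - \<beta>, \<alpha> + \<beta>:] * p - [:- a, 1 + a, -1:] * pderiv p"

lemma poly_L: "poly (L p) t = (\<alpha> * (t - a) - \<beta> * (1 - t)) * poly p t - (1 - t) * (t - a) * poly (pderiv p) t"
  by (simp add: L_def algebra_simps)

lemma degree_L: "degree (L p) \<le> Suc (degree p)"
proof -
  have "degree ([:- \<alpha> * a - \<beta>, \<alpha> + \<beta>:] * p) \<le> Suc (degree p)"
    by (rule order_trans[OF degree_mult_le]) simp
  moreover have "degree ([:- a, 1 + a, -1:] * pderiv p) \<le> Suc (degree p)"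
  proof (cases "degree p")
    case 0
    then have "pderiv p = 0" by (simp add: pderiv_eq_0_iff)
    then show ?thesis by simp
  next
    case (Suc k)
    then show ?thesis
      by (intro order_trans[OF degree_mult_le]) (simp add: degree_pderiv)
  qed
  ultimately show ?thesis unfolding L_def by (rule degree_diff_le)
qed

text \<open>Integration by parts: \<open>L p * q\<close> and \<open>L (p * q)\<close> differ by \<open>(1 - t) (t - a) p q'\<close>, and
  \<open>L (p * q)\<close> has mean zero.\<close>

lemma mean_L: "\<Lambda>' (poly (L p * q)) = \<kappa> * \<Lambda> (poly ([:r\<^sub>0, r\<^sub>1:] * p * pderiv q))"
proof -
  have "L p * q = L (p * q) + [:- a, 1 + a, -1:] * (p * pderiv q)"
    unfolding L_def pderiv_mult by (simp add: algebra_simps smult_add_right)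
  then have "\<Lambda>' (poly (L p * q)) = \<Lambda>' (poly (L (p * q))) + \<Lambda>' (poly ([:- a, 1 + a, -1:] * (p * pderiv q)))"
    by (simp only: Y.\<Lambda>_poly_add)
  then show ?thesis using pearson[of "p * q"] weight[of "p * pderiv q"] by (simp only: L_def mult.assoc add_0)
qed

text \<open>Let \<open>q\<close> be the derivative of \<open>Y.\<pi> k\<close>, of degree \<open>j = k - 1\<close>, and \<open>\<rho> = r\<^sub>0 + r\<^sub>1 t\<close>. The
  claim concerns the mean of \<open>\<rho> q\<close> times \<open>X.\<pi> n\<close>. For \<open>n < j\<close> it vanishes, as \<open>L (X.\<pi> n)\<close> has
  degree below \<open>k\<close>. For \<open>n = j\<close> one may replace \<open>X.\<pi> n\<close> by a positive multiple of \<open>q\<close>, and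
  \<open>\<rho> \<ge> 0\<close>. For \<open>n > j\<close> orthogonality of \<open>X.\<pi> n\<close> leaves only the coefficient of \<open>\<rho> q\<close> in degree
  \<open>n\<close>, which is zero or \<open>r\<^sub>1\<close> times the leading coefficient of \<open>q\<close>.\<close>

lemma coefficient_nonneg: "0 \<le> \<Lambda>' (poly (L (X.\<pi> n) * Y.\<pi> k))"
proof (cases k)
  case 0
  then have "pderiv (Y.\<pi> k) = 0" by (simp add: pderiv_eq_0_iff)
  then show ?thesis by (simp add: mean_L X.\<Lambda>_poly_zero)
next
  case (Suc j)
  define q where "q = pderiv (Y.\<pi> k)"
  have q: "degree q = j" "coeff q j = real (Suc j)"
    using Suc by (simp_all add: q_def degree_pderiv coeff_pderiv)
  have low: "\<Lambda> (poly ([:r\<^sub>0, r\<^sub>1:] * r * q)) = 0" if "degree r < j \<or> r = 0" for r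
  proof -
    have "degree (L r) < k" using that degree_L[of r] Suc by (cases "r = 0") (auto simp: L_def)
    then have "\<Lambda>' (poly (L r * Y.\<pi> k)) = 0" by (rule Y.\<pi>_low)
    then show ?thesis unfolding mean_L q_def[symmetric] using \<kappa>_pos by simp
  qed
  have "0 \<le> \<Lambda> (poly ([:r\<^sub>0, r\<^sub>1:] * X.\<pi> n * q))"
  proof (cases n j rule: linorder_cases)
    case less
    then show ?thesis using low[of "X.\<pi> n"] by simp
  next
    case equal
    define r where "r = q - smult (real (Suc j)) (X.\<pi> n)"
    have "coeff r j = 0" using q equal X.\<pi>_monic[of n] by (simp add: r_def)
    moreover have "degree r \<le> j" unfolding r_def using q equal by (intro degree_diff_le) auto
    ultimately have r: "degree r < j \<or> r = 0"
      by (metis le_neq_implies_less leading_coeff_0_iff)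
    have "[:r\<^sub>0, r\<^sub>1:] * q * q = [:r\<^sub>0, r\<^sub>1:] * r * q + smult (real (Suc j)) ([:r\<^sub>0, r\<^sub>1:] * X.\<pi> n * q)"
      by (simp add: r_def algebra_simps)
    then have "\<Lambda> (poly ([:r\<^sub>0, r\<^sub>1:] * q * q)) = real (Suc j) * \<Lambda> (poly ([:r\<^sub>0, r\<^sub>1:] * X.\<pi> n * q))"
      using low[OF r] by (simp only: X.\<Lambda>_poly_add X.\<Lambda>_poly_smult add_0)
    moreover have "0 \<le> \<Lambda> (poly ([:r\<^sub>0, r\<^sub>1:] * q * q))"
    proof (rule X.\<Lambda>_nonneg)
      fix t assume "t \<in> {a..1}"
      then have "0 \<le> (r\<^sub>0 + r\<^sub>1 * t) * (poly q t * poly q t)" using rho_nonneg by (intro mult_nonneg_nonneg zero_le_square) auto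
      moreover have "poly ([:r\<^sub>0, r\<^sub>1:] * q * q) t = (r\<^sub>0 + r\<^sub>1 * t) * (poly q t * poly q t)"
        by (simp add: algebra_simps)
      ultimately show "0 \<le> poly ([:r\<^sub>0, r\<^sub>1:] * q * q) t" by (simp only:)
    qed (rule X.cont_poly)
    ultimately show ?thesis by (simp add: zero_le_mult_iff)
  next
    case greater
    have deg: "degree ([:r\<^sub>0, r\<^sub>1:] * q) \<le> Suc j"
      by (rule order_trans[OF degree_mult_le]) (simp add: q)
    have "\<Lambda> (poly (([:r\<^sub>0, r\<^sub>1:] * q) * X.\<pi> n)) = coeff ([:r\<^sub>0, r\<^sub>1:] * q) n * X.h n"
      using deg greater by (intro X.\<pi>_top) auto
    moreover have "0 \<le> coeff ([:r\<^sub>0, r\<^sub>1:] * q) n"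
    proof (cases "n = Suc j")
      case True
      then show ?thesis using q r1_nonneg by (simp add: coeff_eq_0)
    next
      case False
      then have "degree ([:r\<^sub>0, r\<^sub>1:] * q) < n" using deg greater by linarith
      then have "coeff ([:r\<^sub>0, r\<^sub>1:] * q) n = 0" by (rule coeff_eq_0)
      then show ?thesis by simp
    qed
    moreover have "[:r\<^sub>0, r\<^sub>1:] * X.\<pi> n * q = ([:r\<^sub>0, r\<^sub>1:] * q) * X.\<pi> n"
      by (simp only: mult.assoc mult.commute[of q])
    ultimately show ?thesis using X.h_pos[of n] by (simp only: mult_nonneg_nonneg less_imp_le)
  qed
  then show ?thesis unfolding mean_L q_def[symmetric] using \<kappa>_pos by simp
qed

lemma L_multiplier: "schur_multiplier S' (\<lambda>x y. poly (L (X.\<pi> n)) (\<tau>' x y))"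
proof -
  define c where "c k = \<Lambda>' (poly (L (X.\<pi> n) * Y.\<pi> k)) / Y.h k" for k
  have c: "0 \<le> c k" for k
    unfolding c_def using coefficient_nonneg[of n k] Y.h_pos[of k] by simp
  have "poly (L (X.\<pi> n)) t = (\<Sum>k\<le>degree (L (X.\<pi> n)). c k * poly (Y.\<pi> k) t)" for t
    using arg_cong[OF Y.poly_expansion[OF order_refl, of "L (X.\<pi> n)"], of "\<lambda>p. poly p t"]
    unfolding c_def by (simp add: poly_sum)
  moreover have "schur_multiplier S' (\<lambda>x y. \<Sum>k\<le>degree (L (X.\<pi> n)). c k * poly (Y.\<pi> k) (\<tau>' x y))"
    by (intro schur_multiplier_sum finite_atMost
        schur_multiplier_mult[of S' "\<lambda>x y. c _" "\<lambda>x y. poly (Y.\<pi> _) (\<tau>' x y)"]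
        schur_multiplier_const c Y.\<pi>_multiplier)
  ultimately show ?thesis by simp
qed

text \<open>Applying \<open>L\<close> to the expansion of \<open>K\<close> termwise gives \<open>F\<close>. As \<open>L (X.\<pi> n)\<close> is positive
  definite, it is largest at \<open>1\<close>, where it equals \<open>\<alpha> (1 - a) X.\<pi> n\<close>; this gives a convergent
  majorant. Solving \<open>poly_L\<close> for the derivative of \<open>X.\<pi> n\<close> then bounds the differentiated series
  on compact subintervals of \<open>(a, 1)\<close>.\<close>

lemma derivative_expansion:
  assumes K: "continuous_on {a..1} K" and pd: "posdef S (\<lambda>x y. K (\<tau> x y))"
  obtains F where "continuous_on {a..1} F" "posdef S' (\<lambda>x y. F (\<tau>' x y))"
    "\<And>t. t \<in> {a<..<1} \<Longrightarrow> \<exists>D. (K has_real_derivative D) (at t) \<and>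
        (1 - t) * (t - a) * D = (\<alpha> * (t - a) - \<beta> * (1 - t)) * K t - F t"
proof -
  obtain b where b: "\<And>n. 0 \<le> b n" and sum1: "summable (\<lambda>n. b n * poly (X.\<pi> n) 1)"
    and K_sums: "\<And>t. t \<in> {a..1} \<Longrightarrow> (\<lambda>n. b n * poly (X.\<pi> n) t) sums K t"
    using X.gangolli_expansion[OF K pd] by metis
  define g where "g n = poly (L (X.\<pi> n))" for n
  have g1: "g n 1 = \<alpha> * (1 - a) * poly (X.\<pi> n) 1" for n by (simp add: g_def poly_L)
  define M where "M n = b n * (\<alpha> * (1 - a) * poly (X.\<pi> n) 1)" for n
  have M: "summable M"
    using summable_mult[OF sum1, of "\<alpha> * (1 - a)"] unfolding M_def by (simp add: mult_ac)
  have g_le: "\<bar>g n t\<bar> \<le> g n 1" if t: "t \<in> {a..1}" for n t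
  proof -
    obtain x y where xy: "x \<in> S'" "y \<in> S'" "\<tau>' x y = t" using Y.\<tau>_surj[OF t] by blast
    have "2 * \<bar>g n (\<tau>' x y)\<bar> \<le> g n (\<tau>' x x) + g n (\<tau>' y y)"
      using schur_multiplier_posdef[OF L_multiplier[of n]] xy Y.\<tau>_sym[OF xy(1,2)]
      unfolding g_def by (intro posdef_bound(1)) auto
    then show ?thesis using xy Y.\<tau>_refl by simp
  qed
  have g_le_M: "norm (b n * g n t) \<le> M n" if "t \<in> {a..1}" for n t
    using g_le[OF that, of n] b[of n] unfolding M_def g1[symmetric] by (simp add: abs_mult mult_left_mono)
  define F where "F t = (\<Sum>n. b n * g n t)" for t
  have F_sums: "(\<lambda>n. b n * g n t) sums F t" if "t \<in> {a..1}" for t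
    unfolding F_def by (intro summable_sums summable_comparison_test[OF _ M] exI[of _ 0] allI impI g_le_M[OF that])
  have "uniform_limit {a..1} (\<lambda>N t. \<Sum>n<N. b n * g n t) F sequentially"
    using Weierstrass_m_test[of "{a..1}" "\<lambda>n t. b n * g n t" M, OF g_le_M M] unfolding F_def[abs_def] .
  then have F: "continuous_on {a..1} F"
    by (rule uniform_limit_theorem[rotated]) (auto intro!: always_eventually continuous_intros simp: g_def)
  have pdF: "posdef S' (\<lambda>x y. F (\<tau>' x y))"
  proof (rule posdef_limit)
    show "posdef S' (\<lambda>x y. \<Sum>n<N. b n * g n (\<tau>' x y))" for N
      unfolding g_def by (intro posdef_sum posdef_scale b schur_multiplier_posdef L_multiplier)
    show "(\<lambda>N. \<Sum>n<N. b n * g n (\<tau>' x y)) \<longlonglongrightarrow> F (\<tau>' x y)" if "x \<in> S'" "y \<in> S'" for x y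
      using F_sums[OF Y.\<tau>_range[OF that]] unfolding sums_def .
  qed
  have "\<exists>D. (K has_real_derivative D) (at t) \<and> (1 - t) * (t - a) * D = (\<alpha> * (t - a) - \<beta> * (1 - t)) * K t - F t"
    if t: "t \<in> {a<..<1}" for t
  proof -
    define I where "I = {(a + t) / 2..(1 + t) / 2}"
    have I: "I \<subseteq> {a<..<1}" "t \<in> interior I" "t \<in> I" using t by (auto simp: I_def field_simps)
    define d where "d n s = b n * poly (pderiv (X.\<pi> n)) s" for n s
    \<comment> \<open>A lower bound of \<open>(1 - s) (s - a)\<close> on I.\<close>
    define m where "m = (1 - t) / 2 * ((t - a) / 2)"
    have m: "0 < m" using t by (simp add: m_def)
    \<comment> \<open>An upper bound of the factor of \<open>poly p t\<close> in \<open>poly_L\<close>.\<close>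
    define B where "B = (\<bar>\<alpha>\<bar> + \<bar>\<beta>\<bar>) * (1 - a)"
    define M' where "M' n = (B * (b n * poly (X.\<pi> n) 1) + M n) / m" for n
    have M': "summable M'" unfolding M'_def by (intro summable_divide summable_add summable_mult sum1 M)
    have eq: "(1 - s) * (s - a) * d n s = (\<alpha> * (s - a) - \<beta> * (1 - s)) * (b n * poly (X.\<pi> n) s) - b n * g n s" for n s
      by (simp add: d_def g_def poly_L algebra_simps)
    have d_le: "norm (d n s) \<le> M' n" if s: "s \<in> I" for n s
    proof -
      have s': "s \<in> {a..1}" "a < s" "s < 1" using s I(1) by auto
      have "m \<le> (1 - s) * (s - a)" unfolding m_def
        using s t by (intro mult_mono) (auto simp: I_def field_simps)
      then have "m * \<bar>d n s\<bar> \<le> \<bar>(1 - s) * (s - a) * d n s\<bar>"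
        using s' by (simp add: abs_mult mult_right_mono)
      also have "\<dots> \<le> \<bar>(\<alpha> * (s - a) - \<beta> * (1 - s)) * (b n * poly (X.\<pi> n) s)\<bar> + \<bar>b n * g n s\<bar>"
        unfolding eq by linarith
      also have "\<dots> \<le> B * (b n * poly (X.\<pi> n) 1) + M n"
      proof (intro add_mono)
        have "\<bar>\<alpha> * (s - a) - \<beta> * (1 - s)\<bar> \<le> \<bar>\<alpha>\<bar> * (s - a) + \<bar>\<beta>\<bar> * (1 - s)"
          using s' abs_triangle_ineq4[of "\<alpha> * (s - a)" "\<beta> * (1 - s)"] by (simp add: abs_mult)
        also have "\<dots> \<le> B" unfolding B_def distrib_right
          using s' by (intro add_mono mult_left_mono) auto
        finally have "\<bar>\<alpha> * (s - a) - \<beta> * (1 - s)\<bar> \<le> B" .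
        moreover have "\<bar>b n * poly (X.\<pi> n) s\<bar> \<le> b n * poly (X.\<pi> n) 1"
          using X.\<pi>_bound[OF s'(1), of n] b[of n] by (simp add: abs_mult mult_left_mono)
        ultimately show "\<bar>(\<alpha> * (s - a) - \<beta> * (1 - s)) * (b n * poly (X.\<pi> n) s)\<bar> \<le> B * (b n * poly (X.\<pi> n) 1)"
          unfolding abs_mult[of "\<alpha> * (s - a) - \<beta> * (1 - s)"] by (intro mult_mono) auto
      qed (use g_le_M[OF s'(1), of n] in simp)
      finally show ?thesis using m by (simp add: M'_def field_simps)
    qed
    have deriv: "((\<lambda>t. \<Sum>n. b n * poly (X.\<pi> n) t) has_real_derivative (\<Sum>n. d n t)) (at t)"
    proof (rule has_field_derivative_series'(2))
      show "convex I" by (simp add: I_def)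
      show "((\<lambda>s. b n * poly (X.\<pi> n) s) has_real_derivative d n s) (at s within I)" for n s
        unfolding d_def by (auto intro!: derivative_eq_intros poly_DERIV[THEN DERIV_subset])
      show "uniformly_convergent_on I (\<lambda>N s. \<Sum>n<N. d n s)"
        by (rule Weierstrass_m_test'[OF d_le M'])
      show "summable (\<lambda>n. b n * poly (X.\<pi> n) t)" using K_sums[of t] t by (auto simp: sums_iff)
    qed (use I in auto)
    have "eventually (\<lambda>s. (\<Sum>n. b n * poly (X.\<pi> n) s) = K s) (nhds t)"
      using t K_sums by (intro eventually_mono[OF eventually_nhds_in_open[of "{a<..<1}" t]]) (auto simp: sums_iff)
    then have "(K has_real_derivative (\<Sum>n. d n t)) (at t)"
      using deriv DERIV_cong_ev[OF refl, of "\<lambda>t. \<Sum>n. b n * poly (X.\<pi> n) t" K t _ _ , OF _ refl] by simp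
    moreover have "(1 - t) * (t - a) * (\<Sum>n. d n t) = (\<alpha> * (t - a) - \<beta> * (1 - t)) * K t - F t"
    proof -
      have "summable (\<lambda>n. d n t)"
        by (intro summable_comparison_test[OF _ M'] exI[of _ 0] allI impI d_le I)
      then have "(\<lambda>n. (1 - t) * (t - a) * d n t) sums ((1 - t) * (t - a) * (\<Sum>n. d n t))"
        by (intro sums_mult summable_sums)
      moreover have "(\<lambda>n. (1 - t) * (t - a) * d n t) sums ((\<alpha> * (t - a) - \<beta> * (1 - t)) * K t - F t)"
        unfolding eq using t by (intro sums_diff sums_mult K_sums F_sums) auto
      ultimately show ?thesis by (rule sums_unique2)
    qed
    ultimately show ?thesis by blast
  qed
  with F pdF that show thesis by blast
qed

end

section \<open>Gauss--Hermite quadrature\<close>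

text \<open>The moments of the standard normal law. Only polynomials are integrated against this law,
  so it is represented by the linear functional \<open>gauss\<close> that its moments determine.\<close>

fun gauss_moment :: "nat \<Rightarrow> real" where
  "gauss_moment 0 = 1"
| "gauss_moment (Suc 0) = 0"
| "gauss_moment (Suc (Suc k)) = real (Suc k) * gauss_moment k"

definition gauss :: "real poly \<Rightarrow> real" where
  "gauss p = (\<Sum>k\<le>degree p. coeff p k * gauss_moment k)"

lemma gauss_eq: "degree p \<le> n \<Longrightarrow> gauss p = (\<Sum>k\<le>n. coeff p k * gauss_moment k)"
  unfolding gauss_def by (intro sum.mono_neutral_left) (auto simp: coeff_eq_0)

lemma gauss_add: "gauss (p + q) = gauss p + gauss q"
  using gauss_eq[of p "max (degree p) (degree q)"] gauss_eq[of q "max (degree p) (degree q)"]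
    gauss_eq[OF degree_add_le_max, of p q]
  by (simp add: distrib_right sum.distrib)

lemma gauss_smult: "gauss (smult c p) = c * gauss p"
  using gauss_eq[OF degree_smult_le, of c p] by (simp add: gauss_def sum_distrib_left mult.assoc)

lemma gauss_zero [simp]: "gauss 0 = 0"
  by (simp add: gauss_def)

lemma gauss_diff: "gauss (p - q) = gauss p - gauss q"
  using gauss_add[of "p - q" q] by simp

lemma gauss_sum: "gauss (\<Sum>i\<in>A. f i) = (\<Sum>i\<in>A. gauss (f i))"
  by (induction A rule: infinite_finite_induct) (auto simp: gauss_add)

lemma gauss_monom [simp]: "gauss (monom c k) = c * gauss_moment k"
proof -
  have "gauss (monom c k) = (\<Sum>j\<le>k. if j = k then c * gauss_moment k else 0)"
    unfolding gauss_eq[OF degree_monom_le] by (intro sum.cong) auto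
  then show ?thesis by simp
qed

lemma pderiv_sum: "pderiv (\<Sum>i\<in>A. f i) = (\<Sum>i\<in>A. pderiv (f i))"
  by (induction A rule: infinite_finite_induct) (auto simp: pderiv_add)

lemma gauss_const: "gauss [:c:] = c"
  by (simp add: gauss_def)

text \<open>Stein's identity, that is, integration by parts for the Gaussian density.\<close>

lemma gauss_stein: "gauss ([:0, 1:] * p) = gauss (pderiv p)"
proof -
  have "gauss ([:0, 1:] * monom c k) = gauss (pderiv (monom c k))" for c k
  proof -
    have "[:0, 1:] * monom c k = monom c (Suc k)" by (simp add: monom_Suc)
    then show ?thesis by (cases k) (auto simp: pderiv_monom)
  qed
  moreover have "[:0, 1:] * p = (\<Sum>k\<le>degree p. [:0, 1:] * monom (coeff p k) k)"
    by (metis poly_as_sum_of_monoms sum_distrib_left)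
  moreover have "pderiv p = (\<Sum>k\<le>degree p. pderiv (monom (coeff p k) k))"
    by (metis poly_as_sum_of_monoms pderiv_sum)
  ultimately show ?thesis by (simp only: gauss_sum)
qed

fun hermite :: "nat \<Rightarrow> real poly" where
  "hermite 0 = 1"
| "hermite (Suc n) = [:0, 1:] * hermite n - pderiv (hermite n)"

lemma hermite_degree: "degree (hermite n) = n" and hermite_monic: "coeff (hermite n) n = 1"
proof -
  have "degree (hermite n) = n \<and> coeff (hermite n) n = 1"
  proof (induction n)
    case (Suc n)
    have c: "coeff (hermite (Suc n)) (Suc n) = 1"
      using Suc by (simp add: coeff_pderiv coeff_eq_0)
    have "degree ([:0, 1:] * hermite n) \<le> Suc n"
      using Suc by (intro order_trans[OF degree_mult_le]) simp
    moreover have "degree (pderiv (hermite n)) \<le> Suc n" using Suc by (simp add: degree_pderiv)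
    ultimately have "degree (hermite (Suc n)) \<le> Suc n"
      unfolding hermite.simps by (rule degree_diff_le)
    moreover have "Suc n \<le> degree (hermite (Suc n))" using c by (intro le_degree) simp
    ultimately show ?case using c by (simp only: le_antisym)
  qed simp
  then show "degree (hermite n) = n" "coeff (hermite n) n = 1" by auto
qed

text \<open>The operator \<open>p \<mapsto> x p - p'\<close> that generates the Hermite polynomials is adjoint to
  differentiation.\<close>

lemma gauss_hermite_mult: "gauss (hermite n * q) = gauss ((pderiv ^^ n) q)"
proof (induction n arbitrary: q)
  case (Suc n)
  have "hermite (Suc n) * q = [:0, 1:] * (hermite n * q) - pderiv (hermite n) * q"
    by (simp add: algebra_simps)
  then have "gauss (hermite (Suc n) * q) = gauss (pderiv (hermite n * q)) - gauss (pderiv (hermite n) * q)"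
    by (simp only: gauss_diff gauss_stein)
  also have "\<dots> = gauss (hermite n * pderiv q)"
    by (simp add: pderiv_mult gauss_add mult.commute)
  finally show ?case by (simp add: Suc funpow_swap1)
qed simp

lemma higher_pderiv_const: "degree p \<le> n \<Longrightarrow> (pderiv ^^ n) p = [:fact n * coeff p n:]" for p :: "real poly"
proof (induction n arbitrary: p)
  case 0
  then show ?case by (auto elim: degree_eq_zeroE)
next
  case (Suc n)
  have "degree (pderiv p) \<le> n" using Suc.prems by (simp add: degree_pderiv)
  then have "(pderiv ^^ n) (pderiv p) = [:fact n * coeff (pderiv p) n:]" by (rule Suc.IH)
  then show ?case by (simp add: funpow_swap1 coeff_pderiv algebra_simps)
qed

lemma gauss_hermite_top: "degree q \<le> n \<Longrightarrow> gauss (hermite n * q) = fact n * coeff q n"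
  by (simp add: gauss_hermite_mult higher_pderiv_const gauss_const)

text \<open>The Hermite polynomials are orthogonal with positive norms; split off the component of
  highest degree.\<close>

lemma gauss_square_nonneg: "0 \<le> gauss (q * q)"
proof -
  have "0 \<le> gauss (q * q)" if "degree q < n" for n and q :: "real poly"
    using that
  proof (induction n arbitrary: q)
    case (Suc n)
    define c where "c = coeff q n"
    define r where "r = q - smult c (hermite n)"
    have c0: "coeff r n = 0" by (simp add: r_def c_def hermite_monic)
    have "degree r \<le> n" unfolding r_def using Suc.prems by (intro degree_diff_le) (auto simp: hermite_degree)
    then have r: "degree r < n \<or> r = 0" using c0 by (metis le_neq_implies_less leading_coeff_0_iff)
    have "0 \<le> gauss (r * r)" using r Suc.IH[of r] by auto
    moreover have "gauss (hermite n * r) = 0"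
      using gauss_hermite_top[OF \<open>degree r \<le> n\<close>] c0 by simp
    moreover have "gauss (hermite n * hermite n) = fact n"
      using gauss_hermite_top[of "hermite n" n] by (simp add: hermite_degree hermite_monic)
    moreover have "q * q = r * r + smult (2 * c) (hermite n * r) + smult (c * c) (hermite n * hermite n)"
      by (rule poly_eq_poly_eq_iff[THEN iffD1], rule ext) (simp add: r_def algebra_simps)
    ultimately show ?case by (simp add: gauss_add gauss_smult)
  qed simp
  then show ?thesis by blast
qed

lemma hermite_exp_tendsto_0: "((\<lambda>x. poly p x * exp (- x\<^sup>2 / 2)) \<longlongrightarrow> 0) at_top" for p :: "real poly"
proof (rule tendsto_rabs_zero_cancel, rule tendsto_sandwich[OF _ _ tendsto_const])
  show "((\<lambda>x. (\<Sum>k\<le>degree p. \<bar>coeff p k\<bar> * (x ^ k / exp x))) \<longlongrightarrow> 0) at_top"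
    by (intro tendsto_null_sum tendsto_mult_right_zero tendsto_power_div_exp_0)
  show "\<forall>\<^sub>F x in at_top. 0 \<le> \<bar>poly p x * exp (- x\<^sup>2 / 2)\<bar>" by simp
  show "\<forall>\<^sub>F x in at_top. \<bar>poly p x * exp (- x\<^sup>2 / 2)\<bar> \<le> (\<Sum>k\<le>degree p. \<bar>coeff p k\<bar> * (x ^ k / exp x))"
    using eventually_ge_at_top[of "2 :: real"]
  proof eventually_elim
    case (elim x)
    have "x \<le> x\<^sup>2 / 2" using elim by (simp add: power2_eq_square)
    then have "exp (- x\<^sup>2 / 2) \<le> 1 / exp x" by (simp add: exp_minus[symmetric] inverse_eq_divide[symmetric])
    moreover have "\<bar>poly p x\<bar> \<le> (\<Sum>k\<le>degree p. \<bar>coeff p k\<bar> * x ^ k)"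
      unfolding poly_altdef using elim by (intro order_trans[OF sum_abs]) (simp add: abs_mult power_abs)
    ultimately have "\<bar>poly p x\<bar> * exp (- x\<^sup>2 / 2) \<le> (\<Sum>k\<le>degree p. \<bar>coeff p k\<bar> * x ^ k) * (1 / exp x)"
      using elim by (intro mult_mono sum_nonneg) auto
    then show ?case by (simp add: abs_mult sum_distrib_right sum_divide_distrib)
  qed
qed

text \<open>Rolle's theorem on a half-line: the square of a function that vanishes at \<open>r\<close> and at
  infinity has a maximum in between.\<close>

lemma rolle_at_infinity:
  fixes f f' :: "real \<Rightarrow> real"
  assumes f: "\<And>x. (f has_real_derivative f' x) (at x)" and lim: "(f \<longlongrightarrow> 0) at_top" and r: "f r = 0"
  obtains z where "r < z" "f' z = 0"
proof -
  have cont: "continuous_on A f" for A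
    using f by (meson DERIV_isCont continuous_at_imp_continuous_on)
  define x where "x = r + 1"
  show thesis
  proof (cases "f x = 0")
    case True
    then show thesis using MVT2[of r x f f'] f r that by (auto simp: x_def)
  next
    case False
    have "\<forall>\<^sub>F y in at_top. \<bar>f y\<bar> < \<bar>f x\<bar>" using tendstoD[OF lim, of "\<bar>f x\<bar>"] False by (simp add: dist_real_def)
    then obtain M where M: "\<And>y. M \<le> y \<Longrightarrow> \<bar>f y\<bar> < \<bar>f x\<bar>" unfolding eventually_at_top_linorder by blast
    define y where "y = max M (x + 1)"
    have y: "x < y" "\<bar>f y\<bar> < \<bar>f x\<bar>" using M[of y] by (auto simp: y_def)
    obtain z where z: "z \<in> {r..y}" "\<And>u. u \<in> {r..y} \<Longrightarrow> \<bar>f u\<bar> \<le> \<bar>f z\<bar>"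
      using continuous_attains_sup[of "{r..y}" "\<lambda>u. \<bar>f u\<bar>"] y continuous_on_rabs[OF cont] by (auto simp: x_def)
    have fz: "\<bar>f x\<bar> \<le> \<bar>f z\<bar>" using z(2)[of x] y by (simp add: x_def)
    then have "z \<noteq> r" "z \<noteq> y" using y r False by auto
    then have zi: "r < z" "z < y" using z(1) by auto
    have "((\<lambda>u. (f u)\<^sup>2) has_real_derivative 2 * f z * f' z) (at z)"
      by (rule derivative_eq_intros f refl)+ simp
    then have "2 * f z * f' z = 0"
    proof (rule DERIV_local_max[of _ _ _ "min (z - r) (y - z)"])
      show "0 < min (z - r) (y - z)" using zi by simp
      show "\<forall>u. \<bar>z - u\<bar> < min (z - r) (y - z) \<longrightarrow> (f u)\<^sup>2 \<le> (f z)\<^sup>2"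
        using z(2) by (auto simp: abs_le_square_iff[symmetric] abs_less_iff)
    qed
    then show thesis using that zi fz False by auto
  qed
qed

text \<open>The derivative of \<open>He\<^sub>n(x) exp(- x\<^sup>2 / 2)\<close> is \<open>- He\<^sub>n\<^sub>+\<^sub>1(x) exp(- x\<^sup>2 / 2)\<close>. By Rolle's
  theorem it vanishes between two consecutive zeros of \<open>He\<^sub>n\<close>, and also below the first and
  above the last.\<close>

lemma hermite_roots:
  "\<exists>r. (\<forall>i. Suc i < n \<longrightarrow> r i < r (Suc i)) \<and> (\<forall>i<n. poly (hermite n) (r i) = 0)"
proof (induction n)
  case (Suc n)
  show ?case
  proof (cases n)
    case 0
    then show ?thesis by (intro exI[of _ "\<lambda>_. 0"]) simp
  next
    case (Suc m)
    from \<open>\<exists>r. _ r\<close> obtain r where r: "\<And>i. Suc i < n \<Longrightarrow> r i < r (Suc i)" "\<And>i. i < n \<Longrightarrow> poly (hermite n) (r i) = 0"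
      by blast
    define f where "f x = poly (hermite n) x * exp (- x\<^sup>2 / 2)" for x
    define f' where "f' x = - poly (hermite (Suc n)) x * exp (- x\<^sup>2 / 2)" for x
    have f: "(f has_real_derivative f' x) (at x)" for x
      unfolding f_def f'_def by (auto intro!: derivative_eq_intros simp: algebra_simps)
    have f0: "f (r i) = 0" if "i < n" for i using r(2)[OF that] by (simp add: f_def)
    have root: "poly (hermite (Suc n)) z = 0" if "f' z = 0" for z using that by (simp only: f'_def) simp
    have "\<exists>z. f' z = 0 \<and> (i < n \<longrightarrow> z < r i) \<and> (0 < i \<longrightarrow> r (i - 1) < z)" if i: "i \<le> n" for i
    proof -
      consider "i = 0" | j where "i = Suc j" "Suc j < n" | "i = n" "0 < i" using i by (cases i) (auto simp: le_less)
      then show ?thesis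
      proof cases
        case 1
        have "((\<lambda>x. f (- x)) \<longlongrightarrow> 0) at_top"
          using hermite_exp_tendsto_0[of "pcompose (hermite n) [:0, -1:]"] by (simp add: f_def poly_pcompose)
        moreover have "((\<lambda>x. f (- x)) has_real_derivative (- f' (- x))) (at x)" for x
          using DERIV_mirror[of f "f' (- x)" x] f by simp
        moreover have "f (- (- r 0)) = 0" using f0[of 0] Suc by simp
        ultimately obtain z where "- r 0 < z" "- f' (- z) = 0"
          using rolle_at_infinity[of "\<lambda>x. f (- x)" "\<lambda>x. - f' (- x)" "- r 0"] by blast
        then show ?thesis using 1 by (intro exI[of _ "- z"]) auto
      next
        case (2 j)
        obtain z where "r j < z" "z < r (Suc j)" "f' z = 0"
          using MVT2[of "r j" "r (Suc j)" f f'] r(1)[of j] f0[of j] f0[of "Suc j"] 2 f by auto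
        then show ?thesis using 2 by (intro exI[of _ z]) auto
      next
        case 3
        obtain z where "r m < z" "f' z = 0"
          using rolle_at_infinity[OF f, of "r m"] hermite_exp_tendsto_0[of "hermite n"] f0[of m] Suc
          unfolding f_def by auto
        then show ?thesis using 3 Suc by (intro exI[of _ z]) auto
      qed
    qed
    then obtain z where z: "\<And>i. i \<le> n \<Longrightarrow> f' (z i) = 0 \<and> (i < n \<longrightarrow> z i < r i) \<and> (0 < i \<longrightarrow> r (i - 1) < z i)"
      by metis
    have "z i < z (Suc i)" if "i < n" for i
      using z[of i] z[of "Suc i"] that by auto
    then show ?thesis using z root by (intro exI[of _ z]) (auto simp: less_Suc_eq_le)
  qed
qed simp

lemma prod_linear_dvd:
  fixes r :: "nat \<Rightarrow> real"
  assumes "inj_on r {..<n}" "\<And>i. i < n \<Longrightarrow> poly p (r i) = 0"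
  shows "(\<Prod>i<n. [:- r i, 1:]) dvd p"
  using assms
proof (induction n arbitrary: p)
  case (Suc n)
  obtain q where q: "p = [:- r n, 1:] * q" using Suc.prems(2)[of n] by (auto simp: poly_eq_0_iff_dvd elim: dvdE)
  have "poly q (r i) = 0" if "i < n" for i
  proof -
    have "r i \<noteq> r n" using Suc.prems(1) that by (auto simp: inj_on_def)
    then show ?thesis using Suc.prems(2)[of i] that by (simp add: q)
  qed
  then have "(\<Prod>i<n. [:- r i, 1:]) dvd q" using Suc.prems(1) by (intro Suc.IH) (auto simp: inj_on_def)
  from mult_dvd_mono[OF this dvd_refl, of "[:- r n, 1:]"] show ?case
    by (simp only: q prod.lessThan_Suc mult.commute[of "[:- r n, 1:]" q])
qed simp

text \<open>Gaussian quadrature with the \<open>n\<close> zeros of a Hermite polynomial as nodes. A polynomial of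
  degree less than \<open>2 n\<close> that vanishes at the nodes is \<open>He\<^sub>n\<close> times a polynomial of lower
  degree, hence has mean zero. The weight of a node is the mean of its Lagrange polynomial \<open>l\<close>,
  and equally that of \<open>l\<^sup>2\<close>, which is nonnegative.\<close>

lemma gauss_hermite_quadrature:
  obtains n :: nat and w r :: "nat \<Rightarrow> real"
  where "\<And>i. i < n \<Longrightarrow> 0 \<le> w i" "\<And>k. k \<le> m \<Longrightarrow> (\<Sum>i<n. w i * r i ^ k) = gauss_moment k"
proof -
  define n where "n = Suc m"
  obtain r where r: "\<And>i. Suc i < n \<Longrightarrow> r i < r (Suc i)" "\<And>i. i < n \<Longrightarrow> poly (hermite n) (r i) = 0"
    using hermite_roots[of n] by blast
  have mono: "r i < r j" if "i < j" "j < n" for i j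
    using that by (induction j) (auto simp: less_Suc_eq intro: r(1) less_trans)
  have inj: "inj_on r {..<n}"
    by (rule inj_onI) (metis lessThan_iff less_irrefl linorder_neqE_nat mono)
  \<comment> \<open>Up to a constant this is the Hermite polynomial.\<close>
  define W where "W = (\<Prod>i<n. [:- r i, 1:])"
  have W0: "W \<noteq> 0" by (simp add: W_def)
  have degW: "degree W = n" unfolding W_def by (subst degree_prod_eq_sum_degree) auto
  have "W dvd hermite n" unfolding W_def using prod_linear_dvd[OF inj r(2)] by simp
  then obtain s where s: "hermite n = W * s" by (elim dvdE)
  have s0: "s \<noteq> 0" using s hermite_monic[of n] by auto
  have "degree s = 0" using degree_mult_eq[OF W0 s0] s hermite_degree[of n] degW by simp
  then obtain c where c: "s = [:c:]" by (elim degree_eq_zeroE)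
  have W_mult: "gauss (W * q) = 0" if "degree q < n" for q
  proof -
    have "c * gauss (W * q) = gauss (hermite n * q)"
      by (simp add: s c gauss_smult[symmetric] mult.commute)
    also have "\<dots> = 0" using gauss_hermite_top[of q n] that by (simp add: coeff_eq_0)
    finally show ?thesis using s0 c by simp
  qed
  have exact: "gauss p = 0" if "\<And>i. i < n \<Longrightarrow> poly p (r i) = 0" "degree p < 2 * n" for p
  proof (cases "p = 0")
    case False
    have "W dvd p" unfolding W_def using prod_linear_dvd[OF inj] that(1) by blast
    then obtain q where q: "p = W * q" by (elim dvdE)
    have "q \<noteq> 0" using False q by auto
    then have "degree p = n + degree q" using q degree_mult_eq[OF W0] degW by simp
    then have "degree q < n" using that(2) by simp
    then show ?thesis using W_mult q by simp
  qed simp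
  define l where "l i = smult (1 / (\<Prod>j\<in>{..<n} - {i}. r i - r j)) (\<Prod>j\<in>{..<n} - {i}. [:- r j, 1:])" for i
  have l_deg: "degree (l i) \<le> n - 1" if "i < n" for i
    unfolding l_def using that
    by (intro order_trans[OF degree_smult_le]) (subst degree_prod_eq_sum_degree, auto)
  have l_eval: "poly (l i) (r j) = (if i = j then 1 else 0)" if "i < n" "j < n" for i j
  proof (cases "i = j")
    case True
    have "(\<Prod>j\<in>{..<n} - {i}. r i - r j) \<noteq> 0" using inj that by (auto simp: inj_on_def)
    then show ?thesis using True by (simp add: l_def poly_prod)
  next
    case False
    then have "(\<Prod>k\<in>{..<n} - {i}. r j - r k) = 0" using that by (intro prod_zero) auto
    then show ?thesis using False by (simp add: l_def poly_prod)
  qed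
  show thesis
  proof (rule that[of n "\<lambda>i. gauss (l i)" r])
    fix i assume i: "i < n"
    have "gauss (l i * l i - l i) = 0"
    proof (rule exact)
      have "degree (l i * l i - l i) \<le> 2 * (n - 1)"
        using l_deg[OF i] by (intro degree_diff_le order_trans[OF degree_mult_le]) auto
      then show "degree (l i * l i - l i) < 2 * n" using i by linarith
    qed (simp add: l_eval i)
    then show "0 \<le> gauss (l i)" using gauss_square_nonneg[of "l i"] by (simp add: gauss_diff)
  next
    fix k assume k: "k \<le> m"
    have "gauss (monom 1 k - (\<Sum>i<n. smult (r i ^ k) (l i))) = 0"
    proof (rule exact)
      fix j assume j: "j < n"
      have "poly (\<Sum>i<n. smult (r i ^ k) (l i)) (r j) = (\<Sum>i<n. if i = j then r j ^ k else 0)"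
        unfolding poly_sum using l_eval j by (intro sum.cong) auto
      then show "poly (monom 1 k - (\<Sum>i<n. smult (r i ^ k) (l i))) (r j) = 0"
        using j by (simp add: poly_monom)
    next
      have "degree (monom 1 k - (\<Sum>i<n. smult (r i ^ k) (l i))) \<le> m"
      proof (intro degree_diff_le degree_sum_le)
        show "degree (monom 1 k :: real poly) \<le> m" using k by (simp add: degree_monom_eq)
        show "degree (smult (r i ^ k) (l i)) \<le> m" if "i \<in> {..<n}" for i
          using l_deg[of i] that by (intro order_trans[OF degree_smult_le]) (auto simp: n_def)
      qed simp
      then show "degree (monom 1 k - (\<Sum>i<n. smult (r i ^ k) (l i))) < 2 * n" by (simp add: n_def)
    qed
    then show "(\<Sum>i<n. gauss (l i) * r i ^ k) = gauss_moment k"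
      by (simp add: gauss_diff gauss_sum gauss_smult mult.commute)
  qed
qed

section \<open>Cubature on the unit sphere of a Euclidean space\<close>

lemma gauss_moment_odd: "odd k \<Longrightarrow> gauss_moment k = 0"
  by (induction k rule: gauss_moment.induct) auto

lemma gauss_moment_even: "gauss_moment (2 * k) = fact (2 * k) / (2 ^ k * fact k)"
proof (induction k)
  case (Suc k)
  have "fact (2 * Suc k) = (2 * real k + 2) * ((2 * real k + 1) * fact (2 * k))" by (simp add: algebra_simps)
  moreover have "2 ^ Suc k * fact (Suc k) = (2 * real k + 2) * (2 ^ k * fact k)" by (simp add: algebra_simps)
  moreover have "gauss_moment (2 * Suc k) = (2 * real k + 1) * gauss_moment (2 * k)" by simp
  moreover have "2 * real k + 2 \<noteq> 0" by (simp add: add_nonneg_eq_0_iff)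
  ultimately show ?case using Suc by (simp only: mult_divide_mult_cancel_left times_divide_eq_right not_False_eq_True)
qed simp

lemma gauss_moment_even_pos: "0 < gauss_moment (2 * k)"
  by (simp add: gauss_moment_even)

lemma sum_even_terms:
  fixes f :: "nat \<Rightarrow> real"
  assumes "\<And>l. odd l \<Longrightarrow> f l = (0 :: real)"
  shows "(\<Sum>l\<le>2 * h. f l) = (\<Sum>i\<le>h. f (2 * i))"
  by (induction h) (auto simp: assms)

text \<open>The sum of independent centred normal variables of variances \<open>A\<close> and \<open>t\<^sup>2\<close> is normal of
  variance \<open>A + t\<^sup>2\<close>, expressed by moments.\<close>

lemma gauss_moment_convolution:
  assumes "0 \<le> A"
  shows "(\<Sum>l\<le>k. real (k choose l) * (gauss_moment l * sqrt A ^ l) * (gauss_moment (k - l) * t ^ (k - l)))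
    = gauss_moment k * sqrt (A + t\<^sup>2) ^ k"
proof (cases "even k")
  case False
  then have "gauss_moment l = 0 \<or> gauss_moment (k - l) = 0" if "l \<le> k" for l
    using that by (cases "even l") (auto intro: gauss_moment_odd)
  then have "(\<Sum>l\<le>k. real (k choose l) * (gauss_moment l * sqrt A ^ l) * (gauss_moment (k - l) * t ^ (k - l))) = 0"
    by (intro sum.neutral ballI) (metis atMost_iff mult_zero_left mult_zero_right)
  then show ?thesis using False by (simp add: gauss_moment_odd)
next
  case True
  then obtain h where k: "k = 2 * h" by blast
  have pw: "sqrt x ^ (2 * i) = x ^ i" if "0 \<le> x" for x i using that by (simp add: power_mult)
  have c: "real (2 * h choose (2 * i)) * gauss_moment (2 * i) * gauss_moment (2 * (h - i)) =
      gauss_moment (2 * h) * real (h choose i)" if "i \<le> h" for i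
  proof -
    have "(2::real) ^ h = 2 ^ i * 2 ^ (h - i)" using that by (simp flip: power_add)
    moreover have "2 * h - 2 * i = 2 * (h - i)" by simp
    ultimately show ?thesis using that
      unfolding gauss_moment_even by (simp add: binomial_fact field_simps)
  qed
  have "(\<Sum>l\<le>k. real (k choose l) * (gauss_moment l * sqrt A ^ l) * (gauss_moment (k - l) * t ^ (k - l))) =
      (\<Sum>i\<le>h. real (k choose (2 * i)) * (gauss_moment (2 * i) * sqrt A ^ (2 * i)) * (gauss_moment (k - 2 * i) * t ^ (k - 2 * i)))"
    unfolding k by (rule sum_even_terms) (simp add: gauss_moment_odd)
  also have "\<dots> = (\<Sum>i\<le>h. gauss_moment (2 * h) * (real (h choose i) * A ^ i * (t\<^sup>2) ^ (h - i)))"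
  proof (intro sum.cong refl)
    fix i assume "i \<in> {..h}"
    then have i: "i \<le> h" "k - 2 * i = 2 * (h - i)" by (auto simp: k)
    show "real (k choose (2 * i)) * (gauss_moment (2 * i) * sqrt A ^ (2 * i)) * (gauss_moment (k - 2 * i) * t ^ (k - 2 * i)) =
        gauss_moment (2 * h) * (real (h choose i) * A ^ i * (t\<^sup>2) ^ (h - i))"
    proof -
      have "real (k choose (2 * i)) * (gauss_moment (2 * i) * sqrt A ^ (2 * i)) * (gauss_moment (k - 2 * i) * t ^ (k - 2 * i)) =
          (real (2 * h choose (2 * i)) * gauss_moment (2 * i) * gauss_moment (2 * (h - i))) * (A ^ i * (t\<^sup>2) ^ (h - i))"
        unfolding i(2) unfolding pw[OF assms] power_mult[of t 2] k by (simp only: mult_ac)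
      then show ?thesis unfolding c[OF i(1)] by (simp only: mult_ac)
    qed
  qed
  also have "\<dots> = gauss_moment k * (A + t\<^sup>2) ^ h"
    by (simp add: binomial_ring sum_distrib_left k)
  finally show ?thesis using assms by (simp add: k power_mult)
qed

text \<open>A single index for pairs of nodes of a product cubature.\<close>

lemma sum_prod_index:
  fixes N M :: nat
  shows "(\<Sum>j<N * M. f (j div M) (j mod M)) = (\<Sum>p<N. \<Sum>q<M. f p q :: real)"
proof (cases "M = 0")
  case False
  show ?thesis
  proof (induction N)
    case (Suc N)
    have "(\<Sum>j<Suc N * M. f (j div M) (j mod M)) =
        (\<Sum>j<N * M. f (j div M) (j mod M)) + (\<Sum>j\<in>{N * M..<Suc N * M}. f (j div M) (j mod M))"
      by (subst sum.union_disjoint[symmetric]) (auto intro!: sum.cong)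
    also have "(\<Sum>j\<in>{N * M..<Suc N * M}. f (j div M) (j mod M)) = (\<Sum>q<M. f N q)"
    proof (rule sum.reindex_bij_witness[of _ "\<lambda>q. N * M + q" "\<lambda>j. j - N * M"])
      fix j assume "j \<in> {N * M..<Suc N * M}"
      then obtain q where q: "j = N * M + q" "q < M" by (auto dest: le_Suc_ex)
      then show "f N (j - N * M) = f (j div M) (j mod M)" by simp
    qed auto
    finally show ?case using Suc by simp
  qed simp
qed simp

lemma sum_factor:
  "(\<Sum>p\<in>A. \<Sum>q\<in>B. C * X p * (Y q * Z)) = C * (\<Sum>p\<in>A. X p) * ((\<Sum>q\<in>B. Y q) * (Z :: real))"
  by (simp only: sum_distrib_left[of C X] sum_distrib_right[of Y _ Z] sum_product)

text \<open>Product of one-dimensional quadratures: a linear form \<open>v\<close> of a standard Gaussian vector is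
  normal with variance \<open>|v|\<^sup>2\<close>.\<close>

lemma gaussian_cubature:
  assumes "finite I"
  shows "\<exists>N w (g :: nat \<Rightarrow> 'i \<Rightarrow> real). (\<forall>j<N. 0 \<le> w j) \<and>
    (\<forall>k\<le>m. \<forall>v. (\<Sum>j<N. w j * (\<Sum>i\<in>I. g j i * v i) ^ k) = gauss_moment k * sqrt (\<Sum>i\<in>I. (v i)\<^sup>2) ^ k)"
  using assms
proof (induction I rule: finite_induct)
  case empty
  have "gauss_moment k * 0 ^ k = 0 ^ k" for k by (cases k) auto
  then show ?case by (intro exI[of _ 1] exI[of _ "\<lambda>_. 1"] exI[of _ "\<lambda>_ _. 0"]) simp
next
  case (insert e I)
  obtain N w and g :: "nat \<Rightarrow> 'i \<Rightarrow> real" where w: "\<And>j. j < N \<Longrightarrow> 0 \<le> w j"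
    and g: "\<And>k v. k \<le> m \<Longrightarrow> (\<Sum>j<N. w j * (\<Sum>i\<in>I. g j i * v i) ^ k) = gauss_moment k * sqrt (\<Sum>i\<in>I. (v i)\<^sup>2) ^ k"
    using insert.IH by blast
  obtain M and u r :: "nat \<Rightarrow> real" where u: "\<And>j. j < M \<Longrightarrow> 0 \<le> u j"
    and r: "\<And>k. k \<le> m \<Longrightarrow> (\<Sum>j<M. u j * r j ^ k) = gauss_moment k"
    by (rule gauss_hermite_quadrature[of m]) (rule that)
  define w' where "w' j = w (j div M) * u (j mod M)" for j
  define g' where "g' j = (g (j div M))(e := r (j mod M))" for j
  have "0 \<le> w' j" if "j < N * M" for j
  proof -
    have "j div M < N" "j mod M < M" using that by (simp_all add: less_mult_imp_div_less) (metis mod_less_divisor mult_0_right neq0_conv not_less_zero)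
    then show ?thesis unfolding w'_def by (intro mult_nonneg_nonneg w u)
  qed
  moreover have "(\<Sum>j<N * M. w' j * (\<Sum>i\<in>insert e I. g' j i * v i) ^ k) =
      gauss_moment k * sqrt (\<Sum>i\<in>insert e I. (v i)\<^sup>2) ^ k" if k: "k \<le> m" for k v
  proof -
    define a where "a p = (\<Sum>i\<in>I. g p i * v i)" for p
    have in_eq: "(\<Sum>i\<in>insert e I. g' j i * v i) = a (j div M) + r (j mod M) * v e" for j
    proof -
      have "(\<Sum>i\<in>I. g' j i * v i) = a (j div M)"
        unfolding a_def g'_def using insert.hyps by (intro sum.cong) auto
      then show ?thesis using insert.hyps by (simp add: g'_def)
    qed
    have "(\<Sum>j<N * M. w' j * (\<Sum>i\<in>insert e I. g' j i * v i) ^ k) =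
        (\<Sum>p<N. \<Sum>q<M. w p * u q * (a p + r q * v e) ^ k)"
      unfolding in_eq w'_def by (rule sum_prod_index[of "\<lambda>p q. w p * u q * (a p + r q * v e) ^ k"])
    also have "\<dots> = (\<Sum>p<N. \<Sum>q<M. \<Sum>l\<le>k. real (k choose l) * (w p * a p ^ l) * (u q * r q ^ (k - l) * v e ^ (k - l)))"
      by (simp add: binomial_ring sum_distrib_left power_mult_distrib mult_ac)
    also have "\<dots> = (\<Sum>p<N. \<Sum>l\<le>k. \<Sum>q<M. real (k choose l) * (w p * a p ^ l) * (u q * r q ^ (k - l) * v e ^ (k - l)))"
      by (rule sum.cong[OF refl]) (rule sum.swap)
    also have "\<dots> = (\<Sum>l\<le>k. \<Sum>p<N. \<Sum>q<M. real (k choose l) * (w p * a p ^ l) * (u q * r q ^ (k - l) * v e ^ (k - l)))"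
      by (rule sum.swap)
    also have "\<dots> = (\<Sum>l\<le>k. real (k choose l) * (\<Sum>p<N. w p * a p ^ l) * ((\<Sum>q<M. u q * r q ^ (k - l)) * v e ^ (k - l)))"
      by (simp only: sum_factor)
    also have "\<dots> = (\<Sum>l\<le>k. real (k choose l) * (gauss_moment l * sqrt (\<Sum>i\<in>I. (v i)\<^sup>2) ^ l) * (gauss_moment (k - l) * v e ^ (k - l)))"
      using k g[of _ v] r unfolding a_def by (intro sum.cong) auto
    also have "\<dots> = gauss_moment k * sqrt ((\<Sum>i\<in>I. (v i)\<^sup>2) + (v e)\<^sup>2) ^ k"
      by (intro gauss_moment_convolution sum_nonneg) simp
    finally show ?thesis using insert.hyps by (simp add: add.commute)
  qed
  ultimately show ?case by blast
qed

text \<open>The moment of order \<open>2 k\<close> of a coordinate of a uniformly distributed point of the unit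
  sphere in a Euclidean space of dimension \<open>D\<close>.\<close>

definition sphere_moment :: "nat \<Rightarrow> nat \<Rightarrow> real" where
  "sphere_moment D k = (\<Prod>i<k. (2 * real i + 1) / (real D + 2 * real i))"

text \<open>Yields the second partial derivatives of a power \<open>|v|^(2 (k + 1))\<close> of the norm.\<close>

lemma quadratic_power_coeff:
  "coeff ([:A, B, 1:] ^ Suc k) 2 = real (Suc k) * A ^ k + real (Suc k) * real k / 2 * A ^ (k - 1) * B\<^sup>2"
proof (induction k)
  case (Suc k)
  have c0: "coeff ([:A, B, 1:] ^ n) 0 = A ^ n" for n by (induction n) (auto simp: coeff_mult)
  have c1: "coeff ([:A, B, 1:] ^ n) 1 = real n * A ^ (n - 1) * B" for n
  proof (induction n)
    case (Suc n)
    have "coeff ([:A, B, 1:] ^ Suc n) 1 = A * coeff ([:A, B, 1:] ^ n) 1 + B * coeff ([:A, B, 1:] ^ n) 0"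
      by (simp add: coeff_pCons)
    then show ?case using Suc c0[of n] by (cases n) (auto simp: algebra_simps)
  qed simp
  have "coeff ([:A, B, 1:] ^ Suc (Suc k)) 2 = A * coeff ([:A, B, 1:] ^ Suc k) 2 +
      B * coeff ([:A, B, 1:] ^ Suc k) 1 + coeff ([:A, B, 1:] ^ Suc k) 0"
    by (simp only: power_Suc[of _ "Suc k"] mult_pCons_left) (simp add: coeff_pCons numeral_2_eq_2)
  then show ?case unfolding Suc c0 c1 by (cases k) (auto simp: field_simps power2_eq_square)
qed (simp add: numeral_2_eq_2)

text \<open>Take the Laplacian in \<open>v\<close> of both sides of \<open>top\<close>: on the left it brings out the factor
  \<open>\<Sum> (y j i)\<^sup>2 = 1\<close>. Each second partial derivative is read off, without calculus, as the
  quadratic coefficient in the variable \<open>x\<close> after replacing \<open>v\<close> by \<open>v + x e\<close>.\<close>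

lemma laplacian_step:
  fixes y :: "nat \<Rightarrow> 'i \<Rightarrow> real"
  assumes I: "finite I" and unit: "\<And>j. j < N \<Longrightarrow> (\<Sum>i\<in>I. (y j i)\<^sup>2) = 1"
    and top: "\<And>v. (\<Sum>j<N. w j * (\<Sum>i\<in>I. y j i * v i) ^ (2 * Suc k)) = c * (\<Sum>i\<in>I. (v i)\<^sup>2) ^ Suc k"
  shows "(2 * real k + 1) * (\<Sum>j<N. w j * (\<Sum>i\<in>I. y j i * v i) ^ (2 * k)) = c * (real (card I) + 2 * real k) * (\<Sum>i\<in>I. (v i)\<^sup>2) ^ k"
proof -
  define d where "d j = (\<Sum>i\<in>I. y j i * v i)" for j
  define A where "A = (\<Sum>i\<in>I. (v i)\<^sup>2)"
  have e: "real (Suc k) * (2 * real k + 1) * (\<Sum>j<N. w j * d j ^ (2 * k) * (y j e)\<^sup>2) =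
      c * (real (Suc k) * A ^ k + real (Suc k) * real k / 2 * A ^ (k - 1) * (2 * v e)\<^sup>2)" if e: "e \<in> I" for e
  proof -
    have "poly (\<Sum>j<N. smult (w j) ([:d j, y j e:] ^ (2 * Suc k))) x = poly (smult c ([:A, 2 * v e, 1:] ^ Suc k)) x" for x
    proof -
      define v' where "v' = v(e := v e + x)"
      have "(\<Sum>i\<in>I. y j i * v' i) = d j + x * y j e" for j
      proof -
        have "(\<Sum>i\<in>I. y j i * v' i) = (\<Sum>i\<in>I. y j i * v i + (if i = e then x * y j e else 0))"
          by (intro sum.cong) (auto simp: v'_def algebra_simps)
        then show ?thesis using I e by (simp add: sum.distrib d_def)
      qed
      moreover have "(\<Sum>i\<in>I. (v' i)\<^sup>2) = A + x * (2 * v e + x)"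
      proof -
        have "(\<Sum>i\<in>I. (v' i)\<^sup>2) = (\<Sum>i\<in>I. (v i)\<^sup>2 + (if i = e then x * (2 * v e + x) else 0))"
          by (intro sum.cong) (auto simp: v'_def algebra_simps power2_eq_square)
        then show ?thesis using I e by (simp add: sum.distrib A_def)
      qed
      moreover have "poly [:d j, y j e:] x = d j + x * y j e" for j by simp
      moreover have "poly [:A, 2 * v e, 1:] x = A + x * (2 * v e + x)" by simp
      ultimately show ?thesis using top[of v'] by (simp only: poly_sum poly_smult poly_power)
    qed
    then have "(\<Sum>j<N. smult (w j) ([:d j, y j e:] ^ (2 * Suc k))) = smult c ([:A, 2 * v e, 1:] ^ Suc k)"
      by (intro poly_eq_poly_eq_iff[THEN iffD1] ext)
    then have "coeff (\<Sum>j<N. smult (w j) ([:d j, y j e:] ^ (2 * Suc k))) 2 = coeff (smult c ([:A, 2 * v e, 1:] ^ Suc k)) 2"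
      by simp
    moreover have "coeff ([:d j, y j e:] ^ (2 * Suc k)) 2 = real (Suc k) * (2 * real k + 1) * (d j ^ (2 * k) * (y j e)\<^sup>2)" for j
    proof -
      have "real (2 * Suc k choose 2) = real (Suc k) * (2 * real k + 1)"
        by (simp add: choose_two field_simps real_of_nat_div)
      moreover have "2 * Suc k - 2 = 2 * k" by simp
      ultimately have "coeff ([:d j, y j e:] ^ (2 * Suc k)) 2 = (real (Suc k) * (2 * real k + 1)) * y j e ^ 2 * d j ^ (2 * k)"
        using coeff_linear_poly_power[of 2 "2 * Suc k" "d j" "y j e"] by (simp only:) simp
      then show ?thesis by (simp only: mult_ac)
    qed
    ultimately have "(\<Sum>j<N. w j * (real (Suc k) * (2 * real k + 1) * (d j ^ (2 * k) * (y j e)\<^sup>2))) =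
        c * coeff ([:A, 2 * v e, 1:] ^ Suc k) 2"
      by (simp only: coeff_sum coeff_smult)
    then show ?thesis unfolding quadratic_power_coeff by (simp add: sum_distrib_left mult_ac)
  qed
  have "real (Suc k) * (2 * real k + 1) * (\<Sum>j<N. w j * d j ^ (2 * k)) =
      (\<Sum>e\<in>I. real (Suc k) * (2 * real k + 1) * (\<Sum>j<N. w j * d j ^ (2 * k) * (y j e)\<^sup>2))"
  proof -
    have "(\<Sum>e\<in>I. \<Sum>j<N. w j * d j ^ (2 * k) * (y j e)\<^sup>2) = (\<Sum>j<N. \<Sum>e\<in>I. w j * d j ^ (2 * k) * (y j e)\<^sup>2)"
      by (rule sum.swap)
    also have "\<dots> = (\<Sum>j<N. w j * d j ^ (2 * k))"
      using unit by (intro sum.cong) (auto simp flip: sum_distrib_left)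
    finally show ?thesis by (simp flip: sum_distrib_left)
  qed
  also have "\<dots> = (\<Sum>e\<in>I. c * real (Suc k) * A ^ k + c * real (Suc k) * 2 * real k * A ^ (k - 1) * (v e)\<^sup>2)"
    using e by (intro sum.cong) (auto simp: algebra_simps power2_eq_square)
  also have "\<dots> = c * real (Suc k) * A ^ k * real (card I) + c * real (Suc k) * 2 * real k * A ^ (k - 1) * A"
    by (simp add: sum.distrib A_def flip: sum_distrib_left)
  also have "\<dots> = real (Suc k) * (c * (real (card I) + 2 * real k) * A ^ k)"
    by (cases k) (auto simp: algebra_simps)
  finally show ?thesis unfolding d_def A_def by (simp add: mult.assoc del: of_nat_Suc)
qed

text \<open>In the top degree \<open>2 K'\<close> the Gaussian nodes may be projected onto the sphere, with the
  radial factor \<open>n j ^ (2 K')\<close> moved into the weights; \<open>laplacian_step\<close> then goes down to all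
  lower even degrees.\<close>

lemma unit_cubature:
  assumes I: "finite I" "I \<noteq> {}"
  obtains N w and y :: "nat \<Rightarrow> 'i \<Rightarrow> real"
  where "\<And>j. j < N \<Longrightarrow> 0 \<le> w j" "\<And>j. j < N \<Longrightarrow> (\<Sum>i\<in>I. (y j i)\<^sup>2) = 1"
    "\<And>k v. k \<le> K \<Longrightarrow> (\<Sum>j<N. w j * (\<Sum>i\<in>I. y j i * v i) ^ (2 * k)) =
        sphere_moment (card I) k * (\<Sum>i\<in>I. (v i)\<^sup>2) ^ k"
proof -
  \<comment> \<open>The top degree is positive, so that nodes at the origin do not contribute.\<close>
  define K' where "K' = Suc K"
  obtain N w and g :: "nat \<Rightarrow> 'i \<Rightarrow> real" where w: "\<And>j. j < N \<Longrightarrow> 0 \<le> w j"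
    and g: "\<And>v. (\<Sum>j<N. w j * (\<Sum>i\<in>I. g j i * v i) ^ (2 * K')) = gauss_moment (2 * K') * sqrt (\<Sum>i\<in>I. (v i)\<^sup>2) ^ (2 * K')"
    using gaussian_cubature[OF I(1), of "2 * K'"] by blast
  obtain e where e: "e \<in> I" using I by blast
  define n where "n j = sqrt (\<Sum>i\<in>I. (g j i)\<^sup>2)" for j
  have n2: "(n j)\<^sup>2 = (\<Sum>i\<in>I. (g j i)\<^sup>2)" for j unfolding n_def by (simp add: sum_nonneg)
  \<comment> \<open>A node at the origin gets weight zero, so any unit vector will do for it.\<close>
  define y where "y j i = (if n j = 0 then if i = e then 1 else 0 else g j i / n j)" for j i
  define C where "C = sphere_moment (card I) K' / gauss_moment (2 * K')"
  have D: "0 < real (card I)" using I by (simp add: card_gt_0_iff)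
  have "0 \<le> sphere_moment (card I) K'" unfolding sphere_moment_def by (intro prod_nonneg) simp
  then have C: "0 \<le> C" unfolding C_def using gauss_moment_even_pos[of K'] by simp
  define w' where "w' j = C * (w j * n j ^ (2 * K'))" for j
  have unit: "(\<Sum>i\<in>I. (y j i)\<^sup>2) = 1" for j
  proof (cases "n j = 0")
    case True
    then have "(\<Sum>i\<in>I. (y j i)\<^sup>2) = (\<Sum>i\<in>I. if i = e then 1 else 0)" by (intro sum.cong) (auto simp: y_def)
    then show ?thesis using I e by simp
  next
    case False
    have "(\<Sum>i\<in>I. (y j i)\<^sup>2) = (\<Sum>i\<in>I. (g j i)\<^sup>2) / (n j)\<^sup>2"
      using False by (simp add: y_def power_divide sum_divide_distrib)
    also have "\<dots> = (n j)\<^sup>2 / (n j)\<^sup>2" by (simp only: n2)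
    finally show ?thesis using False by simp
  qed
  have scaled: "n j ^ (2 * K') * (\<Sum>i\<in>I. y j i * v i) ^ (2 * K') = (\<Sum>i\<in>I. g j i * v i) ^ (2 * K')" for j v
  proof (cases "n j = 0")
    case True
    then have "\<forall>i\<in>I. g j i = 0" using n2[of j] I(1) by (simp add: sum_nonneg_eq_0_iff)
    then show ?thesis using True by (simp add: K'_def)
  next
    case False
    then have "n j * (\<Sum>i\<in>I. y j i * v i) = (\<Sum>i\<in>I. g j i * v i)" by (simp add: y_def sum_distrib_left)
    then show ?thesis by (metis power_mult_distrib)
  qed
  have top: "(\<Sum>j<N. w' j * (\<Sum>i\<in>I. y j i * v i) ^ (2 * K')) = sphere_moment (card I) K' * (\<Sum>i\<in>I. (v i)\<^sup>2) ^ K'" for v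
  proof -
    have "(\<Sum>j<N. w' j * (\<Sum>i\<in>I. y j i * v i) ^ (2 * K')) = C * (\<Sum>j<N. w j * (\<Sum>i\<in>I. g j i * v i) ^ (2 * K'))"
      unfolding w'_def scaled[symmetric] by (simp add: sum_distrib_left mult.assoc)
    also have "\<dots> = sphere_moment (card I) K' * (\<Sum>i\<in>I. (v i)\<^sup>2) ^ K'"
      unfolding g C_def using gauss_moment_even_pos[of K'] by (simp add: power_mult sum_nonneg)
    finally show ?thesis .
  qed
  have all: "(\<Sum>j<N. w' j * (\<Sum>i\<in>I. y j i * v i) ^ (2 * k)) = sphere_moment (card I) k * (\<Sum>i\<in>I. (v i)\<^sup>2) ^ k"
    if "k \<le> K'" for k v
    using that
  proof (induction k arbitrary: v rule: inc_induct)
    case base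
    show ?case by (rule top)
  next
    case (step k)
    have "(2 * real k + 1) * (\<Sum>j<N. w' j * (\<Sum>i\<in>I. y j i * v i) ^ (2 * k)) =
        sphere_moment (card I) (Suc k) * (real (card I) + 2 * real k) * (\<Sum>i\<in>I. (v i)\<^sup>2) ^ k"
      by (intro laplacian_step I unit step.IH)
    also have "\<dots> = (2 * real k + 1) * (sphere_moment (card I) k * (\<Sum>i\<in>I. (v i)\<^sup>2) ^ k)"
      using D by (simp add: sphere_moment_def)
    finally show ?case by simp
  qed
  show thesis
  proof (rule that[of N w' y])
    show "0 \<le> w' j" if "j < N" for j unfolding w'_def using C w[OF that] by (intro mult_nonneg_nonneg) (auto simp: power_mult)
  qed (use unit all in \<open>auto simp: K'_def\<close>)
qed

section \<open>Means with a density\<close>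

text \<open>Both conditions on polynomials are linear in each of them, so monomials suffice.\<close>

lemma exact_cubature_monomials:
  assumes nodes: "\<And>j. j < N \<Longrightarrow> 0 \<le> w j" "\<And>j. j < N \<Longrightarrow> y j \<in> S"
    and mean: "\<And>k x. k \<le> J \<Longrightarrow> x \<in> S \<Longrightarrow> (\<Sum>j<N. w j * \<tau> x (y j) ^ k) = c k"
    and \<Lambda>: "\<And>p :: real poly. \<Lambda> (poly p) = (\<Sum>k\<le>degree p. coeff p k * c k)"
    and conv: "\<And>k l. k + l \<le> J \<Longrightarrow> \<exists>r. degree r \<le> min k l \<and>
      (\<forall>x\<in>S. \<forall>z\<in>S. (\<Sum>j<N. w j * (\<tau> x (y j) ^ k * \<tau> (y j) z ^ l)) = poly r (\<tau> x z))"
  shows "exact_cubature S \<tau> \<Lambda> J N w y"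
  unfolding exact_cubature_def
proof (intro conjI allI impI)
  fix p :: "real poly" and x assume p: "degree p \<le> J" and x: "x \<in> S"
  have "(\<Sum>j<N. w j * poly p (\<tau> x (y j))) = (\<Sum>j<N. \<Sum>k\<le>degree p. coeff p k * (w j * \<tau> x (y j) ^ k))"
    by (simp add: poly_altdef sum_distrib_left mult_ac)
  also have "\<dots> = (\<Sum>k\<le>degree p. \<Sum>j<N. coeff p k * (w j * \<tau> x (y j) ^ k))" by (rule sum.swap)
  also have "\<dots> = (\<Sum>k\<le>degree p. coeff p k * c k)"
    using mean[OF _ x] p by (intro sum.cong) (auto simp flip: sum_distrib_left)
  finally show "(\<Sum>j<N. w j * poly p (\<tau> x (y j))) = \<Lambda> (poly p)" by (simp add: \<Lambda>)
next
  fix p q :: "real poly" assume pq: "degree p + degree q \<le> J"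
  have "\<forall>k l. \<exists>r. k + l \<le> J \<longrightarrow> degree r \<le> min k l \<and>
      (\<forall>x\<in>S. \<forall>z\<in>S. (\<Sum>j<N. w j * (\<tau> x (y j) ^ k * \<tau> (y j) z ^ l)) = poly r (\<tau> x z))"
    using conv by blast
  then obtain R where R': "\<forall>k l. k + l \<le> J \<longrightarrow> degree (R k l) \<le> min k l \<and>
      (\<forall>x\<in>S. \<forall>z\<in>S. (\<Sum>j<N. w j * (\<tau> x (y j) ^ k * \<tau> (y j) z ^ l)) = poly (R k l) (\<tau> x z))"
    unfolding choice_iff by (elim exE)
  have R: "\<And>k l. k + l \<le> J \<Longrightarrow> degree (R k l) \<le> min k l"
    "\<And>k l x z. k + l \<le> J \<Longrightarrow> x \<in> S \<Longrightarrow> z \<in> S \<Longrightarrow>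
       (\<Sum>j<N. w j * (\<tau> x (y j) ^ k * \<tau> (y j) z ^ l)) = poly (R k l) (\<tau> x z)"
    using R' by simp_all
  define r where "r = (\<Sum>k\<le>degree p. \<Sum>l\<le>degree q. smult (coeff p k * coeff q l) (R k l))"
  show "\<exists>r. degree r \<le> min (degree p) (degree q) \<and>
    (\<forall>x\<in>S. \<forall>z\<in>S. (\<Sum>j<N. w j * (poly p (\<tau> x (y j)) * poly q (\<tau> (y j) z))) = poly r (\<tau> x z))"
  proof (intro exI[of _ r] conjI ballI)
    have "degree (smult (coeff p k * coeff q l) (R k l)) \<le> min (degree p) (degree q)"
      if "k \<le> degree p" "l \<le> degree q" for k l
      using R(1)[of k l] that pq by (intro order_trans[OF degree_smult_le]) auto
    then show "degree r \<le> min (degree p) (degree q)"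
      unfolding r_def by (intro degree_sum_le) auto
    fix x z assume xz: "x \<in> S" "z \<in> S"
    have "(\<Sum>j<N. w j * (poly p (\<tau> x (y j)) * poly q (\<tau> (y j) z))) =
        (\<Sum>j<N. \<Sum>k\<le>degree p. \<Sum>l\<le>degree q. coeff p k * coeff q l * (w j * (\<tau> x (y j) ^ k * \<tau> (y j) z ^ l)))"
      unfolding poly_altdef unfolding sum_product unfolding sum_distrib_left by (intro sum.cong refl) (simp only: mult_ac)
    also have "\<dots> = (\<Sum>k\<le>degree p. \<Sum>j<N. \<Sum>l\<le>degree q. coeff p k * coeff q l * (w j * (\<tau> x (y j) ^ k * \<tau> (y j) z ^ l)))"
      by (rule sum.swap)
    also have "\<dots> = (\<Sum>k\<le>degree p. \<Sum>l\<le>degree q. \<Sum>j<N. coeff p k * coeff q l * (w j * (\<tau> x (y j) ^ k * \<tau> (y j) z ^ l)))"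
      by (rule sum.cong[OF refl]) (rule sum.swap)
    also have "\<dots> = (\<Sum>k\<le>degree p. \<Sum>l\<le>degree q. coeff p k * coeff q l * poly (R k l) (\<tau> x z))"
      using R(2)[OF _ xz] pq by (intro sum.cong refl) (auto simp flip: sum_distrib_left)
    finally show "(\<Sum>j<N. w j * (poly p (\<tau> x (y j)) * poly q (\<tau> (y j) z))) = poly r (\<tau> x z)"
      by (simp add: r_def poly_sum)
  qed
qed (use nodes in auto)

text \<open>The substitution \<open>\<xi>\<close> serves to keep the integrand continuous on the closed interval.\<close>

definition weighted_mean :: "real \<Rightarrow> real \<Rightarrow> (real \<Rightarrow> real) \<Rightarrow> (real \<Rightarrow> real) \<Rightarrow> (real \<Rightarrow> real) \<Rightarrow> real" where
  "weighted_mean u v \<xi> w f = integral {u..v} (\<lambda>s. f (\<xi> s) * w s) / integral {u..v} w"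

locale weight =
  fixes u v a :: real and \<xi> w :: "real \<Rightarrow> real"
  assumes uv: "u < v" and \<xi>: "continuous_on {u..v} \<xi>" "\<xi> ` {u..v} = {a..1}"
    and w: "continuous_on {u..v} w" and w_pos: "\<And>s. s \<in> {u<..<v} \<Longrightarrow> 0 < w s"
begin

abbreviation "\<Lambda> \<equiv> weighted_mean u v \<xi> w"

lemma w_nonneg: "s \<in> {u..v} \<Longrightarrow> 0 \<le> w s"
proof -
  assume s: "s \<in> {u..v}"
  have "s \<in> closure {u<..<v}" using s uv by (simp add: closure_greaterThanLessThan)
  moreover have "continuous_on (closure {u<..<v}) w" using w uv by (simp add: closure_greaterThanLessThan)
  ultimately show ?thesis using continuous_ge_on_closure[of "{u<..<v}" w s 0] w_pos by (simp add: less_imp_le)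
qed

lemma \<xi>_mem: "s \<in> {u..v} \<Longrightarrow> \<xi> s \<in> {a..1}"
  using \<xi>(2) by blast

lemma comp_cont: "continuous_on {a..1} f \<Longrightarrow> continuous_on {u..v} (\<lambda>s. f (\<xi> s))"
  using continuous_on_compose2[OF _ \<xi>(1), of "{a..1}" f] \<xi>(2) by simp

lemma integrand: "continuous_on {a..1} f \<Longrightarrow> continuous_on {u..v} (\<lambda>s. f (\<xi> s) * w s)"
  by (intro continuous_intros comp_cont w)

lemma integral_pos:
  assumes f: "continuous_on {u..v} f" "\<And>s. s \<in> {u..v} \<Longrightarrow> 0 \<le> f s" and s: "s \<in> {u..v}" "0 < f s"
  shows "0 < integral {u..v} (\<lambda>s. f s * w s)"
proof -
  have c: "continuous_on {u..v} (\<lambda>s. f s * w s)" by (intro continuous_intros f w)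
  have nn: "0 \<le> f s * w s" if "s \<in> {u..v}" for s using f(2) w_nonneg that by simp
  have "integral {u..v} (\<lambda>s. f s * w s) \<noteq> 0"
  proof
    assume "integral {u..v} (\<lambda>s. f s * w s) = 0"
    then have 0: "\<forall>s\<in>{u..v}. f s * w s = 0" using integral_eq_0_iff[OF c uv nn] by simp
    have fz: "f t = 0" if "t \<in> {u<..<v}" for t
      using 0 w_pos[OF that] that by (metis greaterThanLessThan_subseteq_atLeastAtMost_iff less_irrefl mult_eq_0_iff order_refl subsetD)
    have "continuous_on (closure {u<..<v}) f" "s \<in> closure {u<..<v}"
      using f(1) s(1) uv by (simp_all add: closure_greaterThanLessThan)
    then have "f s = 0" using continuous_constant_on_closure fz by blast
    then show False using s by simp
  qed
  moreover have "0 \<le> integral {u..v} (\<lambda>s. f s * w s)"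
    using nn by (intro integral_nonneg integrable_continuous_interval c)
  ultimately show ?thesis by simp
qed

lemma total_pos: "0 < integral {u..v} w"
  using integral_pos[of "\<lambda>_. 1" u] uv by simp

lemma mean_linear:
  assumes "continuous_on {a..1} f" "continuous_on {a..1} g"
  shows "\<Lambda> (\<lambda>t. p * f t + q * g t) = p * \<Lambda> f + q * \<Lambda> g"
proof -
  have "(\<lambda>s. (p * f (\<xi> s) + q * g (\<xi> s)) * w s) = (\<lambda>s. p * (f (\<xi> s) * w s) + q * (g (\<xi> s) * w s))"
    by (simp add: algebra_simps)
  moreover have "integral {u..v} (\<lambda>s. p * (f (\<xi> s) * w s) + q * (g (\<xi> s) * w s)) =
      p * integral {u..v} (\<lambda>s. f (\<xi> s) * w s) + q * integral {u..v} (\<lambda>s. g (\<xi> s) * w s)"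
    using assms by (subst integral_add) (auto intro!: integrable_continuous_interval continuous_intros comp_cont w)
  ultimately show ?thesis by (simp add: weighted_mean_def add_divide_distrib)
qed

lemma mean_nonneg:
  assumes "continuous_on {a..1} f" "\<And>t. t \<in> {a..1} \<Longrightarrow> 0 \<le> f t"
  shows "0 \<le> \<Lambda> f"
proof -
  have "0 \<le> integral {u..v} (\<lambda>s. f (\<xi> s) * w s)"
    using assms \<xi>_mem w_nonneg
    by (intro integral_nonneg integrable_continuous_interval integrand mult_nonneg_nonneg) blast+
  then show ?thesis using total_pos by (simp add: weighted_mean_def)
qed

lemma mean_pos:
  assumes "continuous_on {a..1} f" "\<And>t. t \<in> {a..1} \<Longrightarrow> 0 \<le> f t" "t \<in> {a..1}" "0 < f t"
  shows "0 < \<Lambda> f"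
proof -
  obtain s where "s \<in> {u..v}" "\<xi> s = t" using assms(3) \<xi>(2) by (metis imageE)
  then have "0 < integral {u..v} (\<lambda>s. f (\<xi> s) * w s)"
    using assms \<xi>_mem by (intro integral_pos[of "\<lambda>s. f (\<xi> s)" s] comp_cont) blast+
  then show ?thesis using total_pos by (simp add: weighted_mean_def)
qed

lemma mean_poly:
  assumes "\<And>k. \<Lambda> (\<lambda>t. t ^ k) = c k"
  shows "\<Lambda> (poly p) = (\<Sum>k\<le>degree p. coeff p k * c k)"
proof -
  have "\<Lambda> (\<lambda>t. \<Sum>k\<in>A. d k * t ^ k) = (\<Sum>k\<in>A. d k * c k)" if "finite A" for A :: "nat set" and d
    using that
  proof (induction A rule: finite_induct)
    case empty
    show ?case by (simp add: weighted_mean_def)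
  next
    case (insert k A)
    have "\<Lambda> (\<lambda>t. d k * t ^ k + 1 * (\<Sum>k\<in>A. d k * t ^ k)) = d k * \<Lambda> (\<lambda>t. t ^ k) + 1 * \<Lambda> (\<lambda>t. \<Sum>k\<in>A. d k * t ^ k)"
      by (rule mean_linear) (intro continuous_intros)+
    then show ?case using insert assms by simp
  qed
  then show ?thesis by (simp add: poly_altdef[abs_def])
qed

lemma averaged_spaceI:
  assumes "a < 1"
    and "\<And>x y. x \<in> S \<Longrightarrow> y \<in> S \<Longrightarrow> \<tau> x y = \<tau> y x" "\<And>x. x \<in> S \<Longrightarrow> \<tau> x x = 1"
    and "\<And>x y. x \<in> S \<Longrightarrow> y \<in> S \<Longrightarrow> \<tau> x y \<in> {a..1}"
    and "\<And>t. t \<in> {a..1} \<Longrightarrow> \<exists>x\<in>S. \<exists>y\<in>S. \<tau> x y = t"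
    and "\<And>J. \<exists>N w y. exact_cubature S \<tau> \<Lambda> J N w y"
  shows "averaged_space S \<tau> a \<Lambda>"
  by unfold_locales (fact assms mean_linear mean_nonneg mean_pos)+

end

section \<open>Polynomial convolution on spheres\<close>

lemma dot_add_left: "dot n (\<lambda>i. u i + v i) w = dot n u w + dot n v w"
  by (simp add: dot_def inner_add_left sum.distrib)
lemma dot_scale_left: "dot n (\<lambda>i. r *\<^sub>R u i) w = r * dot n u w"
  by (simp add: dot_def sum_distrib_left)
lemma dot_commute: "dot n u v = dot n v u"
  by (simp add: dot_def inner_commute)
lemma dot_add_right: "dot n w (\<lambda>i. u i + v i) = dot n w u + dot n w v"
  by (simp add: dot_def inner_add_right sum.distrib)
lemma dot_scale_right: "dot n w (\<lambda>i. r *\<^sub>R u i) = r * dot n w u"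
  by (simp add: dot_def sum_distrib_left)
lemma dot_self_nonneg: "0 \<le> dot n u u"
  by (simp add: dot_def sum_nonneg)

lemma dot_Cauchy_Schwarz: "\<bar>dot n u v\<bar> \<le> sqrt (dot n u u) * sqrt (dot n v v)"
proof -
  have "\<bar>dot n u v\<bar> \<le> (\<Sum>i\<le>n. norm (u i) * norm (v i))"
    unfolding dot_def by (intro order_trans[OF sum_abs] sum_mono Cauchy_Schwarz_ineq2)
  also have "\<dots> = (\<Sum>i\<le>n. \<bar>norm (u i)\<bar> * \<bar>norm (v i)\<bar>)" by simp
  also have "\<dots> \<le> L2_set (\<lambda>i. norm (u i)) {..n} * L2_set (\<lambda>i. norm (v i)) {..n}"
    by (rule L2_set_mult_ineq)
  finally show ?thesis by (simp add: L2_set_def dot_def power2_norm_eq_inner)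
qed

lemma unit_vectorsD: "u \<in> unit_vectors n \<Longrightarrow> u \<in> coordinate_vectors n" "u \<in> unit_vectors n \<Longrightarrow> dot n u u = 1"
  by (auto simp: unit_vectors_def)

lemma dot_unit_bound: "u \<in> unit_vectors n \<Longrightarrow> v \<in> unit_vectors n \<Longrightarrow> dot n u v \<in> {-1..1}"
  using dot_Cauchy_Schwarz[of n u v] by (auto simp: unit_vectors_def abs_le_iff)

text \<open>The moment of order \<open>k\<close> of a coordinate on the sphere; it vanishes for odd \<open>k\<close> by
  symmetry.\<close>

definition signed_moment :: "nat \<Rightarrow> nat \<Rightarrow> real" where
  "signed_moment D k = (if even k then sphere_moment D (k div 2) else 0)"

lemma sum_lessThan_add: "(\<Sum>j<N + (M :: nat). f j) = (\<Sum>j<N. f j) + (\<Sum>j<M. f (N + j))"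
  by (induction M) (simp_all add: add.assoc)

text \<open>Apply \<open>unit_cubature\<close> to the coordinates, then symmetrise the nodes under \<open>y \<mapsto> - y\<close> to
  obtain the odd degrees.\<close>

lemma sphere_cubature:
  obtains N w and y :: "nat \<Rightarrow> nat \<Rightarrow> 'f::euclidean_space"
  where "\<And>j. j < N \<Longrightarrow> 0 \<le> w j" "\<And>j. j < N \<Longrightarrow> y j \<in> unit_vectors n"
    "\<And>k v. k \<le> J \<Longrightarrow> v \<in> coordinate_vectors n \<Longrightarrow>
       (\<Sum>j<N. w j * dot n (y j) v ^ k) = signed_moment (DIM('f) * Suc n) k * sqrt (dot n v v) ^ k"
proof -
  define I where "I = {..n} \<times> (Basis :: 'f set)"
  have I: "finite I" "I \<noteq> {}" "card I = DIM('f) * Suc n" by (auto simp: I_def card_cartesian_product)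
  obtain N w and g :: "nat \<Rightarrow> nat \<times> 'f \<Rightarrow> real"
    where w: "\<And>j. j < N \<Longrightarrow> 0 \<le> w j" and unit: "\<And>j. j < N \<Longrightarrow> (\<Sum>i\<in>I. (g j i)\<^sup>2) = 1"
    and mom: "\<And>k v. k \<le> J \<Longrightarrow> (\<Sum>j<N. w j * (\<Sum>i\<in>I. g j i * v i) ^ (2 * k)) =
        sphere_moment (card I) k * (\<Sum>i\<in>I. (v i)\<^sup>2) ^ k"
    by (rule unit_cubature[OF I(1,2), of J]) (rule that)
  define z where "z j i = (if i \<le> n then \<Sum>b\<in>Basis. g j (i, b) *\<^sub>R b else 0)" for j i
  have inner: "z j i \<bullet> c = (\<Sum>b\<in>Basis. g j (i, b) * (c \<bullet> b))" if "i \<le> n" for j i c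
    using that by (simp add: z_def inner_sum_left inner_commute[of c])
  have zdot: "dot n (z j) v = (\<Sum>i\<in>I. g j i * (v (fst i) \<bullet> snd i))" for j v
  proof -
    have "dot n (z j) v = (\<Sum>i\<le>n. \<Sum>b\<in>Basis. g j (i, b) * (v i \<bullet> b))"
      unfolding dot_def by (intro sum.cong) (auto simp: inner)
    then show ?thesis by (simp add: I_def sum.cartesian_product case_prod_beta)
  qed
  have vdot: "dot n v v = (\<Sum>i\<in>I. (v (fst i) \<bullet> snd i)\<^sup>2)" for v :: "nat \<Rightarrow> 'f"
  proof -
    have "dot n v v = (\<Sum>i\<le>n. \<Sum>b\<in>Basis. (v i \<bullet> b)\<^sup>2)"
      unfolding dot_def by (simp add: euclidean_inner[of "v _" "v _"] power2_eq_square)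
    then show ?thesis by (simp add: I_def sum.cartesian_product case_prod_beta)
  qed
  have zunit: "z j \<in> unit_vectors n" if "j < N" for j
  proof -
    have "z j i \<bullet> b = g j (i, b)" if "i \<le> n" "b \<in> Basis" for i b
      using that by (simp add: inner inner_Basis if_distrib[of "\<lambda>x. _ * x"] cong: if_cong)
    then have "dot n (z j) (z j) = (\<Sum>i\<in>I. (g j i)\<^sup>2)"
      unfolding vdot by (intro sum.cong) (auto simp: I_def)
    then show ?thesis using unit[OF that] by (simp add: unit_vectors_def coordinate_vectors_def z_def)
  qed
  define w' where "w' j = (if j < N then w j else w (j - N)) / 2" for j
  define y where "y j = (if j < N then z j else (\<lambda>i. - z (j - N) i))" for j
  show thesis
  proof (rule that[of "N + N" w' y])
    show "0 \<le> w' j" if "j < N + N" for j using that w[of j] w[of "j - N"] by (auto simp: w'_def)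
    show "y j \<in> unit_vectors n" if "j < N + N" for j
    proof (cases "j < N")
      case False
      then have "z (j - N) \<in> unit_vectors n" using that by (intro zunit) auto
      then show ?thesis using False by (auto simp: y_def unit_vectors_def coordinate_vectors_def dot_def)
    qed (simp add: y_def zunit)
    fix k and v :: "nat \<Rightarrow> 'f" assume k: "k \<le> J"
    have neg: "dot n (\<lambda>i. - z j i) v = - dot n (z j) v" for j by (simp add: dot_def sum_negf)
    have "(\<Sum>j<N + N. w' j * dot n (y j) v ^ k) =
        (\<Sum>j<N. w j / 2 * dot n (z j) v ^ k) + (\<Sum>j<N. w j / 2 * (- dot n (z j) v) ^ k)"
      unfolding sum_lessThan_add by (simp add: w'_def y_def neg)
    also have "\<dots> = (\<Sum>j<N. w j * (if even k then dot n (z j) v ^ k else 0))"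
      by (cases "even k") (simp_all add: sum_negf flip: sum_divide_distrib)
    also have "\<dots> = signed_moment (DIM('f) * Suc n) k * sqrt (dot n v v) ^ k"
    proof (cases "even k")
      case True
      then obtain h where h: "k = 2 * h" by blast
      have "(\<Sum>j<N. w j * dot n (z j) v ^ k) = sphere_moment (DIM('f) * Suc n) h * (dot n v v) ^ h"
        using mom[of h "\<lambda>i. v (fst i) \<bullet> snd i"] k unfolding h zdot vdot I(3) by simp
      then show ?thesis using dot_self_nonneg[of n v] by (simp add: h signed_moment_def power_mult)
    qed (simp add: signed_moment_def)
    finally show "(\<Sum>j<N + N. w' j * dot n (y j) v ^ k) = signed_moment (DIM('f) * Suc n) k * sqrt (dot n v v) ^ k" .
  qed
qed

text \<open>The coefficient of \<open>x^k\<close> in \<open>(1 + 2 t x + x\<^sup>2)^h\<close>, as a polynomial in \<open>t\<close>.\<close>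

fun quadratic_coeff :: "nat \<Rightarrow> nat \<Rightarrow> real poly" where
  "quadratic_coeff 0 k = (if k = 0 then 1 else 0)"
| "quadratic_coeff (Suc h) k = quadratic_coeff h k +
     (if 1 \<le> k then [:0, 2:] * quadratic_coeff h (k - 1) else 0) +
     (if 2 \<le> k then quadratic_coeff h (k - 2) else 0)"

lemma degree_quadratic_coeff: "degree (quadratic_coeff h k) \<le> k"
proof (induction h arbitrary: k)
  case (Suc h)
  have "degree (if 1 \<le> k then [:0, 2:] * quadratic_coeff h (k - 1) else 0) \<le> k"
    using Suc[of "k - 1"] by (auto intro!: order_trans[OF degree_mult_le])
  moreover have "degree (if 2 \<le> k then quadratic_coeff h (k - 2) else 0) \<le> k"
    using Suc[of "k - 2"] by auto
  ultimately show ?case using Suc[of k] unfolding quadratic_coeff.simps by (intro degree_add_le)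
qed simp

lemma poly_quadratic_coeff: "poly (quadratic_coeff h k) t = coeff ([:1, 2 * t, 1:] ^ h) k"
proof (induction h arbitrary: k)
  case (Suc h)
  show ?case
    by (simp add: Suc coeff_pCons split: nat.splits)
qed simp

definition sphere_convolution :: "nat \<Rightarrow> nat \<Rightarrow> nat \<Rightarrow> real poly" where
  "sphere_convolution D k l = smult (signed_moment D (k + l) / real (k + l choose k)) (quadratic_coeff ((k + l) div 2) k)"

text \<open>Polarisation: the moment identity for \<open>v = z + a x\<close>, where \<open>|v|\<^sup>2 = 1 + 2 t a + a\<^sup>2\<close>, is a
  polynomial identity in \<open>a\<close>. Its coefficient of \<open>a^k\<close> is the convolution of \<open>t^k\<close> and \<open>t^l\<close> up
  to a binomial factor.\<close>

lemma sphere_convolution: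
  assumes mom: "\<And>v. v \<in> coordinate_vectors n \<Longrightarrow> (\<Sum>j<N. w j * dot n (y j) v ^ (k + l)) = signed_moment D (k + l) * sqrt (dot n v v) ^ (k + l)"
    and x: "x \<in> unit_vectors n" and z: "z \<in> unit_vectors n"
  shows "(\<Sum>j<N. w j * (dot n (y j) x ^ k * dot n (y j) z ^ l)) = poly (sphere_convolution D k l) (dot n x z)"
proof -
  define t where "t = dot n x z"
  define h where "h = (k + l) div 2"
  have "poly (\<Sum>j<N. smult (w j) ([:dot n (y j) z, dot n (y j) x:] ^ (k + l))) a =
        poly (smult (signed_moment D (k + l)) ([:1, 2 * t, 1:] ^ h)) a" for a
  proof -
    define v where "v = (\<lambda>i. z i + a *\<^sub>R x i)"
    have "v \<in> coordinate_vectors n" using x z by (simp add: v_def unit_vectors_def coordinate_vectors_def)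
    note m = mom[OF this]
    have vv: "dot n v v = 1 + a * (2 * t + a)" unfolding v_def t_def
      using unit_vectorsD(2)[OF x] unit_vectorsD(2)[OF z]
      by (simp add: dot_add_left dot_add_right dot_scale_left dot_scale_right dot_commute[of n z x] algebra_simps)
    have "signed_moment D (k + l) * sqrt (dot n v v) ^ (k + l) = signed_moment D (k + l) * dot n v v ^ h"
    proof (cases "even (k + l)")
      case True
      then have "k + l = 2 * h" by (simp add: h_def)
      then show ?thesis using dot_self_nonneg[of n v] by (simp only: power_mult) simp
    qed (simp add: signed_moment_def)
    moreover have "dot n (y j) v = dot n (y j) z + a * dot n (y j) x" for j
      by (simp add: v_def dot_add_right dot_scale_right)
    moreover have "poly [:dot n (y j) z, dot n (y j) x:] a = dot n (y j) z + a * dot n (y j) x" for j by simp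
    moreover have "poly [:1, 2 * t, 1:] a = 1 + a * (2 * t + a)" by simp
    ultimately show ?thesis using m vv by (simp only: poly_sum poly_smult poly_power)
  qed
  then have "(\<Sum>j<N. smult (w j) ([:dot n (y j) z, dot n (y j) x:] ^ (k + l))) = smult (signed_moment D (k + l)) ([:1, 2 * t, 1:] ^ h)"
    by (intro poly_eq_poly_eq_iff[THEN iffD1] ext)
  then have "coeff (\<Sum>j<N. smult (w j) ([:dot n (y j) z, dot n (y j) x:] ^ (k + l))) k =
      coeff (smult (signed_moment D (k + l)) ([:1, 2 * t, 1:] ^ h)) k" by simp
  moreover have "coeff ([:dot n (y j) z, dot n (y j) x:] ^ (k + l)) k = real (k + l choose k) * (dot n (y j) x ^ k * dot n (y j) z ^ l)" for j
    using coeff_linear_poly_power[of k "k + l" "dot n (y j) z" "dot n (y j) x"] by simp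
  ultimately have "(\<Sum>j<N. w j * (real (k + l choose k) * (dot n (y j) x ^ k * dot n (y j) z ^ l))) =
      signed_moment D (k + l) * poly (quadratic_coeff h k) t"
    by (simp only: coeff_sum coeff_smult poly_quadratic_coeff)
  then have "real (k + l choose k) * (\<Sum>j<N. w j * (dot n (y j) x ^ k * dot n (y j) z ^ l)) =
      signed_moment D (k + l) * poly (quadratic_coeff h k) t"
    by (simp add: sum_distrib_left mult_ac)
  moreover have "real (k + l choose k) \<noteq> 0" by simp
  ultimately show ?thesis unfolding sphere_convolution_def t_def h_def by (simp add: field_simps)
qed

lemma degree_sphere_convolution: "degree (sphere_convolution D k l) \<le> k"
  unfolding sphere_convolution_def by (intro order_trans[OF degree_smult_le] degree_quadratic_coeff)

text \<open>The degree bound \<open>k\<close> of \<open>degree_sphere_convolution\<close> becomes \<open>min k l\<close> by exchanging \<open>x\<close>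
  and \<open>z\<close>.\<close>

lemma sphere_convolution_min:
  assumes mom: "\<And>v. v \<in> coordinate_vectors n \<Longrightarrow> (\<Sum>j<N. w j * dot n (y j) v ^ (k + l)) = signed_moment D (k + l) * sqrt (dot n v v) ^ (k + l)"
  obtains r where "degree r \<le> min k l"
    "\<And>x z. x \<in> unit_vectors n \<Longrightarrow> z \<in> unit_vectors n \<Longrightarrow> (\<Sum>j<N. w j * (dot n (y j) x ^ k * dot n (y j) z ^ l)) = poly r (dot n x z)"
proof (cases "k \<le> l")
  case True
  then show thesis
    using that[of "sphere_convolution D k l"] degree_sphere_convolution[of D k l] sphere_convolution[OF mom] by simp
next
  case False
  have "(\<Sum>j<N. w j * (dot n (y j) x ^ k * dot n (y j) z ^ l)) = poly (sphere_convolution D l k) (dot n x z)"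
    if "x \<in> unit_vectors n" "z \<in> unit_vectors n" for x z
    using sphere_convolution[where n = n and w = w and y = y and k = l and l = k and N = N and D = D and x = z and z = x] mom that
    by (simp add: add.commute[of l k] dot_commute[of n z x] mult.commute[of "_ ^ k"])
  then show thesis using that[of "sphere_convolution D l k"] degree_sphere_convolution[of D l k] False by simp
qed

section \<open>Means and cubatures on spheres\<close>

lemma signed_moment_Suc_Suc:
  "signed_moment D (Suc (Suc k)) = (real k + 1) / (real D + real k) * signed_moment D k"
  by (auto simp: signed_moment_def sphere_moment_def elim!: evenE)

lemma signed_moment_0_1 [simp]: "signed_moment D 0 = 1" "signed_moment D (Suc 0) = 0"
  by (simp_all add: signed_moment_def sphere_moment_def)

text \<open>The mean of a function of a coordinate on the sphere of dimension \<open>e + 1\<close>. Its density in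
  \<open>t\<close> is proportional to \<open>(1 - t\<^sup>2)^((e - 1) / 2)\<close>; in the angle it is continuous also for
  \<open>e = 0\<close>.\<close>

definition sphere_mean :: "nat \<Rightarrow> (real \<Rightarrow> real) \<Rightarrow> real" where
  "sphere_mean e = weighted_mean 0 pi cos (\<lambda>\<theta>. sin \<theta> ^ e)"

lemma cos_image: "cos ` {0..pi} = {-1..1}"
proof (intro equalityI subsetI)
  fix t :: real assume t: "t \<in> {-1..1}"
  then have "t = cos (arccos t)" "arccos t \<in> {0..pi}" by (auto simp: cos_arccos arccos_lbound arccos_ubound)
  then show "t \<in> cos ` {0..pi}" by blast
qed auto

interpretation sphere_weight: weight 0 pi "-1" cos "\<lambda>\<theta>. sin \<theta> ^ e" for e
  by unfold_locales (auto intro!: continuous_intros simp: cos_image sin_gt_zero)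

text \<open>Integrating the derivative of \<open>cos \<theta>^(k+1) sin \<theta>^(e+1)\<close> gives the recursion in \<open>k\<close>.\<close>

lemma sphere_mean_power: "sphere_mean e (\<lambda>t. t ^ k) = signed_moment (Suc (Suc e)) k"
proof -
  define I where "I k = integral {0..pi} (\<lambda>\<theta>. cos \<theta> ^ k * sin \<theta> ^ e)" for k
  have int: "(\<lambda>\<theta>. cos \<theta> ^ k * sin \<theta> ^ e) integrable_on {0..pi}" for k
    by (intro integrable_continuous_interval continuous_intros)
  have rec: "(real k + real e + 2) * I (Suc (Suc k)) = (real k + 1) * I k" for k
  proof -
    have "((\<lambda>\<theta>. (real k + real e + 2) * (cos \<theta> ^ Suc (Suc k) * sin \<theta> ^ e) - (real k + 1) * (cos \<theta> ^ k * sin \<theta> ^ e))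
        has_integral (cos pi ^ Suc k * sin pi ^ Suc e - cos 0 ^ Suc k * sin 0 ^ Suc e)) {0..pi}"
    proof (rule fundamental_theorem_of_calculus)
      fix \<theta> :: real
      have "((\<lambda>\<theta>. cos \<theta> ^ Suc k * sin \<theta> ^ Suc e) has_real_derivative
         ((1 + real k) * (- sin \<theta> * cos \<theta> ^ k)) * sin \<theta> ^ Suc e + ((1 + real e) * (cos \<theta> * sin \<theta> ^ e)) * cos \<theta> ^ Suc k) (at \<theta> within {0..pi})"
        by (rule has_field_derivative_at_within) (rule DERIV_mult DERIV_power_Suc DERIV_sin DERIV_cos)+
      also have "((1 + real k) * (- sin \<theta> * cos \<theta> ^ k)) * sin \<theta> ^ Suc e + ((1 + real e) * (cos \<theta> * sin \<theta> ^ e)) * cos \<theta> ^ Suc k =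
          real (Suc e) * (cos \<theta> ^ Suc (Suc k) * sin \<theta> ^ e) - real (Suc k) * (cos \<theta> ^ k * sin \<theta> ^ e) * (sin \<theta>)\<^sup>2"
        by (simp add: algebra_simps power2_eq_square)
      also have "\<dots> = (real k + real e + 2) * (cos \<theta> ^ Suc (Suc k) * sin \<theta> ^ e) - (real k + 1) * (cos \<theta> ^ k * sin \<theta> ^ e)"
        unfolding sin_squared_eq by (simp add: algebra_simps power2_eq_square)
      finally show "((\<lambda>\<theta>. cos \<theta> ^ Suc k * sin \<theta> ^ Suc e) has_vector_derivative
          (real k + real e + 2) * (cos \<theta> ^ Suc (Suc k) * sin \<theta> ^ e) - (real k + 1) * (cos \<theta> ^ k * sin \<theta> ^ e)) (at \<theta> within {0..pi})"
        by (simp only: has_real_derivative_iff_has_vector_derivative)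
    qed simp
    then have "0 = integral {0..pi} (\<lambda>\<theta>. (real k + real e + 2) * (cos \<theta> ^ Suc (Suc k) * sin \<theta> ^ e) - (real k + 1) * (cos \<theta> ^ k * sin \<theta> ^ e))"
      by (simp add: integral_unique)
    also have "\<dots> = (real k + real e + 2) * I (Suc (Suc k)) - (real k + 1) * I k"
      unfolding I_def by (subst integral_diff) (auto intro!: integrable_on_mult_right int simp del: power_Suc)
    finally show ?thesis by simp
  qed
  have "((\<lambda>\<theta>. cos \<theta> * sin \<theta> ^ e) has_integral (sin pi ^ Suc e / real (Suc e) - sin 0 ^ Suc e / real (Suc e))) {0..pi}"
  proof (rule fundamental_theorem_of_calculus)
    fix \<theta> :: real
    have "((\<lambda>\<theta>. sin \<theta> ^ Suc e / real (Suc e)) has_real_derivative (1 + real e) * (cos \<theta> * sin \<theta> ^ e) / real (Suc e)) (at \<theta> within {0..pi})"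
      by (rule has_field_derivative_at_within, rule DERIV_cdivide, rule DERIV_power_Suc, rule DERIV_sin)
    moreover have "(1 + real e) * (cos \<theta> * sin \<theta> ^ e) / real (Suc e) = cos \<theta> * sin \<theta> ^ e"
      by (simp add: add_nonneg_eq_0_iff)
    ultimately have "((\<lambda>\<theta>. sin \<theta> ^ Suc e / real (Suc e)) has_real_derivative cos \<theta> * sin \<theta> ^ e) (at \<theta> within {0..pi})"
      by (simp only:)
    then show "((\<lambda>\<theta>. sin \<theta> ^ Suc e / real (Suc e)) has_vector_derivative cos \<theta> * sin \<theta> ^ e) (at \<theta> within {0..pi})"
      by (simp only: has_real_derivative_iff_has_vector_derivative)
  qed simp
  then have I1: "I 1 = 0" unfolding I_def by (simp add: integral_unique)
  have "I k = signed_moment (Suc (Suc e)) k * I 0"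
  proof (induction k rule: gauss_moment.induct)
    case (3 k)
    have "(real k + real e + 2) * I (Suc (Suc k)) = (real k + 1) * (signed_moment (Suc (Suc e)) k * I 0)"
      using rec[of k] 3 by simp
    then show ?case unfolding signed_moment_Suc_Suc by (simp add: field_simps)
  qed (use I1 in auto)
  moreover have "0 < I 0" using sphere_weight.total_pos[of e] by (simp add: I_def)
  ultimately show ?thesis by (simp add: sphere_mean_def weighted_mean_def I_def)
qed

definition plane_vector :: "'f \<Rightarrow> 'f \<Rightarrow> nat \<Rightarrow> 'f::real_inner" where
  "plane_vector p q i = (if i = 0 then p else if i = 1 then q else 0)"

lemma dot_plane:
  assumes "1 \<le> n" shows "dot n (plane_vector p q) v = p \<bullet> v 0 + q \<bullet> v 1"
proof -
  have "dot n (plane_vector p q) v = (\<Sum>i\<in>{0, 1}. plane_vector p q i \<bullet> v i)"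
    unfolding dot_def using assms by (intro sum.mono_neutral_right) (auto simp: plane_vector_def)
  then show ?thesis by (simp add: plane_vector_def)
qed

lemma plane_vector_unit:
  assumes "1 \<le> n" "p \<bullet> p + q \<bullet> q = 1" shows "plane_vector p q \<in> unit_vectors n"
  using assms by (simp add: unit_vectors_def dot_plane coordinate_vectors_def) (simp add: plane_vector_def)

lemma sphere_space:
  assumes "1 \<le> d"
  shows "averaged_space (unit_vectors d :: (nat \<Rightarrow> real) set) (dot d) (-1) (sphere_mean (d - 1))"
  unfolding sphere_mean_def
proof (rule sphere_weight.averaged_spaceI)
  fix t :: real assume t: "t \<in> {-1..1}"
  have "t\<^sup>2 \<le> 1" using t by (simp add: abs_square_le_1 abs_le_iff)
  then have "plane_vector t (sqrt (1 - t\<^sup>2)) \<in> unit_vectors d" "plane_vector (1 :: real) 0 \<in> unit_vectors d"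
    using assms by (intro plane_vector_unit; simp flip: power2_eq_square)+
  moreover have "dot d (plane_vector 1 0) (plane_vector t (sqrt (1 - t\<^sup>2))) = t"
    using assms by (simp add: dot_plane plane_vector_def)
  ultimately show "\<exists>x\<in>(unit_vectors d :: (nat \<Rightarrow> real) set). \<exists>y\<in>unit_vectors d. dot d x y = t" by blast
next
  fix J
  obtain N w and y :: "nat \<Rightarrow> nat \<Rightarrow> real" where w: "\<And>j. j < N \<Longrightarrow> 0 \<le> w j" and y: "\<And>j. j < N \<Longrightarrow> y j \<in> unit_vectors d"
    and mom: "\<And>k v. k \<le> J \<Longrightarrow> v \<in> coordinate_vectors d \<Longrightarrow>
       (\<Sum>j<N. w j * dot d (y j) v ^ k) = signed_moment (DIM(real) * Suc d) k * sqrt (dot d v v) ^ k"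
    by (rule sphere_cubature[where J = J and n = d]) (rule that)
  have D: "DIM(real) * Suc d = Suc (Suc (d - 1))" using assms by simp
  have "exact_cubature (unit_vectors d :: (nat \<Rightarrow> real) set) (dot d) (sphere_weight.\<Lambda> (d - 1)) J N w y"
  proof (rule exact_cubature_monomials[where c = "signed_moment (Suc (Suc (d - 1)))"])
    fix k and x :: "nat \<Rightarrow> real" assume "k \<le> J" "x \<in> unit_vectors d"
    then show "(\<Sum>j<N. w j * dot d x (y j) ^ k) = signed_moment (Suc (Suc (d - 1))) k"
      using mom[of k x] unfolding D by (simp add: unit_vectors_def dot_commute[of d x "y _"])
  next
    fix p :: "real poly"
    show "sphere_weight.\<Lambda> (d - 1) (poly p) = (\<Sum>k\<le>degree p. coeff p k * signed_moment (Suc (Suc (d - 1))) k)"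
      by (rule sphere_weight.mean_poly) (rule sphere_mean_power[unfolded sphere_mean_def])
  next
    fix k l assume kl: "k + l \<le> J"
    obtain r where "degree r \<le> min k l"
      "\<And>x z. x \<in> unit_vectors d \<Longrightarrow> z \<in> unit_vectors d \<Longrightarrow> (\<Sum>j<N. w j * (dot d (y j) x ^ k * dot d (y j) z ^ l)) = poly r (dot d x z)"
      by (rule sphere_convolution_min[where n = d and N = N and w = w and y = y and k = k and l = l, OF mom[OF kl]]) (assumption, rule that)
    then show "\<exists>r. degree r \<le> min k l \<and> (\<forall>x\<in>unit_vectors d. \<forall>z\<in>unit_vectors d.
        (\<Sum>j<N. w j * (dot d x (y j) ^ k * dot d (y j) z ^ l)) = poly r (dot d x z))"
      by (intro exI[of _ r]) (simp add: dot_commute[of d _ "y _"])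
  qed (use w y in auto)
  then show "\<exists>N w y. exact_cubature (unit_vectors d :: (nat \<Rightarrow> real) set) (dot d) (sphere_weight.\<Lambda> (d - 1)) J N w y" by blast
qed ((rule dot_commute | erule unit_vectorsD(2) | (rule dot_unit_bound; assumption) | simp)+)

section \<open>Means and cubatures on projective spaces\<close>

text \<open>The beta law with density proportional to \<open>s^b (1 - s)^e\<close>. With \<open>t = 2 s - 1\<close> its
  orthogonal polynomials are the Jacobi polynomials with parameters \<open>\<alpha> = e\<close> and \<open>\<beta> = b\<close>.\<close>

definition beta_mean :: "nat \<Rightarrow> nat \<Rightarrow> (real \<Rightarrow> real) \<Rightarrow> real" where
  "beta_mean b e = weighted_mean 0 1 (\<lambda>s. s) (\<lambda>s. s ^ b * (1 - s) ^ e)"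

definition beta_moment :: "nat \<Rightarrow> nat \<Rightarrow> nat \<Rightarrow> real" where
  "beta_moment b e k = (\<Prod>i<k. (real b + 1 + real i) / (real b + real e + 2 + real i))"

interpretation beta_weight: weight 0 1 0 "\<lambda>s. s" "\<lambda>s. s ^ b * (1 - s) ^ e" for b e
  by unfold_locales (auto intro!: continuous_intros)

text \<open>Integrating the derivative of \<open>s^(k+b+1) (1 - s)^(e+1)\<close> gives the recursion in \<open>k\<close>.\<close>

lemma beta_mean_power: "beta_mean b e (\<lambda>s. s ^ k) = beta_moment b e k"
proof -
  define I where "I k = integral {0..1 :: real} (\<lambda>s. s ^ k * (s ^ b * (1 - s) ^ e))" for k
  have int: "(\<lambda>s :: real. s ^ k * (s ^ b * (1 - s) ^ e)) integrable_on {0..1}" for k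
    by (intro integrable_continuous_interval continuous_intros)
  have rec: "(real b + 1 + real k) * I k = (real b + real e + 2 + real k) * I (Suc k)" for k
  proof -
    have "((\<lambda>s. (real b + 1 + real k) * (s ^ k * (s ^ b * (1 - s) ^ e)) - (real b + real e + 2 + real k) * (s ^ Suc k * (s ^ b * (1 - s) ^ e)))
        has_integral (1 ^ Suc (k + b) * (1 - 1) ^ Suc e - 0 ^ Suc (k + b) * (1 - 0) ^ Suc e)) {0..1 :: real}"
    proof (rule fundamental_theorem_of_calculus)
      fix s :: real
      have "((\<lambda>s. 1 - s) has_real_derivative -1) (at s)" by (auto intro!: derivative_eq_intros)
      then have "((\<lambda>s. s ^ Suc (k + b) * (1 - s) ^ Suc e) has_real_derivative
         ((1 + real (k + b)) * (1 * s ^ (k + b))) * (1 - s) ^ Suc e + ((1 + real e) * (-1 * (1 - s) ^ e)) * s ^ Suc (k + b)) (at s within {0..1})"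
        by (intro has_field_derivative_at_within[OF DERIV_mult] DERIV_power_Suc DERIV_ident)
      also have "((1 + real (k + b)) * (1 * s ^ (k + b))) * (1 - s) ^ Suc e + ((1 + real e) * (-1 * (1 - s) ^ e)) * s ^ Suc (k + b) =
          (real b + 1 + real k) * (s ^ k * (s ^ b * (1 - s) ^ e)) - (real b + real e + 2 + real k) * (s ^ Suc k * (s ^ b * (1 - s) ^ e))"
        by (simp add: algebra_simps power_add)
      finally show "((\<lambda>s. s ^ Suc (k + b) * (1 - s) ^ Suc e) has_vector_derivative
          (real b + 1 + real k) * (s ^ k * (s ^ b * (1 - s) ^ e)) - (real b + real e + 2 + real k) * (s ^ Suc k * (s ^ b * (1 - s) ^ e))) (at s within {0..1})"
        by (simp only: has_real_derivative_iff_has_vector_derivative)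
    qed simp
    then have "0 = integral {0..1} (\<lambda>s. (real b + 1 + real k) * (s ^ k * (s ^ b * (1 - s) ^ e)) - (real b + real e + 2 + real k) * (s ^ Suc k * (s ^ b * (1 - s) ^ e)))"
      by (simp add: integral_unique)
    also have "\<dots> = (real b + 1 + real k) * I k - (real b + real e + 2 + real k) * I (Suc k)"
      unfolding I_def by (subst integral_diff) (auto intro!: integrable_on_mult_right int simp del: power_Suc)
    finally show ?thesis by simp
  qed
  have "I k = beta_moment b e k * I 0"
  proof (induction k)
    case (Suc k)
    have "(real b + real e + 2 + real k) * I (Suc k) = (real b + 1 + real k) * (beta_moment b e k * I 0)"
      using rec[of k] Suc by simp
    moreover have "real b + real e + 2 + real k \<noteq> 0" by (simp add: add_nonneg_eq_0_iff)
    ultimately show ?case by (simp add: beta_moment_def field_simps)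
  qed (simp add: beta_moment_def)
  moreover have "0 < I 0" using beta_weight.total_pos[of b e] by (simp add: I_def)
  ultimately show ?thesis by (simp add: beta_mean_def weighted_mean_def I_def)
qed

text \<open>The reals, complex numbers and quaternions at once. Multiplication need not be
  commutative, but it is associative and compatible with the norm.\<close>

locale scalars =
  fixes mul :: "'f \<Rightarrow> 'f \<Rightarrow> 'f::euclidean_space" and cj :: "'f \<Rightarrow> 'f" and one :: 'f
  assumes mul_add_right: "mul x (y + z) = mul x y + mul x z"
    and mul_add_left: "mul (x + y) z = mul x z + mul y z"
    and mul_scale_left: "mul (r *\<^sub>R x) y = r *\<^sub>R mul x y"
    and mul_scale_right: "mul x (r *\<^sub>R y) = r *\<^sub>R mul x y"
    and mul_assoc: "mul (mul x y) z = mul x (mul y z)"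
    and norm_mul: "norm (mul x y) = norm x * norm y"
    and adjoint: "mul x y \<bullet> z = y \<bullet> mul (cj x) z"
    and norm_cj: "norm (cj x) = norm x"
    and mul_one: "mul x one = x"
    and norm_one: "norm one = 1"
begin

definition herm :: "nat \<Rightarrow> (nat \<Rightarrow> 'f) \<Rightarrow> (nat \<Rightarrow> 'f) \<Rightarrow> 'f" where
  "herm n x y = (\<Sum>i\<le>n. mul (cj (x i)) (y i))"

definition scale :: "(nat \<Rightarrow> 'f) \<Rightarrow> 'f \<Rightarrow> nat \<Rightarrow> 'f" where
  "scale x c = (\<lambda>i. mul (x i) c)"

text \<open>The squared cosine of the angle between the lines spanned by \<open>x\<close> and \<open>y\<close>. Functions of the
  overlap on unit vectors stand for functions on projective space.\<close>

definition overlap :: "nat \<Rightarrow> (nat \<Rightarrow> 'f) \<Rightarrow> (nat \<Rightarrow> 'f) \<Rightarrow> real" where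
  "overlap n x y = (norm (herm n x y))\<^sup>2"

lemma mul_zero_left: "mul 0 y = 0" using mul_scale_left[of 0 0 y] by simp

lemma mul_sum_left: "mul (\<Sum>i\<in>A. f i) y = (\<Sum>i\<in>A. mul (f i) y)"
  by (induction A rule: infinite_finite_induct) (auto simp: mul_add_left mul_zero_left)

lemma dot_scale: "dot n (scale x c) y = c \<bullet> herm n x y"
  by (simp add: dot_def scale_def herm_def adjoint inner_sum_right)

lemma herm_scale: "herm n x (scale y c) = mul (herm n x y) c"
  by (simp add: herm_def scale_def mul_sum_left mul_assoc)

lemma scale_one: "scale x one = x"
  by (simp add: scale_def mul_one)

lemma dot_scale_self: "dot n (scale x c) (scale x c) = (norm c)\<^sup>2 * dot n x x"
  by (simp add: dot_def scale_def dot_square_norm norm_mul power_mult_distrib sum_distrib_left mult.commute)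

lemma scale_unit: "x \<in> unit_vectors n \<Longrightarrow> norm c = 1 \<Longrightarrow> scale x c \<in> unit_vectors n"
  by (simp add: unit_vectors_def dot_scale_self) (simp add: coordinate_vectors_def scale_def mul_zero_left)

text \<open>Choose the scalar \<open>c = herm n x y\<close>, for which \<open>dot n (scale x c) y\<close> is \<open>|c|\<^sup>2\<close>, and read
  the same number from the other side.\<close>

lemma norm_herm_le: "norm (herm n x y) \<le> norm (herm n y x)"
proof -
  define c where "c = herm n x y"
  have "(norm c)\<^sup>2 = dot n (scale x c) y" by (simp add: dot_scale c_def power2_norm_eq_inner)
  also have "\<dots> = dot n (scale y one) (scale x c)" by (simp add: scale_one dot_commute)
  also have "\<dots> = one \<bullet> mul (herm n y x) c" by (simp add: dot_scale herm_scale)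
  also have "\<dots> \<le> norm one * norm (mul (herm n y x) c)" by (rule norm_cauchy_schwarz)
  finally have "norm c * norm c \<le> norm (herm n y x) * norm c" by (simp add: norm_one norm_mul power2_eq_square)
  then show ?thesis by (cases "norm c = 0") (auto simp: c_def)
qed

lemma overlap_sym: "overlap n x y = overlap n y x"
  unfolding overlap_def using norm_herm_le[of n x y] norm_herm_le[of n y x] by simp

lemma norm_herm_le_1:
  assumes "x \<in> unit_vectors n" "y \<in> unit_vectors n"
  shows "norm (herm n x y) \<le> 1"
proof -
  define c where "c = herm n x y"
  have "(norm c)\<^sup>2 = dot n (scale x c) y" by (simp add: dot_scale c_def power2_norm_eq_inner)
  also have "\<dots> \<le> sqrt (dot n (scale x c) (scale x c)) * sqrt (dot n y y)"
    using dot_Cauchy_Schwarz[of n "scale x c" y] by simp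
  also have "\<dots> = norm c" using assms by (simp add: dot_scale_self unit_vectors_def)
  finally have "norm c * norm c \<le> 1 * norm c" by (simp add: power2_eq_square)
  then show ?thesis by (cases "norm c = 0") (auto simp: c_def)
qed

lemma overlap_range: "x \<in> unit_vectors n \<Longrightarrow> y \<in> unit_vectors n \<Longrightarrow> overlap n x y \<in> {0..1}"
  using norm_herm_le_1 by (simp add: overlap_def power_le_one)

lemma overlap_refl:
  assumes "x \<in> unit_vectors n" shows "overlap n x x = 1"
proof -
  have "1 = dot n (scale x one) x" using assms by (simp add: scale_one unit_vectors_def)
  also have "\<dots> \<le> norm one * norm (herm n x x)" unfolding dot_scale by (rule norm_cauchy_schwarz)
  finally show ?thesis using norm_herm_le_1[OF assms assms] by (simp add: norm_one overlap_def)
qed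

lemma herm_plane:
  assumes "1 \<le> n" shows "herm n (plane_vector p q) v = mul (cj p) (v 0) + mul (cj q) (v 1)"
proof -
  have "mul (cj 0) y = 0" for y using norm_mul[of "cj 0" y] norm_cj[of 0] by simp
  then have "herm n (plane_vector p q) v = (\<Sum>i\<in>{0, 1}. mul (cj (plane_vector p q i)) (v i))"
    unfolding herm_def using assms by (intro sum.mono_neutral_right) (auto simp: plane_vector_def)
  then show ?thesis by (simp add: plane_vector_def)
qed

lemma overlap_extend:
  assumes "x \<in> coordinate_vectors m" "m \<le> n" shows "overlap n x y = overlap m x y"
proof -
  have "mul (cj 0) y = 0" for y using norm_mul[of "cj 0" y] norm_cj[of 0] by simp
  then have "herm n x y = herm m x y"
    unfolding herm_def using assms by (intro sum.mono_neutral_right) (auto simp: coordinate_vectors_def)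
  then show ?thesis by (simp add: overlap_def)
qed

lemma overlap_surj:
  assumes "1 \<le> n" "s \<in> {0..1}"
  shows "\<exists>x\<in>unit_vectors n. \<exists>y\<in>unit_vectors n. overlap n x y = s"
proof -
  have "mul (cj 0) y = 0" for y using norm_mul[of "cj 0" y] norm_cj[of 0] by simp
  then have "overlap n (plane_vector one 0) (plane_vector (sqrt s *\<^sub>R one) (sqrt (1 - s) *\<^sub>R one)) = s"
    using assms by (simp add: overlap_def herm_plane plane_vector_def mul_scale_right norm_mul norm_cj norm_one)
  moreover have "one \<bullet> one = 1" using norm_one by (simp add: norm_eq_1)
  then have "plane_vector one 0 \<in> unit_vectors n" "plane_vector (sqrt s *\<^sub>R one) (sqrt (1 - s) *\<^sub>R one) \<in> unit_vectors n"
    using assms by (intro plane_vector_unit; simp)+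
  ultimately show ?thesis by blast
qed

text \<open>The moments of the overlap. If \<open>c\<close> is the Hermitian product with a random unit vector,
  then \<open>c \<bullet> u\<close>, for an independent random unit scalar \<open>u\<close>, is a coordinate on the sphere of the
  whole vector space; its moments are those of \<open>|c|\<close> times those of a coordinate on the unit
  scalars.\<close>

lemma moment_quotient:
  assumes "DIM('f) = 2 * Suc b" "1 \<le> n"
  shows "sphere_moment (DIM('f) * Suc n) k / sphere_moment DIM('f) k = beta_moment b (Suc b * n - 1) k"
proof -
  have "1 \<le> Suc b * n" using assms(2) by simp
  then have n: "real (Suc b * n - 1) = real (Suc b) * real n - 1" by (simp only: of_nat_diff of_nat_mult of_nat_1)
  have "sphere_moment (DIM('f) * Suc n) k / sphere_moment DIM('f) k =
      (\<Prod>i<k. ((2 * real i + 1) / (real (DIM('f) * Suc n) + 2 * real i)) / ((2 * real i + 1) / (real DIM('f) + 2 * real i)))"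
    unfolding sphere_moment_def by (rule prod_dividef[symmetric])
  also have "\<dots> = beta_moment b (Suc b * n - 1) k"
    unfolding beta_moment_def
  proof (intro prod.cong refl)
    fix i
    define m where "m = real (Suc b)"
    have m: "0 < m" by (simp add: m_def)
    have "2 * real i + 1 \<noteq> 0" by (simp add: add_nonneg_eq_0_iff)
    then have "((2 * real i + 1) / (real (DIM('f) * Suc n) + 2 * real i)) / ((2 * real i + 1) / (real DIM('f) + 2 * real i)) =
        (real DIM('f) + 2 * real i) / (real (DIM('f) * Suc n) + 2 * real i)" by simp
    also have "\<dots> = (2 * (m + real i)) / (2 * (m * (real n + 1) + real i))"
      unfolding assms(1) by (simp add: m_def algebra_simps)
    also have "\<dots> = (m + real i) / (m * (real n + 1) + real i)" by (rule mult_divide_mult_cancel_left) simp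
    finally show "((2 * real i + 1) / (real (DIM('f) * Suc n) + 2 * real i)) / ((2 * real i + 1) / (real DIM('f) + 2 * real i)) =
        (real b + 1 + real i) / (real b + real (Suc b * n - 1) + 2 + real i)"
      unfolding n by (simp add: m_def algebra_simps)
  qed
  finally show ?thesis .
qed

text \<open>A cubature on the sphere of degree \<open>2 J\<close> serves as one of degree \<open>J\<close> for the overlap:
  \<open>overlap n x z ^ k\<close> is, up to the constant \<open>\<gamma> k\<close>, the average of \<open>dot n (scale x u) z ^ (2 k)\<close>
  over unit scalars \<open>u\<close>, and the average over \<open>u\<close> is itself a finite sum, namely a cubature on
  the unit scalars. In the convolution both factors are averaged; the average of a power of the
  resulting inner product over the unit scalars is again a power of the overlap, and odd powers
  average to zero. The assumption on the dimension ensures that \<open>b\<close> is an integer; it excludes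
  only the real scalars.\<close>

lemma projective_space_averaged:
  assumes b: "DIM('f) = 2 * Suc b" and n: "1 \<le> n"
  shows "averaged_space (unit_vectors n :: (nat \<Rightarrow> 'f) set) (overlap n) 0 (beta_mean b (Suc b * n - 1))"
  unfolding beta_mean_def
proof (rule beta_weight.averaged_spaceI)
  fix J
  obtain N w and y :: "nat \<Rightarrow> nat \<Rightarrow> 'f" where w: "\<And>j. j < N \<Longrightarrow> 0 \<le> w j" and y: "\<And>j. j < N \<Longrightarrow> y j \<in> unit_vectors n"
    and mom: "\<And>k v. k \<le> 2 * J \<Longrightarrow> v \<in> coordinate_vectors n \<Longrightarrow>
       (\<Sum>j<N. w j * dot n (y j) v ^ k) = signed_moment (DIM('f) * Suc n) k * sqrt (dot n v v) ^ k"
    by (rule sphere_cubature[where J = "2 * J" and n = n]) (rule that)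
  obtain M p and u' :: "nat \<Rightarrow> nat \<Rightarrow> 'f" where p: "\<And>a. a < M \<Longrightarrow> 0 \<le> p a" and u': "\<And>a. a < M \<Longrightarrow> u' a \<in> unit_vectors 0"
    and mom0: "\<And>k v. k \<le> 2 * J \<Longrightarrow> v \<in> coordinate_vectors 0 \<Longrightarrow>
       (\<Sum>a<M. p a * dot 0 (u' a) v ^ k) = signed_moment (DIM('f) * Suc 0) k * sqrt (dot 0 v v) ^ k"
    by (rule sphere_cubature[where J = "2 * J" and n = 0]) (rule that)
  define u where "u a = u' a 0" for a
  have u: "norm (u a) = 1" if "a < M" for a
    using u'[OF that] by (simp add: u_def unit_vectors_def dot_def norm_eq_1)
  define m where "m = DIM('f)"
  have avg: "(\<Sum>a<M. p a * (u a \<bullet> q) ^ k) = signed_moment m k * norm q ^ k" if "k \<le> 2 * J" for k q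
    using mom0[OF that, of "\<lambda>i. if i = 0 then q else 0"]
    by (simp add: dot_def u_def m_def coordinate_vectors_def norm_eq_sqrt_inner)
  have total: "(\<Sum>a<M. p a) = 1" using avg[of 0 0] by simp
  define \<gamma> where "\<gamma> k = sphere_moment m k" for k
  have \<gamma>: "\<gamma> k > 0" for k unfolding \<gamma>_def sphere_moment_def m_def
    by (intro prod_pos divide_pos_pos; force intro: add_pos_nonneg add_nonneg_pos)
  have pow: "overlap n x z ^ k = (\<Sum>a<M. p a * dot n (scale x (u a)) z ^ (2 * k)) / \<gamma> k" if "k \<le> J" for x z k
    using avg[of "2 * k" "herm n x z"] that \<gamma>[of k]
    by (simp add: dot_scale overlap_def signed_moment_def \<gamma>_def power_mult)
  define D where "D = DIM('f) * Suc n"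
  have "exact_cubature (unit_vectors n) (overlap n) (beta_weight.\<Lambda> b (Suc b * n - 1)) J N w y"
  proof (rule exact_cubature_monomials[where c = "beta_moment b (Suc b * n - 1)"])
    fix k and x :: "nat \<Rightarrow> 'f" assume k: "k \<le> J" and x: "x \<in> unit_vectors n"
    have "(\<Sum>j<N. w j * overlap n x (y j) ^ k) = (\<Sum>j<N. \<Sum>a<M. p a * (w j * dot n (y j) (scale x (u a)) ^ (2 * k))) / \<gamma> k"
      unfolding pow[OF k] by (simp add: sum_divide_distrib sum_distrib_left mult_ac dot_commute)
    also have "(\<Sum>j<N. \<Sum>a<M. p a * (w j * dot n (y j) (scale x (u a)) ^ (2 * k))) =
        (\<Sum>a<M. \<Sum>j<N. p a * (w j * dot n (y j) (scale x (u a)) ^ (2 * k)))" by (rule sum.swap)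
    also have "\<dots> = (\<Sum>a<M. p a * signed_moment D (2 * k))"
    proof (intro sum.cong refl)
      fix a assume "a \<in> {..<M}"
      then have "scale x (u a) \<in> unit_vectors n" using x u by (intro scale_unit) auto
      then show "(\<Sum>j<N. p a * (w j * dot n (y j) (scale x (u a)) ^ (2 * k))) = p a * signed_moment D (2 * k)"
        using mom[of "2 * k" "scale x (u a)"] k by (simp add: unit_vectors_def D_def flip: sum_distrib_left)
    qed
    also have "\<dots> = sphere_moment D k" by (simp add: total signed_moment_def flip: sum_distrib_right)
    finally show "(\<Sum>j<N. w j * overlap n x (y j) ^ k) = beta_moment b (Suc b * n - 1) k"
      using moment_quotient[OF b n, of k] by (simp add: D_def \<gamma>_def m_def)
  next
    fix q :: "real poly"
    show "beta_weight.\<Lambda> b (Suc b * n - 1) (poly q) = (\<Sum>k\<le>degree q. coeff q k * beta_moment b (Suc b * n - 1) k)"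
      by (rule beta_weight.mean_poly) (rule beta_mean_power[unfolded beta_mean_def])
  next
    fix k l assume kl: "k + l \<le> J"
    obtain r where r: "degree r \<le> min (2 * k) (2 * l)"
      and conv: "\<And>x z. x \<in> unit_vectors n \<Longrightarrow> z \<in> unit_vectors n \<Longrightarrow>
        (\<Sum>j<N. w j * (dot n (y j) x ^ (2 * k) * dot n (y j) z ^ (2 * l))) = poly r (dot n x z)"
    proof (rule sphere_convolution_min[where n = n and N = N and w = w and y = y and k = "2 * k" and l = "2 * l" and D = D])
      fix v :: "nat \<Rightarrow> 'f" assume "v \<in> coordinate_vectors n"
      then show "(\<Sum>j<N. w j * dot n (y j) v ^ (2 * k + 2 * l)) = signed_moment D (2 * k + 2 * l) * sqrt (dot n v v) ^ (2 * k + 2 * l)"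
        using kl unfolding D_def by (intro mom) auto
    qed (rule that)
    define h where "h = min k l"
    define R where "R = (\<Sum>i\<le>h. monom (coeff r (2 * i) * \<gamma> i / (\<gamma> k * \<gamma> l)) i)"
    have main: "(\<Sum>j<N. w j * (overlap n x (y j) ^ k * overlap n (y j) z ^ l)) = poly R (overlap n x z)"
      if x: "x \<in> unit_vectors n" and z: "z \<in> unit_vectors n" for x z
    proof -
      define c where "c = herm n x z"
      have "(\<Sum>j<N. w j * (overlap n x (y j) ^ k * overlap n (y j) z ^ l)) =
          (\<Sum>j<N. \<Sum>a<M. \<Sum>a'<M. p a * p a' * (w j * (dot n (y j) (scale x (u a)) ^ (2 * k) * dot n (y j) (scale z (u a')) ^ (2 * l)))) / (\<gamma> k * \<gamma> l)"
        unfolding sum_divide_distrib[of _ "{..<N}"]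
      proof (intro sum.cong refl)
        fix j
        define f where "f a = dot n (y j) (scale x (u a)) ^ (2 * k)" for a
        define g where "g a = dot n (y j) (scale z (u a)) ^ (2 * l)" for a
        have "overlap n x (y j) ^ k = (\<Sum>a<M. p a * f a) / \<gamma> k"
          unfolding f_def using pow[of k x "y j"] kl by (simp add: dot_commute)
        moreover have "overlap n (y j) z ^ l = (\<Sum>a<M. p a * g a) / \<gamma> l"
          unfolding g_def overlap_sym[of n "y j" z] using pow[of l z "y j"] kl by (simp add: dot_commute)
        ultimately have "w j * (overlap n x (y j) ^ k * overlap n (y j) z ^ l) =
            w j * ((\<Sum>a<M. p a * f a) * (\<Sum>a<M. p a * g a)) / (\<gamma> k * \<gamma> l)" by simp
        also have "w j * ((\<Sum>a<M. p a * f a) * (\<Sum>a<M. p a * g a)) = (\<Sum>a<M. \<Sum>a'<M. p a * p a' * (w j * (f a * g a')))"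
          unfolding sum_product unfolding sum_distrib_left by (intro sum.cong refl) (simp only: mult_ac)
        finally show "w j * (overlap n x (y j) ^ k * overlap n (y j) z ^ l) =
            (\<Sum>a<M. \<Sum>a'<M. p a * p a' * (w j * (dot n (y j) (scale x (u a)) ^ (2 * k) * dot n (y j) (scale z (u a')) ^ (2 * l)))) / (\<gamma> k * \<gamma> l)"
          unfolding f_def g_def .
      qed
      also have "(\<Sum>j<N. \<Sum>a<M. \<Sum>a'<M. p a * p a' * (w j * (dot n (y j) (scale x (u a)) ^ (2 * k) * dot n (y j) (scale z (u a')) ^ (2 * l)))) =
          (\<Sum>a<M. \<Sum>j<N. \<Sum>a'<M. p a * p a' * (w j * (dot n (y j) (scale x (u a)) ^ (2 * k) * dot n (y j) (scale z (u a')) ^ (2 * l))))"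
        by (rule sum.swap)
      also have "\<dots> = (\<Sum>a<M. \<Sum>a'<M. \<Sum>j<N. p a * p a' * (w j * (dot n (y j) (scale x (u a)) ^ (2 * k) * dot n (y j) (scale z (u a')) ^ (2 * l))))"
        by (rule sum.cong[OF refl]) (rule sum.swap)
      also have "\<dots> = (\<Sum>a<M. \<Sum>a'<M. p a * p a' * (\<Sum>i\<le>2 * h. coeff r i * (u a \<bullet> mul c (u a')) ^ i))"
      proof (intro sum.cong refl)
        fix a a' assume a: "a \<in> {..<M}" "a' \<in> {..<M}"
        have "scale x (u a) \<in> unit_vectors n" "scale z (u a') \<in> unit_vectors n" using x z u a by (auto intro: scale_unit)
        then have "(\<Sum>j<N. w j * (dot n (y j) (scale x (u a)) ^ (2 * k) * dot n (y j) (scale z (u a')) ^ (2 * l))) =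
            poly r (u a \<bullet> mul c (u a'))"
          using conv by (simp add: dot_scale herm_scale c_def)
        also have "\<dots> = (\<Sum>i\<le>2 * h. coeff r i * (u a \<bullet> mul c (u a')) ^ i)"
          unfolding poly_altdef using r by (intro sum.mono_neutral_left) (auto simp: h_def coeff_eq_0)
        finally show "(\<Sum>j<N. p a * p a' * (w j * (dot n (y j) (scale x (u a)) ^ (2 * k) * dot n (y j) (scale z (u a')) ^ (2 * l)))) =
            p a * p a' * (\<Sum>i\<le>2 * h. coeff r i * (u a \<bullet> mul c (u a')) ^ i)"
          by (simp flip: sum_distrib_left)
      qed
      also have "\<dots> = (\<Sum>a'<M. \<Sum>a<M. p a * p a' * (\<Sum>i\<le>2 * h. coeff r i * (u a \<bullet> mul c (u a')) ^ i))"
        by (rule sum.swap)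
      also have "\<dots> = (\<Sum>a'<M. p a' * (\<Sum>i\<le>2 * h. coeff r i * (signed_moment m i * norm c ^ i)))"
      proof (intro sum.cong refl)
        fix a' assume a': "a' \<in> {..<M}"
        have "(\<Sum>a<M. p a * p a' * (\<Sum>i\<le>2 * h. coeff r i * (u a \<bullet> mul c (u a')) ^ i)) =
            p a' * (\<Sum>a<M. \<Sum>i\<le>2 * h. coeff r i * (p a * (u a \<bullet> mul c (u a')) ^ i))"
          by (simp add: sum_distrib_left mult_ac)
        also have "(\<Sum>a<M. \<Sum>i\<le>2 * h. coeff r i * (p a * (u a \<bullet> mul c (u a')) ^ i)) =
            (\<Sum>i\<le>2 * h. \<Sum>a<M. coeff r i * (p a * (u a \<bullet> mul c (u a')) ^ i))" by (rule sum.swap)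
        also have "\<dots> = (\<Sum>i\<le>2 * h. coeff r i * (signed_moment m i * norm c ^ i))"
        proof (intro sum.cong refl)
          fix i assume "i \<in> {..2 * h}"
          then have "i \<le> 2 * J" using kl by (auto simp: h_def)
          then show "(\<Sum>a<M. coeff r i * (p a * (u a \<bullet> mul c (u a')) ^ i)) = coeff r i * (signed_moment m i * norm c ^ i)"
            using avg[of i "mul c (u a')"] u a' by (simp add: norm_mul flip: sum_distrib_left)
        qed
        finally show "(\<Sum>a<M. p a * p a' * (\<Sum>i\<le>2 * h. coeff r i * (u a \<bullet> mul c (u a')) ^ i)) =
            p a' * (\<Sum>i\<le>2 * h. coeff r i * (signed_moment m i * norm c ^ i))" .
      qed
      also have "\<dots> = (\<Sum>i\<le>2 * h. coeff r i * (signed_moment m i * norm c ^ i))"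
        by (simp add: total flip: sum_distrib_right)
      also have "\<dots> = (\<Sum>i\<le>h. coeff r (2 * i) * (\<gamma> i * overlap n x z ^ i))"
        by (subst sum_even_terms) (auto simp: signed_moment_def \<gamma>_def overlap_def c_def power_mult)
      finally show ?thesis by (simp add: R_def poly_sum poly_monom sum_divide_distrib mult_ac)
    qed
    have "degree R \<le> h"
      unfolding R_def by (intro degree_sum_le) (auto intro: order_trans[OF degree_monom_le])
    then show "\<exists>r. degree r \<le> min k l \<and> (\<forall>x\<in>unit_vectors n. \<forall>z\<in>unit_vectors n.
        (\<Sum>j<N. w j * (overlap n x (y j) ^ k * overlap n (y j) z ^ l)) = poly r (overlap n x z))"
      using main unfolding h_def by blast
  qed (use w y in auto)
  then show "\<exists>N w y. exact_cubature (unit_vectors n) (overlap n) (beta_weight.\<Lambda> b (Suc b * n - 1)) J N w y" by blast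
qed (auto intro: overlap_sym overlap_refl overlap_surj[OF n] dest: overlap_range)

end

section \<open>Pairs of spaces\<close>

lemma poly_additive_induct [case_names zero monom add]:
  fixes p :: "real poly"
  assumes "P 0" "\<And>c k. P (monom c k)" "\<And>p q. P p \<Longrightarrow> P q \<Longrightarrow> P (p + q)"
  shows "P p"
proof -
  have "P (\<Sum>k\<in>A. monom (coeff p k) k)" if "finite A" for A
    using that by (induction A rule: finite_induct) (auto intro: assms)
  then show ?thesis by (metis poly_as_sum_of_monoms finite_atMost)
qed

context averaged_space
begin

lemma \<Lambda>_two_powers: "\<Lambda> (\<lambda>t. u * t ^ i + v * t ^ j) = u * \<Lambda> (\<lambda>t. t ^ i) + v * \<Lambda> (\<lambda>t. t ^ j)"
  by (intro \<Lambda>_linear continuous_intros)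

text \<open>Reduces the Pearson equation to a recursion between three consecutive moments.\<close>

lemma pearsonI:
  assumes "\<And>k. (\<alpha> + \<beta> + real k) * \<Lambda> (\<lambda>t. t ^ Suc k) - (\<alpha> * a + \<beta> + real k * (1 + a)) * \<Lambda> (\<lambda>t. t ^ k)
     + real k * a * \<Lambda> (\<lambda>t. t ^ (k - 1)) = 0"
  shows "\<Lambda> (poly ([:- \<alpha> * a - \<beta>, \<alpha> + \<beta>:] * p - [:- a, 1 + a, -1:] * pderiv p)) = 0"
proof (induction p rule: poly_additive_induct)
  case zero
  show ?case by (simp only: mult_zero_right pderiv_0 diff_zero \<Lambda>_poly_zero)
next
  case (monom c k)
  have "poly ([:- \<alpha> * a - \<beta>, \<alpha> + \<beta>:] * monom c k - [:- a, 1 + a, -1:] * pderiv (monom c k)) =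
    (\<lambda>t. c * ((\<alpha> + \<beta> + real k) * t ^ Suc k + (-1) * ((\<alpha> * a + \<beta> + real k * (1 + a)) * t ^ k + (- (real k * a)) * t ^ (k - 1))))"
    by (cases k) (auto simp: fun_eq_iff poly_monom pderiv_monom algebra_simps)
  moreover have "\<Lambda> (\<lambda>t. c * ((\<alpha> + \<beta> + real k) * t ^ Suc k + (-1) * ((\<alpha> * a + \<beta> + real k * (1 + a)) * t ^ k + (- (real k * a)) * t ^ (k - 1)))) =
    c * ((\<alpha> + \<beta> + real k) * \<Lambda> (\<lambda>t. t ^ Suc k) + (-1) * ((\<alpha> * a + \<beta> + real k * (1 + a)) * \<Lambda> (\<lambda>t. t ^ k) + (- (real k * a)) * \<Lambda> (\<lambda>t. t ^ (k - 1))))"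
    by (subst \<Lambda>_scale, intro continuous_intros, subst \<Lambda>_linear, intro continuous_intros, intro continuous_intros, subst \<Lambda>_two_powers) simp
  ultimately show ?case using assms[of k] by (simp only:) (simp add: algebra_simps)
next
  case (add p q)
  have "[:- \<alpha> * a - \<beta>, \<alpha> + \<beta>:] * (p + q) - [:- a, 1 + a, -1:] * pderiv (p + q) =
    ([:- \<alpha> * a - \<beta>, \<alpha> + \<beta>:] * p - [:- a, 1 + a, -1:] * pderiv p) + ([:- \<alpha> * a - \<beta>, \<alpha> + \<beta>:] * q - [:- a, 1 + a, -1:] * pderiv q)"
    by (simp only: pderiv_add ring_distribs add_diff_add)
  then show ?case using add by (simp only: \<Lambda>_poly_add add_0)
qed

end

text \<open>Reduces the relation between the densities to one between their moments.\<close>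

lemma weightI:
  assumes X: "averaged_space S \<tau> a \<Lambda>" and Y: "averaged_space S' \<tau>' a \<Lambda>'"
    and eq: "\<And>k. (1 + a) * \<Lambda>' (\<lambda>t. t ^ Suc k) - \<Lambda>' (\<lambda>t. t ^ Suc (Suc k)) - a * \<Lambda>' (\<lambda>t. t ^ k) =
      \<kappa> * (r\<^sub>0 * \<Lambda> (\<lambda>t. t ^ k) + r\<^sub>1 * \<Lambda> (\<lambda>t. t ^ Suc k))"
  shows "\<Lambda>' (poly ([:- a, 1 + a, -1:] * p)) = \<kappa> * \<Lambda> (poly ([:r\<^sub>0, r\<^sub>1:] * p))"
proof -
  interpret X: averaged_space S \<tau> a \<Lambda> by (rule X)
  interpret Y: averaged_space S' \<tau>' a \<Lambda>' by (rule Y)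
  show ?thesis
  proof (induction p rule: poly_additive_induct)
    case zero
    show ?case by (simp only: mult_zero_right X.\<Lambda>_poly_zero Y.\<Lambda>_poly_zero)
  next
    case (monom c k)
    have "poly ([:- a, 1 + a, -1:] * monom c k) = (\<lambda>t. c * ((1 + a) * t ^ Suc k + (-1) * (1 * t ^ Suc (Suc k) + a * t ^ k)))"
      by (auto simp: fun_eq_iff poly_monom algebra_simps)
    moreover have "\<Lambda>' (\<lambda>t. c * ((1 + a) * t ^ Suc k + (-1) * (1 * t ^ Suc (Suc k) + a * t ^ k))) =
        c * ((1 + a) * \<Lambda>' (\<lambda>t. t ^ Suc k) + (-1) * (1 * \<Lambda>' (\<lambda>t. t ^ Suc (Suc k)) + a * \<Lambda>' (\<lambda>t. t ^ k)))"
      by (subst Y.\<Lambda>_scale, intro continuous_intros, subst Y.\<Lambda>_linear, intro continuous_intros, intro continuous_intros, subst Y.\<Lambda>_two_powers) simp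
    moreover have "poly ([:r\<^sub>0, r\<^sub>1:] * monom c k) = (\<lambda>t. c * (r\<^sub>0 * t ^ k + r\<^sub>1 * t ^ Suc k))"
      by (auto simp: fun_eq_iff poly_monom algebra_simps)
    moreover have "\<Lambda> (\<lambda>t. c * (r\<^sub>0 * t ^ k + r\<^sub>1 * t ^ Suc k)) = c * (r\<^sub>0 * \<Lambda> (\<lambda>t. t ^ k) + r\<^sub>1 * \<Lambda> (\<lambda>t. t ^ Suc k))"
      by (subst X.\<Lambda>_scale, intro continuous_intros, subst X.\<Lambda>_two_powers) simp
    ultimately show ?case using arg_cong[OF eq[of k], of "\<lambda>x. c * x"] by (simp only:) (simp add: algebra_simps)
  next
    case (add p q)
    then show ?case by (simp only: ring_distribs X.\<Lambda>_poly_add Y.\<Lambda>_poly_add)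
  qed
qed

context space_pair
begin

text \<open>The term \<open>- \<beta> (1 - t) K\<close> of \<open>derivative_expansion\<close> is not positive definite; writing
  \<open>1 - t\<close> as \<open>(1 - a) - (t - a)\<close> distributes it between \<open>f\<^sub>1\<close> and \<open>f\<^sub>2\<close>, since \<open>t - a\<close> is a
  Schur multiplier. The set \<open>T\<close> is contained in both spaces of the pair; on it the positive
  definite functions of both can be added.\<close>

lemma derivative_split:
  assumes \<alpha>\<beta>: "0 \<le> \<alpha>" "0 \<le> \<beta>"
    and g: "g ` T \<subseteq> S" "\<And>x y. x \<in> T \<Longrightarrow> y \<in> T \<Longrightarrow> \<tau> (g x) (g y) = \<sigma> x y"
    and e: "e ` T \<subseteq> S'" "\<And>x y. x \<in> T \<Longrightarrow> y \<in> T \<Longrightarrow> \<tau>' (e x) (e y) = \<sigma> x y"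
    and K: "continuous_on {a..1} K" and pd: "posdef S (\<lambda>x y. K (\<tau> x y))"
  obtains f\<^sub>1 f\<^sub>2 where "continuous_on {a..1} f\<^sub>1" "continuous_on {a..1} f\<^sub>2"
    "posdef T (\<lambda>x y. f\<^sub>1 (\<sigma> x y))" "posdef T (\<lambda>x y. f\<^sub>2 (\<sigma> x y))"
    "\<And>t. t \<in> {a<..<1} \<Longrightarrow> \<exists>D. (K has_real_derivative D) (at t) \<and> (1 - t) * (t - a) * D = f\<^sub>1 t - f\<^sub>2 t"
proof -
  obtain F where F: "continuous_on {a..1} F" "posdef S' (\<lambda>x y. F (\<tau>' x y))"
    and D: "\<And>t. t \<in> {a<..<1} \<Longrightarrow> \<exists>D. (K has_real_derivative D) (at t) \<and>
        (1 - t) * (t - a) * D = (\<alpha> * (t - a) - \<beta> * (1 - t)) * K t - F t"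
    by (rule derivative_expansion[OF K pd]) (rule that)
  define f\<^sub>1 where "f\<^sub>1 t = (\<alpha> + \<beta>) * ((t - a) * K t)" for t
  define f\<^sub>2 where "f\<^sub>2 t = F t + (\<beta> * (1 - a)) * K t" for t
  show thesis
  proof (rule that[of f\<^sub>1 f\<^sub>2])
    show "continuous_on {a..1} f\<^sub>1" "continuous_on {a..1} f\<^sub>2"
      unfolding f\<^sub>1_def[abs_def] f\<^sub>2_def[abs_def] by (intro continuous_intros K F)+
    have "posdef S (\<lambda>x y. (\<tau> x y - a) * K (\<tau> x y))"
      using X.linear_multiplier pd unfolding schur_multiplier_def by blast
    then have "posdef S (\<lambda>x y. f\<^sub>1 (\<tau> x y))"
      unfolding f\<^sub>1_def using \<alpha>\<beta> by (intro posdef_scale) auto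
    from posdef_image[OF this g(1)] show "posdef T (\<lambda>x y. f\<^sub>1 (\<sigma> x y))"
      using posdef_cong[of T "\<lambda>x y. f\<^sub>1 (\<tau> (g x) (g y))" "\<lambda>x y. f\<^sub>1 (\<sigma> x y)"] g(2) by simp
    have "posdef T (\<lambda>x y. K (\<tau> (g x) (g y)))" by (rule posdef_image[OF pd g(1)])
    then have KT: "posdef T (\<lambda>x y. (\<beta> * (1 - a)) * K (\<tau> (g x) (g y)))"
      using \<alpha>\<beta> X.a_less by (intro posdef_scale) auto
    have "posdef T (\<lambda>x y. F (\<tau>' (e x) (e y)))" by (rule posdef_image[OF F(2) e(1)])
    from posdef_add[OF this KT] show "posdef T (\<lambda>x y. f\<^sub>2 (\<sigma> x y))"
      using posdef_cong[of T "\<lambda>x y. F (\<tau>' (e x) (e y)) + \<beta> * (1 - a) * K (\<tau> (g x) (g y))" "\<lambda>x y. f\<^sub>2 (\<sigma> x y)"] g(2) e(2)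
      by (simp add: f\<^sub>2_def)
    show "\<exists>D. (K has_real_derivative D) (at t) \<and> (1 - t) * (t - a) * D = f\<^sub>1 t - f\<^sub>2 t" if t: "t \<in> {a<..<1}" for t
    proof -
      obtain D where "(K has_real_derivative D) (at t)"
        "(1 - t) * (t - a) * D = (\<alpha> * (t - a) - \<beta> * (1 - t)) * K t - F t" using D[OF t] by blast
      then show ?thesis by (intro exI[of _ D]) (simp add: f\<^sub>1_def f\<^sub>2_def algebra_simps)
    qed
  qed
qed

end

text \<open>Moments on the spheres of dimensions \<open>e + 2\<close> and \<open>e\<close>. For positive \<open>e\<close> the density of the
  first is that of the second multiplied by \<open>1 - t\<^sup>2\<close>, up to a constant.\<close>

lemma signed_moment_dimension: "signed_moment (Suc (Suc (Suc e))) k * (real e + 1 + real k) = (real e + 1) * signed_moment (Suc e) k"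
proof (induction k rule: gauss_moment.induct)
  case (3 k)
  define m where "m = signed_moment (Suc (Suc (Suc e))) k"
  define m' where "m' = signed_moment (Suc e) k"
  have IH: "m * (real e + 1 + real k) = (real e + 1) * m'" using 3 by (simp only: m_def m'_def)
  have p: "real e + 1 + real k \<noteq> 0" "real e + 3 + real k \<noteq> 0" by (simp_all add: add_nonneg_eq_0_iff)
  have "signed_moment (Suc (Suc (Suc e))) (Suc (Suc k)) * (real e + 1 + real (Suc (Suc k))) =
      (real k + 1) / (real e + 3 + real k) * m * (real e + 3 + real k)"
    unfolding signed_moment_Suc_Suc m_def by (simp add: add_ac)
  also have "\<dots> = (real k + 1) * m" using p by simp
  also have "\<dots> = (real k + 1) / (real e + 1 + real k) * (m * (real e + 1 + real k))" using p by simp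
  also have "\<dots> = (real e + 1) * signed_moment (Suc e) (Suc (Suc k))"
    unfolding IH signed_moment_Suc_Suc m'_def by (simp add: add_ac)
  finally show ?case .
qed auto

text \<open>Here \<open>\<omega>' = (1 - t\<^sup>2)^((d - 4) / 2)\<close> and \<open>\<omega> = (1 - t\<^sup>2) \<omega>'\<close>, whence \<open>\<rho> = 1\<close>, and \<open>\<alpha> = \<beta>\<close> by
  symmetry. The factor \<open>\<kappa>\<close> compensates the normalisation of the two means.\<close>

lemma sphere_pair:
  assumes d: "3 \<le> d"
  shows "space_pair (unit_vectors d :: (nat \<Rightarrow> real) set) (dot d) (-1) (sphere_mean (d - 1))
    (unit_vectors (d - 2) :: (nat \<Rightarrow> real) set) (dot (d - 2)) (sphere_mean (d - 3))
    ((real d - 2) / 2) ((real d - 2) / 2) 1 0 ((real d - 2) / (real d - 1))"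
proof -
  interpret X: averaged_space "unit_vectors d :: (nat \<Rightarrow> real) set" "dot d" "-1" "sphere_mean (d - 1)"
    using d by (intro sphere_space) simp
  have "d - 2 - 1 = d - 3" by simp
  then interpret Y: averaged_space "unit_vectors (d - 2) :: (nat \<Rightarrow> real) set" "dot (d - 2)" "-1" "sphere_mean (d - 3)"
    using sphere_space[of "d - 2"] d by simp
  obtain e where e: "d = e + 3" using d by (metis add.commute le_Suc_ex)
  have D: "Suc (Suc (d - 3)) = Suc (Suc e)" "Suc (Suc (d - 1)) = Suc (Suc (Suc (Suc e)))" "real d = real e + 3" by (simp_all add: e)
  show ?thesis
  proof unfold_locales
    fix p
    show "sphere_mean (d - 3) (poly ([:- ((real d - 2) / 2) * - 1 - (real d - 2) / 2, (real d - 2) / 2 + (real d - 2) / 2:] * p - [:- (- 1), 1 + - 1, - 1:] * pderiv p)) = 0"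
    proof (rule Y.pearsonI)
      fix k
      show "((real d - 2) / 2 + (real d - 2) / 2 + real k) * sphere_mean (d - 3) (\<lambda>t. t ^ Suc k) -
         ((real d - 2) / 2 * - 1 + (real d - 2) / 2 + real k * (1 + - 1)) * sphere_mean (d - 3) (\<lambda>t. t ^ k) +
         real k * - 1 * sphere_mean (d - 3) (\<lambda>t. t ^ (k - 1)) = 0"
        unfolding sphere_mean_power D
        by (cases k) (auto simp: signed_moment_Suc_Suc field_simps add_nonneg_eq_0_iff)
    qed
    show "sphere_mean (d - 3) (poly ([:- (- 1), 1 + - 1, - 1:] * p)) = (real d - 2) / (real d - 1) * sphere_mean (d - 1) (poly ([:1, 0:] * p))"
    proof (rule weightI[OF X.averaged_space_axioms Y.averaged_space_axioms])
      fix k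
      have dim: "signed_moment (Suc (Suc (Suc (Suc e)))) k = (real e + 2) / (real e + 2 + real k) * signed_moment (Suc (Suc e)) k"
        using signed_moment_dimension[of "Suc e" k] by (simp add: field_simps add_nonneg_eq_0_iff)
      show "(1 + - 1) * sphere_mean (d - 3) (\<lambda>t. t ^ Suc k) - sphere_mean (d - 3) (\<lambda>t. t ^ Suc (Suc k)) - - 1 * sphere_mean (d - 3) (\<lambda>t. t ^ k) =
          (real d - 2) / (real d - 1) * (1 * sphere_mean (d - 1) (\<lambda>t. t ^ k) + 0 * sphere_mean (d - 1) (\<lambda>t. t ^ Suc k))"
        unfolding sphere_mean_power D signed_moment_Suc_Suc dim
        by (simp add: divide_simps add_nonneg_eq_0_iff; simp add: algebra_simps)
    qed
  qed (use d in auto)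
qed

lemma beta_moment_Suc: "beta_moment b e (Suc k) = (real b + 1 + real k) / (real b + real e + 2 + real k) * beta_moment b e k"
  by (simp add: beta_moment_def)

lemma beta_moment_Suc_weight:
  "beta_moment b (Suc e) k = (real b + real e + 2) / (real b + real e + 2 + real k) * beta_moment b e k"
proof (induction k)
  case (Suc k)
  have "0 < real b + real e + 2 + real k" by simp
  then show ?case unfolding beta_moment_Suc Suc by (simp add: divide_simps; simp add: algebra_simps)
qed (simp add: beta_moment_def)

lemma beta_moment_shift: "beta_moment 0 e (Suc k) = beta_moment 1 e k / (real e + 2)"
  unfolding beta_moment_def prod.lessThan_Suc_shift by (simp add: add_ac)

lemma beta_pearson:
  assumes "averaged_space S \<tau> 0 (beta_mean 0 e)"
  shows "beta_mean 0 e (poly ([:- (real e + 1) * 0 - 1, real e + 1 + 1:] * p - [:- 0, 1 + 0, -1:] * pderiv p)) = 0"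
proof -
  interpret averaged_space S \<tau> 0 "beta_mean 0 e" by (rule assms)
  show ?thesis
  proof (rule pearsonI)
    fix k
    have "0 < real e + 2 + real k" by simp
    then show "(real e + 1 + 1 + real k) * beta_mean 0 e (\<lambda>t. t ^ Suc k) - ((real e + 1) * 0 + 1 + real k * (1 + 0)) * beta_mean 0 e (\<lambda>t. t ^ k) +
         real k * 0 * beta_mean 0 e (\<lambda>t. t ^ (k - 1)) = 0"
      unfolding beta_mean_power beta_moment_Suc by (simp add: divide_simps; simp add: algebra_simps)
  qed
qed

text \<open>Here \<open>\<omega>' = (1 - s)^e\<close> and \<open>\<omega> = (1 - s)^(e + 1)\<close>, so that \<open>s (1 - s) \<omega>' = s \<omega>\<close> and \<open>\<rho> = s\<close>.\<close>

lemma beta_pair_complex: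
  assumes X: "averaged_space S \<tau> 0 (beta_mean 0 (Suc e))" and Y: "averaged_space S' \<tau>' 0 (beta_mean 0 e)"
  shows "space_pair S \<tau> 0 (beta_mean 0 (Suc e)) S' \<tau>' (beta_mean 0 e) (real e + 1) 1 0 1 ((real e + 1) / (real e + 2))"
proof -
  interpret X: averaged_space S \<tau> 0 "beta_mean 0 (Suc e)" by (rule X)
  interpret Y: averaged_space S' \<tau>' 0 "beta_mean 0 e" by (rule Y)
  show ?thesis
  proof unfold_locales
    fix p
    show "beta_mean 0 e (poly ([:- (real e + 1) * 0 - 1, real e + 1 + 1:] * p - [:- 0, 1 + 0, -1:] * pderiv p)) = 0"
      by (rule beta_pearson[OF Y])
    show "beta_mean 0 e (poly ([:- 0, 1 + 0, - 1:] * p)) = (real e + 1) / (real e + 2) * beta_mean 0 (Suc e) (poly ([:0, 1:] * p))"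
    proof (rule weightI[OF X Y])
      fix k
      have "0 < real e + 2 + (1 + real k)" by simp
      then show "(1 + 0) * beta_mean 0 e (\<lambda>t. t ^ Suc k) - beta_mean 0 e (\<lambda>t. t ^ Suc (Suc k)) - 0 * beta_mean 0 e (\<lambda>t. t ^ k) =
          (real e + 1) / (real e + 2) * (0 * beta_mean 0 (Suc e) (\<lambda>t. t ^ k) + 1 * beta_mean 0 (Suc e) (\<lambda>t. t ^ Suc k))"
        unfolding beta_mean_power beta_moment_Suc_weight beta_moment_Suc[of 0 e "Suc k"]
        by (simp add: divide_simps add_nonneg_eq_0_iff; simp add: algebra_simps)
    qed
  qed auto
qed

text \<open>Here \<open>\<omega>' = (1 - s)^e\<close> and \<open>\<omega> = s (1 - s)^(e + 1)\<close>, so that \<open>s (1 - s) \<omega>' = \<omega>\<close> and \<open>\<rho> = 1\<close>.\<close>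

lemma beta_pair_quaternionic:
  assumes X: "averaged_space S \<tau> 0 (beta_mean 1 (Suc e))" and Y: "averaged_space S' \<tau>' 0 (beta_mean 0 e)"
  shows "space_pair S \<tau> 0 (beta_mean 1 (Suc e)) S' \<tau>' (beta_mean 0 e) (real e + 1) 1 1 0 ((real e + 1) / ((real e + 2) * (real e + 3)))"
proof -
  interpret X: averaged_space S \<tau> 0 "beta_mean 1 (Suc e)" by (rule X)
  interpret Y: averaged_space S' \<tau>' 0 "beta_mean 0 e" by (rule Y)
  show ?thesis
  proof unfold_locales
    fix p
    show "beta_mean 0 e (poly ([:- (real e + 1) * 0 - 1, real e + 1 + 1:] * p - [:- 0, 1 + 0, -1:] * pderiv p)) = 0"
      by (rule beta_pearson[OF Y])
    show "beta_mean 0 e (poly ([:- 0, 1 + 0, - 1:] * p)) = (real e + 1) / ((real e + 2) * (real e + 3)) * beta_mean 1 (Suc e) (poly ([:1, 0:] * p))"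
    proof (rule weightI[OF X Y])
      fix k
      have "0 < real e + 3 + real k" by simp
      then show "(1 + 0) * beta_mean 0 e (\<lambda>t. t ^ Suc k) - beta_mean 0 e (\<lambda>t. t ^ Suc (Suc k)) - 0 * beta_mean 0 e (\<lambda>t. t ^ k) =
          (real e + 1) / ((real e + 2) * (real e + 3)) * (1 * beta_mean 1 (Suc e) (\<lambda>t. t ^ k) + 0 * beta_mean 1 (Suc e) (\<lambda>t. t ^ Suc k))"
        unfolding beta_mean_power unfolding beta_moment_Suc[of 0 e "Suc k"] unfolding beta_moment_shift beta_moment_Suc_weight
        by (simp add: divide_simps add_nonneg_eq_0_iff; simp add: algebra_simps)
    qed
  qed auto
qed

section \<open>Splitting the derivative on spheres and projective spaces\<close>

text \<open>The theorem for radial parts, with the spaces replaced by sets of representatives and the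
  cosines of half the distances by \<open>\<tau>\<close> and \<open>\<tau>'\<close>.\<close>

definition splits :: "'p set \<Rightarrow> ('p \<Rightarrow> 'p \<Rightarrow> real) \<Rightarrow> 'q set \<Rightarrow> ('q \<Rightarrow> 'q \<Rightarrow> real) \<Rightarrow> bool" where
  "splits U \<tau> U' \<tau>' \<longleftrightarrow> (\<forall>K. continuous_on {-1..1} K \<longrightarrow> posdef U (\<lambda>x y. K (\<tau> x y)) \<longrightarrow>
     (\<exists>f\<^sub>1 f\<^sub>2. continuous_on {-1..1} f\<^sub>1 \<and> continuous_on {-1..1} f\<^sub>2 \<and>
        posdef U' (\<lambda>x y. f\<^sub>1 (\<tau>' x y)) \<and> posdef U' (\<lambda>x y. f\<^sub>2 (\<tau>' x y)) \<and>
        (\<forall>t\<in>{-1<..<1}. \<exists>D. (K has_real_derivative D) (at t) \<and> (1 - t\<^sup>2) * D = f\<^sub>1 t - f\<^sub>2 t)))"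

lemma coordinate_vectors_mono: "m \<le> n \<Longrightarrow> coordinate_vectors m \<subseteq> coordinate_vectors n"
  by (auto simp: coordinate_vectors_def)

lemma dot_extend:
  assumes "x \<in> coordinate_vectors m" "m \<le> n" shows "dot n x y = dot m x y"
  unfolding dot_def using assms by (intro sum.mono_neutral_right) (auto simp: coordinate_vectors_def)

lemma unit_vectors_mono: "m \<le> n \<Longrightarrow> unit_vectors m \<subseteq> unit_vectors n"
  using coordinate_vectors_mono[of m n] dot_extend[of _ m n] by (fastforce simp: unit_vectors_def)

lemma sphere_splits:
  assumes d: "3 \<le> d"
  shows "splits (unit_vectors d :: (nat \<Rightarrow> real) set) (dot d) (unit_vectors (d - 2) :: (nat \<Rightarrow> real) set) (dot (d - 2))"
  unfolding splits_def
proof (intro allI impI)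
  interpret space_pair "unit_vectors d :: (nat \<Rightarrow> real) set" "dot d" "-1" "sphere_mean (d - 1)"
    "unit_vectors (d - 2) :: (nat \<Rightarrow> real) set" "dot (d - 2)" "sphere_mean (d - 3)"
    "(real d - 2) / 2" "(real d - 2) / 2" 1 0 "(real d - 2) / (real d - 1)"
    by (rule sphere_pair[OF d])
  fix K assume K: "continuous_on {-1..1} K" "posdef (unit_vectors d) (\<lambda>x y :: nat \<Rightarrow> real. K (dot d x y))"
  obtain f\<^sub>1 f\<^sub>2 where f: "continuous_on {-1..1} f\<^sub>1" "continuous_on {-1..1} f\<^sub>2"
    "posdef (unit_vectors (d - 2) :: (nat \<Rightarrow> real) set) (\<lambda>x y. f\<^sub>1 (dot (d - 2) x y))"
    "posdef (unit_vectors (d - 2) :: (nat \<Rightarrow> real) set) (\<lambda>x y. f\<^sub>2 (dot (d - 2) x y))"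
    and D: "\<And>t. t \<in> {-1<..<1} \<Longrightarrow> \<exists>D. (K has_real_derivative D) (at t) \<and> (1 - t) * (t - -1) * D = f\<^sub>1 t - f\<^sub>2 t"
  proof (rule derivative_split[where e = "\<lambda>x. x" and g = "\<lambda>x. x" and T = "unit_vectors (d - 2)" and \<sigma> = "dot (d - 2)", OF _ _ _ _ _ _ K])
    show "(\<lambda>x. x) ` unit_vectors (d - 2) \<subseteq> (unit_vectors d :: (nat \<Rightarrow> real) set)"
      using unit_vectors_mono[of "d - 2" d] by simp
    show "dot d x y = dot (d - 2) x y" if "x \<in> unit_vectors (d - 2)" for x y :: "nat \<Rightarrow> real"
      using that by (intro dot_extend) (auto simp: unit_vectors_def)
  qed (use d that in auto)
  have "(1 - t) * (t - -1) = 1 - t\<^sup>2" for t :: real by (simp add: power2_eq_square algebra_simps)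
  then show "\<exists>f\<^sub>1 f\<^sub>2. continuous_on {-1..1} f\<^sub>1 \<and> continuous_on {-1..1} f\<^sub>2 \<and>
        posdef (unit_vectors (d - 2)) (\<lambda>x y :: nat \<Rightarrow> real. f\<^sub>1 (dot (d - 2) x y)) \<and>
        posdef (unit_vectors (d - 2)) (\<lambda>x y :: nat \<Rightarrow> real. f\<^sub>2 (dot (d - 2) x y)) \<and>
        (\<forall>t\<in>{-1<..<1}. \<exists>D. (K has_real_derivative D) (at t) \<and> (1 - t\<^sup>2) * D = f\<^sub>1 t - f\<^sub>2 t)"
    using f D by (intro exI[of _ f\<^sub>1] exI[of _ f\<^sub>2] conjI ballI) (simp_all only:)
qed

text \<open>The change of variables \<open>t = 2 s - 1\<close>, under which \<open>1 - t\<^sup>2 = 4 s (1 - s)\<close> and the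
  derivative is halved.\<close>

lemma splits_from_unit_interval:
  assumes pair: "space_pair S \<tau> 0 \<Lambda> S' \<tau>' \<Lambda>' \<alpha> \<beta> r\<^sub>0 r\<^sub>1 \<kappa>" and \<alpha>\<beta>: "0 \<le> \<alpha>" "0 \<le> \<beta>"
    and g: "g ` T \<subseteq> S" "\<And>x y. x \<in> T \<Longrightarrow> y \<in> T \<Longrightarrow> \<tau> (g x) (g y) = \<sigma> x y"
    and e: "e ` T \<subseteq> S'" "\<And>x y. x \<in> T \<Longrightarrow> y \<in> T \<Longrightarrow> \<tau>' (e x) (e y) = \<sigma> x y"
  shows "splits S (\<lambda>x y. 2 * \<tau> x y - 1) T (\<lambda>x y. 2 * \<sigma> x y - 1)"
  unfolding splits_def
proof (intro allI impI)
  interpret space_pair S \<tau> 0 \<Lambda> S' \<tau>' \<Lambda>' \<alpha> \<beta> r\<^sub>0 r\<^sub>1 \<kappa> by (rule pair)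
  fix K assume K: "continuous_on {-1..1} K" and pd: "posdef S (\<lambda>x y. K (2 * \<tau> x y - 1))"
  define k where "k s = K (2 * s - 1)" for s
  have k: "continuous_on {0..1} k"
    unfolding k_def[abs_def] by (rule continuous_on_compose2[OF K]) (auto intro!: continuous_intros)
  have pd': "posdef S (\<lambda>x y. k (\<tau> x y))" using pd by (simp add: k_def)
  obtain f\<^sub>1 f\<^sub>2 where f: "continuous_on {0..1} f\<^sub>1" "continuous_on {0..1} f\<^sub>2"
    "posdef T (\<lambda>x y. f\<^sub>1 (\<sigma> x y))" "posdef T (\<lambda>x y. f\<^sub>2 (\<sigma> x y))"
    and D: "\<And>t. t \<in> {0<..<1} \<Longrightarrow> \<exists>D. (k has_real_derivative D) (at t) \<and> (1 - t) * (t - 0) * D = f\<^sub>1 t - f\<^sub>2 t"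
    by (rule derivative_split[OF \<alpha>\<beta> g e k pd']) (assumption | rule that)+
  define F where "F f t = 2 * f ((1 + t) / 2)" for f :: "real \<Rightarrow> real" and t :: real
  have F: "continuous_on {-1..1} (F f)" if "continuous_on {0..1} f" for f
    unfolding F_def[abs_def] by (intro continuous_intros continuous_on_compose2[OF that]) auto
  have FT: "posdef T (\<lambda>x y. F f (2 * \<sigma> x y - 1))" if "posdef T (\<lambda>x y. f (\<sigma> x y))" for f
    using posdef_scale[OF that, of 2] by (simp add: F_def)
  have "\<exists>D. (K has_real_derivative D) (at t) \<and> (1 - t\<^sup>2) * D = F f\<^sub>1 t - F f\<^sub>2 t" if t: "t \<in> {-1<..<1}" for t
  proof -
    define s where "s = (1 + t) / 2"
    have s: "s \<in> {0<..<1}" using t by (auto simp: s_def)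
    obtain D' where D': "(k has_real_derivative D') (at s)" "(1 - s) * (s - 0) * D' = f\<^sub>1 s - f\<^sub>2 s" using D[OF s] by blast
    have "((\<lambda>t. (1 + t) / 2) has_real_derivative 1 / 2) (at t)" by (auto intro!: derivative_eq_intros)
    then have "((\<lambda>t. k ((1 + t) / 2)) has_real_derivative D' * (1 / 2)) (at t)"
      using DERIV_chain2[of k D' "\<lambda>t. (1 + t) / 2" t "1 / 2" UNIV] D'(1) by (simp add: s_def)
    moreover have "(\<lambda>t. k ((1 + t) / 2)) = K"
    proof
      fix t :: real
      have "2 * ((1 + t) / 2) - 1 = t" by (simp add: field_simps)
      then show "k ((1 + t) / 2) = K t" by (simp only: k_def)
    qed
    moreover have "(1 - t\<^sup>2) * (D' * (1 / 2)) = 2 * ((1 - s) * (s - 0) * D')"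
      by (simp add: s_def power2_eq_square field_simps)
    then have "(1 - t\<^sup>2) * (D' * (1 / 2)) = F f\<^sub>1 t - F f\<^sub>2 t"
      unfolding D'(2) by (simp add: F_def s_def[symmetric] right_diff_distrib)
    ultimately show ?thesis by (intro exI[of _ "D' * (1 / 2)"]) simp
  qed
  then show "\<exists>f\<^sub>1 f\<^sub>2. continuous_on {-1..1} f\<^sub>1 \<and> continuous_on {-1..1} f\<^sub>2 \<and>
        posdef T (\<lambda>x y. f\<^sub>1 (2 * \<sigma> x y - 1)) \<and> posdef T (\<lambda>x y. f\<^sub>2 (2 * \<sigma> x y - 1)) \<and>
        (\<forall>t\<in>{-1<..<1}. \<exists>D. (K has_real_derivative D) (at t) \<and> (1 - t\<^sup>2) * D = f\<^sub>1 t - f\<^sub>2 t)"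
    using F[OF f(1)] F[OF f(2)] FT[OF f(3)] FT[OF f(4)] by blast
qed

interpretation real_scalars: scalars "(*) :: real \<Rightarrow> real \<Rightarrow> real" "\<lambda>x. x" 1
  by unfold_locales (auto simp: algebra_simps abs_mult)

interpretation complex_scalars: scalars "(*) :: complex \<Rightarrow> complex \<Rightarrow> complex" cnj 1
  by unfold_locales (auto simp: algebra_simps norm_mult inner_complex_def)

lemma norm_quat_mult: "norm (quat_mult p q) = norm p * norm q"
proof -
  obtain a b c d e f g h where "p = (Complex a b, Complex c d)" "q = (Complex e f, Complex g h)"
    by (metis complex.exhaust surj_pair)
  then have "(norm (quat_mult p q))\<^sup>2 = (norm p * norm q)\<^sup>2"
    by (simp add: quat_mult_def norm_Pair power_mult_distrib cmod_power2) (simp add: power2_eq_square algebra_simps)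
  then show ?thesis by (simp add: power2_eq_iff_nonneg)
qed

interpretation quaternion_scalars: scalars quat_mult quat_cnj "(1, 0)"
proof unfold_locales
  fix x y z :: quaternion and r :: real
  show "quat_mult x y \<bullet> z = y \<bullet> quat_mult (quat_cnj x) z"
    by (simp add: quat_mult_def quat_cnj_def inner_prod_def inner_complex_def algebra_simps)
  show "norm (quat_cnj x) = norm x" by (cases x) (simp add: quat_cnj_def norm_Pair)
  show "norm (quat_mult x y) = norm x * norm y" by (rule norm_quat_mult)
qed (auto simp: quat_mult_def algebra_simps norm_Pair scaleR_prod_def)

lemma complex_projective_splits:
  assumes n: "2 \<le> n"
  shows "splits (unit_vectors n :: (nat \<Rightarrow> complex) set) (\<lambda>x y. 2 * complex_scalars.overlap n x y - 1)
    (unit_vectors (n - 1)) (\<lambda>x y. 2 * complex_scalars.overlap (n - 1) x y - 1)"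
proof -
  obtain e where e: "n = e + 2" using n by (metis add.commute le_Suc_ex)
  have "averaged_space (unit_vectors n :: (nat \<Rightarrow> complex) set) (complex_scalars.overlap n) 0 (beta_mean 0 (Suc e))"
    using complex_scalars.projective_space_averaged[of 0 n] by (simp add: e)
  moreover have "averaged_space (unit_vectors (n - 1) :: (nat \<Rightarrow> complex) set) (complex_scalars.overlap (n - 1)) 0 (beta_mean 0 e)"
    using complex_scalars.projective_space_averaged[of 0 "n - 1"] by (simp add: e)
  ultimately have pair: "space_pair (unit_vectors n :: (nat \<Rightarrow> complex) set) (complex_scalars.overlap n) 0 (beta_mean 0 (Suc e))
    (unit_vectors (n - 1)) (complex_scalars.overlap (n - 1)) (beta_mean 0 e) (real e + 1) 1 0 1 ((real e + 1) / (real e + 2))"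
    by (rule beta_pair_complex)
  show ?thesis
  proof (rule splits_from_unit_interval[OF pair, where e = "\<lambda>x. x" and g = "\<lambda>x. x"])
    show "(\<lambda>x. x) ` unit_vectors (n - 1) \<subseteq> (unit_vectors n :: (nat \<Rightarrow> complex) set)"
      using unit_vectors_mono[of "n - 1" n] by simp
    show "complex_scalars.overlap n x y = complex_scalars.overlap (n - 1) x y" if "x \<in> unit_vectors (n - 1)" for x y
      using that by (intro complex_scalars.overlap_extend) (auto simp: unit_vectors_def)
  qed auto
qed

lemma herm_quaternion_embedding:
  "quaternion_scalars.herm n (\<lambda>i. (x i, 0)) (\<lambda>i. (y i, 0)) = (complex_scalars.herm n x y, 0)"
  unfolding quaternion_scalars.herm_def complex_scalars.herm_def
  by (simp add: quat_mult_def quat_cnj_def sum_prod)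

lemma overlap_quaternion_embedding:
  "quaternion_scalars.overlap n (\<lambda>i. (x i, 0)) (\<lambda>i. (y i, 0)) = complex_scalars.overlap n x y"
  unfolding quaternion_scalars.overlap_def complex_scalars.overlap_def herm_quaternion_embedding
  by (simp add: norm_Pair)

lemma quaternion_embedding_unit: "x \<in> unit_vectors n \<Longrightarrow> (\<lambda>i. (x i, 0 :: complex)) \<in> unit_vectors n" for x :: "nat \<Rightarrow> complex"
  by (auto simp: unit_vectors_def coordinate_vectors_def dot_def zero_prod_def)

text \<open>The quaternionic projective space of dimension \<open>n\<close> forms a pair with the complex one of
  dimension \<open>2 n - 1\<close>, whose density arises from its own by division by \<open>s (1 - s)\<close>. Both
  contain the complex projective space of dimension \<open>m\<close>.\<close>

lemma quaternionic_projective_splits: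
  assumes n: "2 \<le> n" and m: "m \<le> n"
  shows "splits (unit_vectors n :: (nat \<Rightarrow> quaternion) set) (\<lambda>x y. 2 * quaternion_scalars.overlap n x y - 1)
    (unit_vectors m) (\<lambda>x y. 2 * complex_scalars.overlap m x y - 1)"
proof -
  define e where "e = 2 * n - 2"
  have e: "2 * n - 1 = Suc e" "2 * n - Suc (Suc 0) = e" "1 \<le> 2 * n - 1" using n by (auto simp: e_def)
  have "averaged_space (unit_vectors n :: (nat \<Rightarrow> quaternion) set) (quaternion_scalars.overlap n) 0 (beta_mean 1 (Suc e))"
    using quaternion_scalars.projective_space_averaged[of 1 n] n e by (simp add: numeral_2_eq_2)
  moreover have "averaged_space (unit_vectors (2 * n - 1) :: (nat \<Rightarrow> complex) set) (complex_scalars.overlap (2 * n - 1)) 0 (beta_mean 0 e)"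
    using complex_scalars.projective_space_averaged[of 0 "2 * n - 1"] n e by simp
  ultimately have pair: "space_pair (unit_vectors n :: (nat \<Rightarrow> quaternion) set) (quaternion_scalars.overlap n) 0 (beta_mean 1 (Suc e))
    (unit_vectors (2 * n - 1)) (complex_scalars.overlap (2 * n - 1)) (beta_mean 0 e) (real e + 1) 1 1 0 ((real e + 1) / ((real e + 2) * (real e + 3)))"
    by (rule beta_pair_quaternionic)
  show ?thesis
  proof (rule splits_from_unit_interval[OF pair, where e = "\<lambda>x. x" and g = "\<lambda>x i. (x i, 0)"])
    show "(\<lambda>x. x) ` unit_vectors m \<subseteq> (unit_vectors (2 * n - 1) :: (nat \<Rightarrow> complex) set)"
    proof -
      have "m \<le> 2 * n - 1" using m n by linarith
      then show ?thesis using unit_vectors_mono[of m "2 * n - 1"] by auto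
    qed
    show "(\<lambda>x i. (x i, 0)) ` unit_vectors m \<subseteq> (unit_vectors n :: (nat \<Rightarrow> quaternion) set)"
      using unit_vectors_mono[OF m] quaternion_embedding_unit by blast
    fix x y :: "nat \<Rightarrow> complex" assume "x \<in> unit_vectors m"
    then have x: "x \<in> coordinate_vectors m" by (simp add: unit_vectors_def)
    show "complex_scalars.overlap (2 * n - 1) x y = complex_scalars.overlap m x y"
      using x m n by (intro complex_scalars.overlap_extend) auto
    show "quaternion_scalars.overlap n (\<lambda>i. (x i, 0)) (\<lambda>i. (y i, 0)) = complex_scalars.overlap m x y"
      unfolding overlap_quaternion_embedding using x m by (intro complex_scalars.overlap_extend) auto
  qed auto
qed

lemma dot_multiplier: "schur_multiplier (S :: (nat \<Rightarrow> real) set) (dot n)"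
proof -
  have "schur_multiplier S (\<lambda>x y :: nat \<Rightarrow> real. \<Sum>i\<le>n. x i * y i)"
    by (intro schur_multiplier_sum schur_multiplier_feature finite_atMost)
  then show ?thesis by (simp add: dot_def[abs_def])
qed

text \<open>A kernel \<open>K(2 t\<^sup>2 - 1)\<close> in the cosine \<open>t\<close> on the sphere is even. By the equation that
  defines it, the function \<open>F\<close> of \<open>derivative_expansion\<close> is then odd, so that \<open>t F(t)\<close> is even,
  hence a function of \<open>2 t\<^sup>2 - 1\<close>, and still positive definite. With \<open>T = 2 t\<^sup>2 - 1\<close> one has
  \<open>1 - T\<^sup>2 = 4 t\<^sup>2 (1 - t\<^sup>2)\<close> and \<open>d/dt = 4 t d/dT\<close>; multiplying the equation for \<open>t\<close> by \<open>t\<close>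
  gives the one for \<open>T\<close>.\<close>

lemma real_projective_splits:
  assumes d: "3 \<le> d"
  shows "splits (unit_vectors d :: (nat \<Rightarrow> real) set) (\<lambda>x y. 2 * (dot d x y)\<^sup>2 - 1)
    (unit_vectors (d - 2)) (\<lambda>x y :: nat \<Rightarrow> real. 2 * (dot (d - 2) x y)\<^sup>2 - 1)"
  unfolding splits_def
proof (intro allI impI)
  interpret space_pair "unit_vectors d :: (nat \<Rightarrow> real) set" "dot d" "-1" "sphere_mean (d - 1)"
    "unit_vectors (d - 2) :: (nat \<Rightarrow> real) set" "dot (d - 2)" "sphere_mean (d - 3)"
    "(real d - 2) / 2" "(real d - 2) / 2" 1 0 "(real d - 2) / (real d - 1)"
    by (rule sphere_pair[OF d])
  let ?S = "unit_vectors d :: (nat \<Rightarrow> real) set" and ?T = "unit_vectors (d - 2) :: (nat \<Rightarrow> real) set"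
  fix K assume K: "continuous_on {-1..1} K" and pd: "posdef ?S (\<lambda>x y. K (2 * (dot d x y)\<^sup>2 - 1))"
  have sq: "2 * t\<^sup>2 - 1 \<in> {-1..1}" if "t \<in> {-1..1}" for t :: real
    using that by (simp add: abs_square_le_1 abs_le_iff)
  define k where "k t = K (2 * t\<^sup>2 - 1)" for t
  have k: "continuous_on {-1..1} k"
    unfolding k_def[abs_def] by (rule continuous_on_compose2[OF K]) (use sq in \<open>auto intro!: continuous_intros\<close>)
  have k_even: "k (- t) = k t" for t by (simp add: k_def)
  obtain F where F: "continuous_on {-1..1} F" "posdef ?T (\<lambda>x y. F (dot (d - 2) x y))"
    and D: "\<And>t. t \<in> {-1<..<1} \<Longrightarrow> \<exists>D. (k has_real_derivative D) (at t) \<and>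
      (1 - t) * (t - -1) * D = ((real d - 2) / 2 * (t - -1) - (real d - 2) / 2 * (1 - t)) * k t - F t"
    by (rule derivative_expansion[OF k pd[folded k_def]]) (rule that)
  have lin: "(real d - 2) / 2 * (t - -1) - (real d - 2) / 2 * (1 - t) = (real d - 2) * t" for t :: real
    by (simp add: field_simps)
  have F_odd: "F t + F (- t) = 0" if t: "t \<in> {-1..1}" for t
  proof -
    have "continuous_on {-1..1} (\<lambda>t. F t + F (- t))"
      by (intro continuous_intros F continuous_on_compose2[OF F(1)]) auto
    then have c: "continuous_on (closure {-1<..<1}) (\<lambda>t. F t + F (- t))" by (simp add: closure_greaterThanLessThan)
    have "F s + F (- s) = 0" if s: "s \<in> {-1<..<1}" for s
    proof -
      obtain D1 where D1: "(k has_real_derivative D1) (at s)" "(1 - s) * (s - -1) * D1 = (real d - 2) * s * k s - F s"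
        using D[OF s] unfolding lin by blast
      obtain D2 where D2: "(k has_real_derivative D2) (at (- s))" "(1 - - s) * (- s - -1) * D2 = (real d - 2) * (- s) * k (- s) - F (- s)"
        using D[of "- s"] s unfolding lin by auto
      have "((\<lambda>t. k (- t)) has_real_derivative - D2) (at s)" using D2(1) by (simp add: DERIV_mirror)
      then have "D1 = - D2" using DERIV_unique[OF D1(1)] by (simp add: k_even)
      have eq: "(1 - - s) * (- s - -1) = (1 - s) * (s - -1)" by (simp add: algebra_simps)
      have "(1 - s) * (s - -1) * D2 = - ((real d - 2) * s * k s) - F (- s)"
        using D2(2) unfolding eq by (simp add: k_even)
      moreover have "- ((1 - s) * (s - -1) * D2) = (real d - 2) * s * k s - F s"
        using D1(2) \<open>D1 = - D2\<close> by simp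
      ultimately show ?thesis by linarith
    qed
    then show ?thesis using continuous_constant_on_closure[OF c, of 0 t] t by (simp add: closure_greaterThanLessThan)
  qed
  \<comment> \<open>The nonnegative root; the choice of sign does not matter for the even function \<open>t F(t)\<close>.\<close>
  define r where "r T = sqrt ((1 + T) / 2)" for T :: real
  have r: "continuous_on {-1..1} r" unfolding r_def[abs_def] by (auto intro!: continuous_intros)
  have r_mem: "r T \<in> {-1..1}" if "T \<in> {-1..1}" for T
  proof -
    have "0 \<le> r T" "r T \<le> 1" using that by (auto simp: r_def)
    then show ?thesis by simp
  qed
  define f\<^sub>1 where "f\<^sub>1 T = (real d - 2) * ((1 + T) / 2 * K T)" for T
  define f\<^sub>2 where "f\<^sub>2 T = r T * F (r T)" for T
  have f2_eq: "f\<^sub>2 (2 * t\<^sup>2 - 1) = t * F t" if t: "t \<in> {-1..1}" for t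
  proof -
    have "r (2 * t\<^sup>2 - 1) = \<bar>t\<bar>" by (simp add: r_def)
    moreover have "F (- t) = - F t" using F_odd[OF t] by linarith
    ultimately show ?thesis by (simp add: f\<^sub>2_def abs_if)
  qed
  have "continuous_on {-1..1} f\<^sub>1" unfolding f\<^sub>1_def[abs_def] by (intro continuous_intros K) auto
  moreover have "continuous_on {-1..1} f\<^sub>2"
    unfolding f\<^sub>2_def[abs_def] by (intro continuous_intros r continuous_on_compose2[OF F(1) r]) (use r_mem in auto)
  moreover have "posdef ?T (\<lambda>x y. f\<^sub>1 (2 * (dot (d - 2) x y)\<^sup>2 - 1))"
  proof -
    have "(\<lambda>x. x) ` ?T \<subseteq> ?S" using unit_vectors_mono[of "d - 2" d] by auto
    from posdef_image[OF pd this] have "posdef ?T (\<lambda>x y. K (2 * (dot d x y)\<^sup>2 - 1))" .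
    then have "posdef ?T (\<lambda>x y. dot d x y * dot d x y * K (2 * (dot d x y)\<^sup>2 - 1))"
      using schur_multiplier_mult[OF dot_multiplier[of ?T d] dot_multiplier[of ?T d]] unfolding schur_multiplier_def by blast
    then have "posdef ?T (\<lambda>x y. (real d - 2) * (dot d x y * dot d x y * K (2 * (dot d x y)\<^sup>2 - 1)))"
      using d by (intro posdef_scale) auto
    also have "?this \<longleftrightarrow> posdef ?T (\<lambda>x y. f\<^sub>1 (2 * (dot (d - 2) x y)\<^sup>2 - 1))"
    proof (rule posdef_cong)
      fix x y assume "x \<in> ?T"
      then have "dot d x y = dot (d - 2) x y" by (intro dot_extend) (auto simp: unit_vectors_def)
      then show "(real d - 2) * (dot d x y * dot d x y * K (2 * (dot d x y)\<^sup>2 - 1)) = f\<^sub>1 (2 * (dot (d - 2) x y)\<^sup>2 - 1)"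
        by (simp add: f\<^sub>1_def power2_eq_square)
    qed
    finally show ?thesis .
  qed
  moreover have "posdef ?T (\<lambda>x y. f\<^sub>2 (2 * (dot (d - 2) x y)\<^sup>2 - 1))"
  proof -
    have "posdef ?T (\<lambda>x y. dot (d - 2) x y * F (dot (d - 2) x y))"
      using dot_multiplier[of ?T "d - 2"] F(2) unfolding schur_multiplier_def by blast
    also have "?this \<longleftrightarrow> posdef ?T (\<lambda>x y. f\<^sub>2 (2 * (dot (d - 2) x y)\<^sup>2 - 1))"
      by (intro posdef_cong f2_eq[symmetric] dot_unit_bound)
    finally show ?thesis .
  qed
  moreover have "\<exists>D. (K has_real_derivative D) (at T) \<and> (1 - T\<^sup>2) * D = f\<^sub>1 T - f\<^sub>2 T" if T: "T \<in> {-1<..<1}" for T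
  proof -
    define t where "t = r T"
    have t: "0 < t" "t < 1" "t\<^sup>2 = (1 + T) / 2" using T by (auto simp: t_def r_def)
    obtain D1 where D1: "(k has_real_derivative D1) (at t)" "(1 - t) * (t - -1) * D1 = (real d - 2) * t * k t - F t"
      using D[of t] t unfolding lin by auto
    have "(r has_real_derivative (1 / 2) * (inverse t / 2)) (at T)"
      unfolding r_def[abs_def] t_def using T
      by (auto intro!: derivative_eq_intros simp: r_def)
    from DERIV_chain2[OF D1(1)[unfolded t_def] this]
    have "((\<lambda>T. k (r T)) has_real_derivative D1 * ((1 / 2) * (inverse t / 2))) (at T)" .
    moreover have "k (r s) = K s" if "s \<in> {-1<..<1}" for s
    proof -
      have "2 * (r s)\<^sup>2 - 1 = s" using that by (simp add: r_def field_simps)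
      then show ?thesis by (simp only: k_def)
    qed
    then have "eventually (\<lambda>T. k (r T) = K T) (nhds T)"
      using T by (intro eventually_mono[OF eventually_nhds_in_open[of "{-1<..<1}" T]]) auto
    ultimately have "(K has_real_derivative D1 * ((1 / 2) * (inverse t / 2))) (at T)"
      using DERIV_cong_ev[OF refl _ refl, of "\<lambda>T. k (r T)" K T] by simp
    moreover have "(1 - T\<^sup>2) * (D1 * ((1 / 2) * (inverse t / 2))) = f\<^sub>1 T - f\<^sub>2 T"
    proof -
      have T_eq: "T = 2 * t\<^sup>2 - 1" using t by simp
      have "1 - T\<^sup>2 = 4 * t * t * ((1 - t) * (t - -1))" unfolding T_eq by (simp add: power2_eq_square algebra_simps)
      moreover have "4 * t * t * x * (D1 * ((1 / 2) * (inverse t / 2))) = t * (x * D1)" for x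
        using t(1) by (simp add: field_simps)
      ultimately have "(1 - T\<^sup>2) * (D1 * ((1 / 2) * (inverse t / 2))) = t * ((1 - t) * (t - -1) * D1)"
        by (simp only:)
      also have "\<dots> = t * ((real d - 2) * t * k t - F t)" by (simp only: D1(2))
      also have "\<dots> = f\<^sub>1 T - f\<^sub>2 T"
      proof -
        have "k t = K T" by (simp only: k_def T_eq[symmetric])
        moreover have "(1 + T) / 2 = t * t" using t(3) by (simp add: power2_eq_square)
        ultimately show ?thesis by (simp add: f\<^sub>1_def f\<^sub>2_def t_def[symmetric] algebra_simps)
      qed
      finally show ?thesis .
    qed
    ultimately show ?thesis by blast
  qed
  ultimately show "\<exists>f\<^sub>1 f\<^sub>2. continuous_on {-1..1} f\<^sub>1 \<and> continuous_on {-1..1} f\<^sub>2 \<and>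
        posdef ?T (\<lambda>x y. f\<^sub>1 (2 * (dot (d - 2) x y)\<^sup>2 - 1)) \<and> posdef ?T (\<lambda>x y. f\<^sub>2 (2 * (dot (d - 2) x y)\<^sup>2 - 1)) \<and>
        (\<forall>t\<in>{-1<..<1}. \<exists>D. (K has_real_derivative D) (at t) \<and> (1 - t\<^sup>2) * D = f\<^sub>1 t - f\<^sub>2 t)"
    by blast
qed

section \<open>Zonal kernels on a space with a model\<close>

text \<open>The map \<open>\<psi>\<close> need not be injective: unit vectors represent the lines that they span.\<close>

definition models :: "'a metric \<Rightarrow> 'p set \<Rightarrow> ('p \<Rightarrow> 'p \<Rightarrow> real) \<Rightarrow> ('p \<Rightarrow> 'a) \<Rightarrow> bool" where
  "models X U \<tau> \<psi> \<longleftrightarrow> \<psi> ` U = mspace X \<and>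
     (\<forall>u\<in>U. \<forall>v\<in>U. \<tau> u v \<in> {-1..1} \<and> mdist X (\<psi> u) (\<psi> v) = 2 * arccos (\<tau> u v))"

text \<open>A geodesic from a point to one at maximal distance. All cosines are attained on it, which
  makes the radial part unique, and its continuity gives that of the radial part.\<close>

definition great_arc :: "'p set \<Rightarrow> ('p \<Rightarrow> 'p \<Rightarrow> real) \<Rightarrow> (real \<Rightarrow> 'p) \<Rightarrow> bool" where
  "great_arc U \<tau> \<gamma> \<longleftrightarrow> (\<forall>s\<in>{0..2 * pi}. \<gamma> s \<in> U \<and> (\<forall>s'\<in>{0..2 * pi}. \<tau> (\<gamma> s) (\<gamma> s') = cos ((s - s') / 2)))"

lemma great_arcD:
  "great_arc U \<tau> \<gamma> \<Longrightarrow> s \<in> {0..2 * pi} \<Longrightarrow> \<gamma> s \<in> U"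
  "great_arc U \<tau> \<gamma> \<Longrightarrow> s \<in> {0..2 * pi} \<Longrightarrow> s' \<in> {0..2 * pi} \<Longrightarrow> \<tau> (\<gamma> s) (\<gamma> s') = cos ((s - s') / 2)"
  unfolding great_arc_def by blast+

locale modelled_space =
  fixes X :: "'a metric" and U :: "'p set" and \<tau> :: "'p \<Rightarrow> 'p \<Rightarrow> real" and \<psi> :: "'p \<Rightarrow> 'a" and \<gamma> :: "real \<Rightarrow> 'p"
  assumes models: "models X U \<tau> \<psi>" and arc: "great_arc U \<tau> \<gamma>"
begin

lemma surj: "\<psi> ` U = mspace X" and range: "u \<in> U \<Longrightarrow> v \<in> U \<Longrightarrow> \<tau> u v \<in> {-1..1}"
  and dist: "u \<in> U \<Longrightarrow> v \<in> U \<Longrightarrow> mdist X (\<psi> u) (\<psi> v) = 2 * arccos (\<tau> u v)"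
  using models unfolding models_def by blast+

definition cosine :: "'a \<Rightarrow> 'a \<Rightarrow> real" where "cosine x y = cos (mdist X x y / 2)"

lemma cosine: "u \<in> U \<Longrightarrow> v \<in> U \<Longrightarrow> cosine (\<psi> u) (\<psi> v) = \<tau> u v"
  using range[of u v] by (simp add: cosine_def dist cos_arccos)

lemma mdist_cosine: "x \<in> mspace X \<Longrightarrow> y \<in> mspace X \<Longrightarrow> mdist X x y = 2 * arccos (cosine x y)"
  unfolding surj[symmetric] by (auto simp: cosine dist)

lemma cosine_range: "x \<in> mspace X \<Longrightarrow> y \<in> mspace X \<Longrightarrow> cosine x y \<in> {-1..1}"
  unfolding cosine_def by simp

definition arc_point :: "real \<Rightarrow> 'a" where "arc_point t = \<psi> (\<gamma> (2 * arccos t))"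

lemma arc_parameter: "t \<in> {-1..1} \<Longrightarrow> 2 * arccos t \<in> {0..2 * pi}"
  by (auto simp: arccos_lbound arccos_ubound)

lemma arc_point_mem: "t \<in> {-1..1} \<Longrightarrow> arc_point t \<in> mspace X"
  using great_arcD(1)[OF arc arc_parameter] surj unfolding arc_point_def by blast

lemma arc_point_dist:
  assumes "t \<in> {-1..1}" "t' \<in> {-1..1}"
  shows "mdist X (arc_point t) (arc_point t') = 2 * \<bar>arccos t - arccos t'\<bar>"
proof -
  define c where "c = arccos t - arccos t'"
  have "\<bar>c\<bar> \<le> pi" using assms arccos_lbound[of t] arccos_ubound[of t] arccos_lbound[of t'] arccos_ubound[of t']
    by (auto simp: c_def abs_le_iff)
  then have "arccos (cos c) = \<bar>c\<bar>" using arccos_cos[of "\<bar>c\<bar>"] by simp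
  moreover have "(2 * arccos t - 2 * arccos t') / 2 = c" by (simp add: c_def)
  moreover note dist[OF great_arcD(1)[OF arc arc_parameter[OF assms(1)]] great_arcD(1)[OF arc arc_parameter[OF assms(2)]]]
  ultimately show ?thesis
    by (simp only: arc_point_def great_arcD(2)[OF arc arc_parameter[OF assms(1)] arc_parameter[OF assms(2)]] c_def[symmetric])
qed

lemma arc_point_cosine: "t \<in> {-1..1} \<Longrightarrow> cosine (arc_point t) (arc_point 1) = t"
  using arc_point_dist[of t 1] arccos_lbound[of t] by (simp add: cosine_def cos_arccos)

text \<open>Every value in \<open>[-1, 1]\<close> is the cosine of a pair of points on the arc, so the radial part
  is unique.\<close>

lemma radial_part_eq:
  assumes "\<And>x y. x \<in> mspace X \<Longrightarrow> y \<in> mspace X \<Longrightarrow> K x y = f (cosine x y)"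
  shows "radial_part X K = restrict f {-1..1}"
  unfolding radial_part_def cosine_def[symmetric]
proof (rule the_equality)
  show "restrict f {-1..1} \<in> extensional {-1..1} \<and> (\<forall>x\<in>mspace X. \<forall>y\<in>mspace X. K x y = restrict f {-1..1} (cosine x y))"
    using assms cosine_range by simp
  fix g assume g: "g \<in> extensional {-1..1} \<and> (\<forall>x\<in>mspace X. \<forall>y\<in>mspace X. K x y = g (cosine x y))"
  show "g = restrict f {-1..1}"
  proof (rule extensionalityI[of _ "{-1..1}"])
    fix t :: real assume t: "t \<in> {-1..1}"
    have "g (cosine (arc_point t) (arc_point 1)) = f (cosine (arc_point t) (arc_point 1))"
      using g assms[of "arc_point t" "arc_point 1"] arc_point_mem[OF t] arc_point_mem[of 1] by simp
    then show "g t = restrict f {-1..1} t" using t by (simp add: arc_point_cosine)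
  qed (use g in auto)
qed

text \<open>A motion takes an arbitrary pair of points to a pair on the arc.\<close>

lemma zonal_radial:
  assumes G: "motion_group X G" and K: "zonal_kernel X G K"
  obtains f where "radial_part X K = restrict f {-1..1}"
    "\<And>x y. x \<in> mspace X \<Longrightarrow> y \<in> mspace X \<Longrightarrow> K x y = f (cosine x y)"
    "\<And>t. f t = K (arc_point t) (arc_point 1)"
proof -
  define f where "f t = K (arc_point t) (arc_point 1)" for t
  have f: "K x y = f (cosine x y)" if x: "x \<in> mspace X" and y: "y \<in> mspace X" for x y
  proof -
    define t where "t = cosine x y"
    have t: "t \<in> {-1..1}" using cosine_range[OF x y] by (simp add: t_def)
    have p: "arc_point t \<in> mspace X" "arc_point 1 \<in> mspace X" using t by (auto intro: arc_point_mem)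
    have "mdist X x y = mdist X (arc_point t) (arc_point 1)"
      using mdist_cosine[OF x y] mdist_cosine[OF p] t by (simp add: arc_point_cosine t_def[symmetric])
    then obtain A where "A \<in> G" "A x = arc_point t" "A y = arc_point 1"
      using G x y p unfolding motion_group_def by blast
    then show ?thesis using K x y unfolding zonal_kernel_def f_def t_def by metis
  qed
  then show thesis using that[of f] radial_part_eq[of K f] f_def by blast
qed

lemma continuous_arc_point: "continuous_map (top_of_set {-1..1}) (mtopology_of X) arc_point"
proof -
  interpret M: Metric_space "mspace X" "mdist X" by (rule Metric_space_mspace_mdist)
  have "continuous_map (top_of_set {-1..1}) M.mtopology arc_point"
    unfolding M.continuous_map_to_metric
  proof (intro ballI allI impI)
    fix t e :: real assume "t \<in> topspace (top_of_set {-1..1})" and e: "0 < e"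
    then have t: "t \<in> {-1..1}" by simp
    obtain d where d: "0 < d" "\<And>t'. t' \<in> {-1..1} \<Longrightarrow> dist t' t < d \<Longrightarrow> dist (arccos t') (arccos t) < e / 2"
      using continuous_on_arccos' t e unfolding continuous_on_iff by (metis half_gt_zero)
    show "\<exists>V. openin (top_of_set {-1..1}) V \<and> t \<in> V \<and> (\<forall>y\<in>V. arc_point y \<in> M.mball (arc_point t) e)"
    proof (intro exI[of _ "{-1..1} \<inter> ball t d"] conjI ballI)
      show "openin (top_of_set {-1..1}) ({-1..1} \<inter> ball t d)" by (simp add: openin_open_Int)
      show "t \<in> {-1..1} \<inter> ball t d" using t d by simp
      fix s assume s: "s \<in> {-1..1} \<inter> ball t d"
      then have "\<bar>arccos s - arccos t\<bar> < e / 2" using d(2)[of s] by (simp add: dist_commute dist_real_def)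
      then show "arc_point s \<in> M.mball (arc_point t) e"
        using s t arc_point_mem arc_point_dist[of t s] by (simp add: M.in_mball abs_minus_commute)
    qed
  qed
  then show ?thesis by (simp add: mtopology_of_def)
qed

lemma radial_continuous:
  assumes K: "continuous_kernel X K" and f: "\<And>t. f t = K (arc_point t) (arc_point 1)"
  shows "continuous_on {-1..1} f"
proof -
  have "continuous_map (top_of_set {-1..1}) (prod_topology (mtopology_of X) (mtopology_of X)) (\<lambda>t. (arc_point t, arc_point 1))"
    using arc_point_mem[of 1] by (intro continuous_map_pairedI continuous_arc_point) simp
  from continuous_map_compose[OF this K[unfolded continuous_kernel_def]]
  have "continuous_map (top_of_set {-1..1}) euclideanreal f" by (simp add: o_def f[abs_def])
  then show ?thesis by simp
qed

lemma continuous_radial_kernel: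
  assumes f: "continuous_on {-1..1} f"
  shows "continuous_kernel X (\<lambda>x y. f (cosine x y))"
proof -
  have "continuous_map (prod_topology (mtopology_of X) (mtopology_of X)) euclideanreal (\<lambda>p. mdist X (fst p) (snd p))"
    using continuous_map_mdist_alt[OF continuous_map_id] by (simp add: case_prod_beta)
  moreover have "continuous_on UNIV (\<lambda>d. f (cos (d / 2)))"
    by (rule continuous_on_compose2[OF f]) (auto intro!: continuous_intros)
  then have "continuous_map euclideanreal euclideanreal (\<lambda>d. f (cos (d / 2)))" by simp
  ultimately have "continuous_map (prod_topology (mtopology_of X) (mtopology_of X)) euclideanreal
      ((\<lambda>d. f (cos (d / 2))) \<circ> (\<lambda>p. mdist X (fst p) (snd p)))" by (rule continuous_map_compose)
  then show ?thesis by (simp add: continuous_kernel_def cosine_def o_def case_prod_unfold)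
qed

lemma posdef_radial_kernel:
  assumes "posdef U (\<lambda>u v. f (\<tau> u v))"
  shows "positive_definite_kernel X (\<lambda>x y. f (cosine x y))"
  unfolding positive_definite_kernel_def
proof (intro allI impI)
  fix n and x :: "nat \<Rightarrow> 'a" and c :: "nat \<Rightarrow> real"
  assume x: "inj_on x {1..n} \<and> x ` {1..n} \<subseteq> mspace X"
  define u where "u i = (SOME u. u \<in> U \<and> \<psi> u = x (Suc i))" for i
  have u: "u i \<in> U \<and> \<psi> (u i) = x (Suc i)" if "i < n" for i
  proof -
    have "x (Suc i) \<in> mspace X" using x that by auto
    then have "\<exists>u. u \<in> U \<and> \<psi> u = x (Suc i)" unfolding surj[symmetric] by auto
    then show ?thesis unfolding u_def by (rule someI_ex)
  qed
  have "0 \<le> (\<Sum>i<n. \<Sum>j<n. c (Suc i) * c (Suc j) * f (\<tau> (u i) (u j)))"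
    using u by (intro posdefD[OF assms, of n u "\<lambda>i. c (Suc i)"]) auto
  also have "\<dots> = (\<Sum>i<n. \<Sum>j<n. c (Suc i) * c (Suc j) * f (cosine (x (Suc i)) (x (Suc j))))"
  proof (intro sum.cong refl)
    fix i j assume "i \<in> {..<n}" "j \<in> {..<n}"
    then have "cosine (x (Suc i)) (x (Suc j)) = \<tau> (u i) (u j)" using u[of i] u[of j] cosine by (metis lessThan_iff)
    then show "c (Suc i) * c (Suc j) * f (\<tau> (u i) (u j)) = c (Suc i) * c (Suc j) * f (cosine (x (Suc i)) (x (Suc j)))" by simp
  qed
  also have "\<dots> = (\<Sum>\<mu>=1..n. \<Sum>\<nu>=1..n. c \<mu> * c \<nu> * f (cosine (x \<mu>) (x \<nu>)))"
    by (simp only: sum.atLeast1_atMost_eq One_nat_def)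
  finally show "0 \<le> (\<Sum>\<mu>=1..n. \<Sum>\<nu>=1..n. c \<mu> * c \<nu> * f (cosine (x \<mu>) (x \<nu>)))" .
qed

end

text \<open>Repeated points are merged by adding up their coefficients.\<close>

lemma positive_definite_kernel_imp_posdef:
  assumes "positive_definite_kernel X K"
  shows "posdef (mspace X) K"
proof (rule posdefI)
  fix n and x :: "nat \<Rightarrow> 'a" and c :: "nat \<Rightarrow> real"
  assume x: "\<And>i. i < n \<Longrightarrow> x i \<in> mspace X"
  define P where "P = x ` {..<n}"
  define C where "C p = (\<Sum>i\<in>{i\<in>{..<n}. x i = p}. c i)" for p
  have fin: "finite P" by (simp add: P_def)
  have group: "(\<Sum>i<n. c i * h (x i)) = (\<Sum>p\<in>P. C p * h p)" for h
  proof -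
    have "(\<Sum>i<n. c i * h (x i)) = (\<Sum>p\<in>P. \<Sum>i\<in>{i\<in>{..<n}. x i = p}. c i * h (x i))"
      unfolding P_def by (rule sum.image_gen) simp
    also have "\<dots> = (\<Sum>p\<in>P. C p * h p)"
      unfolding C_def sum_distrib_right by (intro sum.cong) auto
    finally show ?thesis .
  qed
  have "(\<Sum>i<n. \<Sum>j<n. c i * c j * K (x i) (x j)) = (\<Sum>i<n. c i * (\<Sum>j<n. c j * K (x i) (x j)))"
    by (simp add: sum_distrib_left mult.assoc)
  also have "\<dots> = (\<Sum>i<n. c i * (\<Sum>q\<in>P. C q * K (x i) q))" by (simp only: group[of "K _"])
  also have "\<dots> = (\<Sum>p\<in>P. C p * (\<Sum>q\<in>P. C q * K p q))" by (rule group[of "\<lambda>p. \<Sum>q\<in>P. C q * K p q"])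
  also have "\<dots> \<ge> 0"
  proof (cases "P = {}")
    case False
    obtain b where b: "bij_betw b {1..card P} P" using ex_bij_betw_nat_finite_1[OF fin] by blast
    have "0 < card P" using False fin by (simp add: card_gt_0_iff)
    moreover have "b ` {1..card P} \<subseteq> mspace X" using b x unfolding bij_betw_def P_def by auto
    ultimately have "0 \<le> (\<Sum>\<mu>=1..card P. \<Sum>\<nu>=1..card P. C (b \<mu>) * C (b \<nu>) * K (b \<mu>) (b \<nu>))"
      using assms[unfolded positive_definite_kernel_def, rule_format, of "card P" b "\<lambda>\<mu>. C (b \<mu>)"] b
      by (simp add: bij_betw_def)
    also have "\<dots> = (\<Sum>\<mu>=1..card P. C (b \<mu>) * (\<Sum>\<nu>=1..card P. C (b \<nu>) * K (b \<mu>) (b \<nu>)))"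
      by (simp add: sum_distrib_left mult.assoc)
    also have "\<dots> = (\<Sum>\<mu>=1..card P. C (b \<mu>) * (\<Sum>q\<in>P. C q * K (b \<mu>) q))"
      by (intro sum.cong refl arg_cong2[of _ _ _ _ "(*)"] sum.reindex_bij_betw[OF b])
    also have "\<dots> = (\<Sum>p\<in>P. C p * (\<Sum>q\<in>P. C q * K p q))" by (rule sum.reindex_bij_betw[OF b])
    finally show ?thesis .
  qed simp
  finally show "0 \<le> (\<Sum>i<n. \<Sum>j<n. c i * c j * K (x i) (x j))" .
qed

text \<open>The embedding chooses representatives and applies \<open>e\<close>. The derivative of the radial part
  is \<open>(f\<^sub>1 - f\<^sub>2) / (1 - t\<^sup>2)\<close>, hence continuous on the open interval.\<close>

lemma conclusion_from_splits:
  assumes Md: "models Md U \<tau> \<psi>" and M: "models M U' \<tau>' \<psi>'" and arc: "great_arc U' \<tau>' \<gamma>"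
    and e: "e ` U' \<subseteq> U" "\<And>u v. u \<in> U' \<Longrightarrow> v \<in> U' \<Longrightarrow> \<tau> (e u) (e v) = \<tau>' u v"
    and splits: "splits U \<tau> U' \<tau>'"
    and G: "motion_group Md G" and H: "motion_group M H"
    and K: "continuous_kernel Md K" "positive_definite_kernel Md K" "zonal_kernel Md G K"
  shows "(\<exists>\<iota>. isometric_embedding M Md \<iota>) \<and>
    radial_part Md K C1_differentiable_on {-1<..<1} \<and>
    (\<exists>f\<^sub>1 f\<^sub>2 K\<^sub>1 K\<^sub>2.
       continuous_kernel M K\<^sub>1 \<and> positive_definite_kernel M K\<^sub>1 \<and> zonal_kernel M H K\<^sub>1 \<and>
       f\<^sub>1 = radial_part M K\<^sub>1 \<and>
       continuous_kernel M K\<^sub>2 \<and> positive_definite_kernel M K\<^sub>2 \<and> zonal_kernel M H K\<^sub>2 \<and>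
       f\<^sub>2 = radial_part M K\<^sub>2 \<and>
       (\<forall>t\<in>{-1<..<1}. (1 - t\<^sup>2) * deriv (radial_part Md K) t = f\<^sub>1 t - f\<^sub>2 t))"
proof -
  have "great_arc U \<tau> (\<lambda>s. e (\<gamma> s))"
    using arc e unfolding great_arc_def by (simp add: image_subset_iff)
  then interpret Md: modelled_space Md U \<tau> \<psi> "\<lambda>s. e (\<gamma> s)" by unfold_locales (rule Md)
  interpret M: modelled_space M U' \<tau>' \<psi>' \<gamma> by unfold_locales (rule M arc)+
  define \<iota> where "\<iota> x = \<psi> (e (inv_into U' \<psi>' x))" for x
  have inv: "inv_into U' \<psi>' x \<in> U'" "\<psi>' (inv_into U' \<psi>' x) = x" if "x \<in> mspace M" for x
    using that unfolding M.surj[symmetric] by (auto intro: inv_into_into f_inv_into_f)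
  have embedding: "isometric_embedding M Md \<iota>"
    unfolding isometric_embedding_def
  proof (intro conjI ballI)
    show "\<iota> ` mspace M \<subseteq> mspace Md" using inv(1) e(1) Md.surj unfolding \<iota>_def by blast
    fix x y assume xy: "x \<in> mspace M" "y \<in> mspace M"
    have "mdist Md (\<iota> x) (\<iota> y) = 2 * arccos (\<tau>' (inv_into U' \<psi>' x) (inv_into U' \<psi>' y))"
      unfolding \<iota>_def using Md.dist inv(1)[OF xy(1)] inv(1)[OF xy(2)] e by (simp add: image_subset_iff)
    also have "\<dots> = mdist M x y" using M.dist[OF inv(1)[OF xy(1)] inv(1)[OF xy(2)]] inv(2) xy by simp
    finally show "mdist Md (\<iota> x) (\<iota> y) = mdist M x y" .
  qed
  obtain f where f: "radial_part Md K = restrict f {-1..1}"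
    "\<And>x y. x \<in> mspace Md \<Longrightarrow> y \<in> mspace Md \<Longrightarrow> K x y = f (Md.cosine x y)"
    "\<And>t. f t = K (Md.arc_point t) (Md.arc_point 1)"
    by (rule Md.zonal_radial[OF G K(3)]) (rule that)
  have f_cont: "continuous_on {-1..1} f" by (rule Md.radial_continuous[OF K(1) f(3)])
  have "posdef U (\<lambda>u v. K (\<psi> u) (\<psi> v))"
    using Md.surj by (intro posdef_image[OF positive_definite_kernel_imp_posdef[OF K(2)]]) simp
  also have "?this \<longleftrightarrow> posdef U (\<lambda>u v. f (\<tau> u v))"
  proof (rule posdef_cong)
    fix u v assume uv: "u \<in> U" "v \<in> U"
    then have "\<psi> u \<in> mspace Md" "\<psi> v \<in> mspace Md" using Md.surj by auto
    then show "K (\<psi> u) (\<psi> v) = f (\<tau> u v)" using f(2) Md.cosine[OF uv] by simp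
  qed
  finally have "posdef U (\<lambda>u v. f (\<tau> u v))" .
  then obtain f\<^sub>1 f\<^sub>2 where f12: "continuous_on {-1..1} f\<^sub>1" "continuous_on {-1..1} f\<^sub>2"
    "posdef U' (\<lambda>x y. f\<^sub>1 (\<tau>' x y))" "posdef U' (\<lambda>x y. f\<^sub>2 (\<tau>' x y))"
    and D: "\<And>t. t \<in> {-1<..<1} \<Longrightarrow> \<exists>D. (f has_real_derivative D) (at t) \<and> (1 - t\<^sup>2) * D = f\<^sub>1 t - f\<^sub>2 t"
    using splits[unfolded splits_def, rule_format, OF f_cont] by blast
  have pos: "0 < 1 - t\<^sup>2" if "t \<in> {-1<..<1}" for t :: real
    using that abs_square_less_1[of t] by (auto simp: abs_less_iff)
  define f' where "f' t = (f\<^sub>1 t - f\<^sub>2 t) / (1 - t\<^sup>2)" for t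
  have deriv: "(radial_part Md K has_real_derivative f' t) (at t)" if t: "t \<in> {-1<..<1}" for t
  proof -
    obtain D' where "(f has_real_derivative D') (at t)" "(1 - t\<^sup>2) * D' = f\<^sub>1 t - f\<^sub>2 t" using D[OF t] by blast
    moreover from this(2) have "D' = f' t" using pos[OF t] by (simp add: f'_def field_simps)
    moreover have "eventually (\<lambda>s. f s = radial_part Md K s) (nhds t)"
      unfolding f(1) using t by (intro eventually_mono[OF eventually_nhds_in_open[of "{-1<..<1}" t]]) auto
    ultimately show ?thesis using DERIV_cong_ev[OF refl _ refl, of f "radial_part Md K" t] by simp
  qed
  have sub: "{-1<..<1} \<subseteq> {-1..1 :: real}" by auto
  have "continuous_on {-1<..<1} f'"
    unfolding f'_def[abs_def]
    by (intro continuous_intros continuous_on_subset[OF f12(1) sub] continuous_on_subset[OF f12(2) sub]) (use pos in force)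
  then have C1: "radial_part Md K C1_differentiable_on {-1<..<1}"
    unfolding C1_differentiable_on_def using deriv
    by (intro exI[of _ f']) (auto simp: has_real_derivative_iff_has_vector_derivative)
  have zonal: "zonal_kernel M H (\<lambda>x y. h (M.cosine x y))" for h
    using H unfolding zonal_kernel_def motion_group_def M.cosine_def by simp
  have "\<exists>K'. continuous_kernel M K' \<and> positive_definite_kernel M K' \<and> zonal_kernel M H K' \<and> radial_part M K' = restrict h {-1..1}"
    if "continuous_on {-1..1} h" "posdef U' (\<lambda>x y. h (\<tau>' x y))" for h
    using M.continuous_radial_kernel[OF that(1)] M.posdef_radial_kernel[OF that(2)] zonal[of h] M.radial_part_eq[of "\<lambda>x y. h (M.cosine x y)" h]
    by blast
  from this[OF f12(1,3)] this[OF f12(2,4)] obtain K\<^sub>1 K\<^sub>2 where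
    K1: "continuous_kernel M K\<^sub>1" "positive_definite_kernel M K\<^sub>1" "zonal_kernel M H K\<^sub>1" "radial_part M K\<^sub>1 = restrict f\<^sub>1 {-1..1}" and
    K2: "continuous_kernel M K\<^sub>2" "positive_definite_kernel M K\<^sub>2" "zonal_kernel M H K\<^sub>2" "radial_part M K\<^sub>2 = restrict f\<^sub>2 {-1..1}"
    by blast
  have eq: "(1 - t\<^sup>2) * deriv (radial_part Md K) t = restrict f\<^sub>1 {-1..1} t - restrict f\<^sub>2 {-1..1} t" if t: "t \<in> {-1<..<1}" for t
    using DERIV_imp_deriv[OF deriv[OF t]] pos[OF t] t by (simp add: f'_def)
  show ?thesis
    by (intro conjI exI[of _ \<iota>] exI[of _ "restrict f\<^sub>1 {-1..1}"] exI[of _ "restrict f\<^sub>2 {-1..1}"] exI[of _ K\<^sub>1] exI[of _ K\<^sub>2]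
        ballI embedding C1 K1(1-3) K1(4)[symmetric] K2(1-3) K2(4)[symmetric] eq)
qed

section \<open>Models of spheres and projective spaces\<close>

text \<open>For a projective space, \<open>U\<close> consists of unit vectors and \<open>q\<close> forms their lines; otherwise
  \<open>q\<close> is the identity.\<close>

lemma models_from_isometry:
  assumes X: "isometric_to X S \<delta>" and q: "q ` U = S"
    and \<tau>: "\<And>u v. u \<in> U \<Longrightarrow> v \<in> U \<Longrightarrow> \<tau> u v \<in> {-1..1} \<and> \<delta> (q u) (q v) = 2 * arccos (\<tau> u v)"
  obtains \<psi> where "models X U \<tau> \<psi>"
proof -
  obtain \<phi> where bij: "bij_betw \<phi> (mspace X) S"
    and iso: "\<And>x y. x \<in> mspace X \<Longrightarrow> y \<in> mspace X \<Longrightarrow> mdist X x y = \<delta> (\<phi> x) (\<phi> y)"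
    using X unfolding isometric_to_def by blast
  define \<psi> where "\<psi> u = inv_into (mspace X) \<phi> (q u)" for u
  have inv: "inv_into (mspace X) \<phi> ` S = mspace X" by (rule bij_betw_imp_surj_on[OF bij_betw_inv_into[OF bij]])
  have "\<psi> ` U = inv_into (mspace X) \<phi> ` (q ` U)" unfolding \<psi>_def by (simp add: image_image)
  then have 1: "\<psi> ` U = mspace X" using q inv by simp
  have "\<phi> (\<psi> u) = q u" if "u \<in> U" for u
    unfolding \<psi>_def using that q by (intro bij_betw_inv_into_right[OF bij]) auto
  then have "mdist X (\<psi> u) (\<psi> v) = 2 * arccos (\<tau> u v)" if "u \<in> U" "v \<in> U" for u v
    using iso[of "\<psi> u" "\<psi> v"] 1 \<tau> that by auto
  then have "models X U \<tau> \<psi>" unfolding models_def using 1 \<tau> by blast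
  then show thesis by (rule that)
qed

lemma sphere_model:
  assumes "unit_sphere d X"
  obtains \<psi> where "models X (unit_vectors d :: (nat \<Rightarrow> real) set) (dot d) \<psi>"
proof (rule models_from_isometry[OF assms[unfolded unit_sphere_def], of "\<lambda>u. u" "unit_vectors d" "dot d"])
  fix u v :: "nat \<Rightarrow> real" assume "u \<in> unit_vectors d" "v \<in> unit_vectors d"
  then show "dot d u v \<in> {-1..1} \<and> sphere_dist d u v = 2 * arccos (dot d u v)"
    using dot_unit_bound by (simp add: sphere_dist_def)
qed (use that in auto)

lemma sphere_arc:
  assumes "1 \<le> d"
  shows "great_arc (unit_vectors d) (dot d) (\<lambda>s. plane_vector (cos (s / 2)) (sin (s / 2) :: real))"
  unfolding great_arc_def using assms
  by (auto intro!: plane_vector_unit simp: dot_plane plane_vector_def cos_diff diff_divide_distrib simp flip: power2_eq_square)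

text \<open>The distance in a projective space is four times an angle with cosine \<open>r\<close>; by the double
  angle formula, the cosine of half the distance is \<open>2 r\<^sup>2 - 1\<close>.\<close>

lemma four_arccos:
  assumes "r \<in> {0..1}"
  shows "4 * arccos r = 2 * arccos (2 * r\<^sup>2 - 1)"
proof -
  define \<theta> where "\<theta> = arccos r"
  have r: "cos \<theta> = r" using assms by (simp add: \<theta>_def cos_arccos)
  have "0 \<le> \<theta>" "\<theta> \<le> pi / 2" using assms arccos_le_pi2[of r] arccos_lbound[of r] by (auto simp: \<theta>_def)
  then have "arccos (cos (2 * \<theta>)) = 2 * \<theta>" by (intro arccos_cos) auto
  then show ?thesis by (simp add: cos_double_cos r \<theta>_def[symmetric])
qed

context scalars
begin

lemma unit_vectors_line:
  assumes "u \<in> unit_vectors n"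
  shows "line mul u \<inter> unit_vectors n = scale u ` {c. norm c = 1}"
proof -
  have "scale u c \<in> unit_vectors n \<longleftrightarrow> norm c = 1" for c
  proof
    assume "scale u c \<in> unit_vectors n"
    then have "(norm c)\<^sup>2 = 1" using assms by (simp add: unit_vectors_def dot_scale_self)
    then show "norm c = 1" by (simp add: power2_eq_1_iff) (metis norm_ge_zero neg_0_le_iff_le not_one_le_zero)
  qed (rule scale_unit[OF assms])
  then show ?thesis unfolding line_def scale_def[symmetric] by blast
qed

text \<open>The real inner product of unit vectors in the two lines is at most \<open>|herm n u v|\<close> by the
  Cauchy--Schwarz inequality, with equality for a suitable unit scalar, so the infimum is a
  minimum.\<close>

lemma projective_dist_lines:
  assumes u: "u \<in> unit_vectors n" and v: "v \<in> unit_vectors n"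
  shows "projective_dist n (line mul u) (line mul v) = 4 * arccos (norm (herm n u v))"
proof -
  define H where "H = herm n u v"
  have H: "norm H \<le> 1" using norm_herm_le_1[OF u v] by (simp add: H_def)
  have dot: "dot n (scale u a) (scale v b) = a \<bullet> mul H b" for a b by (simp add: dot_scale herm_scale H_def)
  have "(INF (x, y) \<in> (line mul u \<inter> unit_vectors n) \<times> (line mul v \<inter> unit_vectors n). arccos (dot n x y)) = arccos (norm H)"
  proof (rule cInf_eq_minimum)
    \<comment> \<open>The direction of H; any unit scalar will do if H is zero.\<close>
    define c where "c = (if H = 0 then one else (1 / norm H) *\<^sub>R H)"
    have "norm c = 1" by (simp add: c_def norm_one)
    moreover have "c \<bullet> mul H one = norm H"
      by (simp add: c_def mul_one dot_square_norm power2_eq_square)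
    ultimately show "arccos (norm H) \<in> (\<lambda>(x, y). arccos (dot n x y)) ` ((line mul u \<inter> unit_vectors n) \<times> (line mul v \<inter> unit_vectors n))"
      unfolding unit_vectors_line[OF u] unit_vectors_line[OF v]
      by (intro image_eqI[of _ _ "(scale u c, scale v one)"]) (auto simp: dot norm_one)
  next
    fix z assume "z \<in> (\<lambda>(x, y). arccos (dot n x y)) ` ((line mul u \<inter> unit_vectors n) \<times> (line mul v \<inter> unit_vectors n))"
    then obtain a b where ab: "norm a = 1" "norm b = 1" and z: "z = arccos (dot n (scale u a) (scale v b))"
      unfolding unit_vectors_line[OF u] unit_vectors_line[OF v] by auto
    have "\<bar>dot n (scale u a) (scale v b)\<bar> \<le> norm H"
      unfolding dot using Cauchy_Schwarz_ineq2[of a "mul H b"] ab by (simp add: norm_mul)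
    then show "arccos (norm H) \<le> z" unfolding z using H by (intro arccos_le_arccos) (auto simp: abs_le_iff)
  qed
  then show ?thesis by (simp add: projective_dist_def H_def)
qed

lemma line_scaleR:
  assumes "r \<noteq> 0" shows "line mul (\<lambda>i. r *\<^sub>R u i) = line mul u"
proof (intro equalityI subsetI)
  fix x assume "x \<in> line mul (\<lambda>i. r *\<^sub>R u i)"
  then obtain c where "x = (\<lambda>i. mul (r *\<^sub>R u i) c)" by (auto simp: line_def)
  then have "x = (\<lambda>i. mul (u i) (r *\<^sub>R c))" by (simp add: mul_scale_left mul_scale_right)
  then show "x \<in> line mul u" by (auto simp: line_def)
next
  fix x assume "x \<in> line mul u"
  then obtain c where "x = (\<lambda>i. mul (u i) c)" by (auto simp: line_def)
  then have "x = (\<lambda>i. mul (r *\<^sub>R u i) ((1 / r) *\<^sub>R c))" using assms by (simp add: mul_scale_left mul_scale_right)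
  then show "x \<in> line mul (\<lambda>i. r *\<^sub>R u i)" by (auto simp: line_def)
qed

lemma lines_of_unit_vectors: "line mul ` unit_vectors n = projective_points mul n"
proof (intro equalityI subsetI)
  fix L assume "L \<in> line mul ` unit_vectors n"
  then obtain u where u: "u \<in> unit_vectors n" "L = line mul u" by blast
  then have "u \<noteq> (\<lambda>i. 0)" by (auto simp: unit_vectors_def dot_def)
  then show "L \<in> projective_points mul n" using u by (auto simp: projective_points_def unit_vectors_def)
next
  fix L assume "L \<in> projective_points mul n"
  then obtain v where v: "L = line mul v" "v \<in> coordinate_vectors n" "v \<noteq> (\<lambda>i. 0)" by (auto simp: projective_points_def)
  define r where "r = sqrt (dot n v v)"
  have "dot n v v \<noteq> 0"
  proof
    assume "dot n v v = 0"
    then have "\<forall>i\<le>n. v i = 0" by (simp add: dot_def sum_nonneg_eq_0_iff)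
    then have "v i = 0" for i using v(2) by (cases "i \<le> n") (auto simp: coordinate_vectors_def)
    then show False using v(3) by blast
  qed
  then have r: "r \<noteq> 0" "r * r = dot n v v" using dot_self_nonneg[of n v] by (auto simp: r_def)
  define u where "u = (\<lambda>i. (1 / r) *\<^sub>R v i)"
  have "dot n u u = (1 / r) * ((1 / r) * dot n v v)" unfolding u_def by (simp only: dot_scale_left dot_scale_right)
  then have "dot n u u = (1 / r) * ((1 / r) * (r * r))" by (simp only: r(2))
  then have "dot n u u = 1" using r(1) by simp
  then have "u \<in> unit_vectors n" using v(2) by (simp add: unit_vectors_def coordinate_vectors_def u_def)
  moreover have "L = line mul u" using line_scaleR[of "1 / r" v] r v(1) by (simp add: u_def)
  ultimately show "L \<in> line mul ` unit_vectors n" by blast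
qed

lemma projective_model:
  assumes "isometric_to X (projective_points mul n) (projective_dist n)"
  obtains \<psi> where "models X (unit_vectors n) (\<lambda>x y. 2 * overlap n x y - 1) \<psi>"
proof (rule models_from_isometry[OF assms lines_of_unit_vectors, of "\<lambda>x y. 2 * overlap n x y - 1"])
  fix u v :: "nat \<Rightarrow> 'f" assume uv: "u \<in> unit_vectors n" "v \<in> unit_vectors n"
  have "norm (herm n u v) \<in> {0..1}" using norm_herm_le_1[OF uv] by simp
  then show "2 * overlap n u v - 1 \<in> {-1..1} \<and> projective_dist n (line mul u) (line mul v) = 2 * arccos (2 * overlap n u v - 1)"
    using overlap_range[OF uv] by (simp add: projective_dist_lines[OF uv] four_arccos overlap_def)
qed (rule that)

lemma mul_cj_scale: "mul (cj (r *\<^sub>R x)) y = r *\<^sub>R mul (cj x) y"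
proof -
  have "z \<bullet> mul (cj (r *\<^sub>R x)) y = z \<bullet> (r *\<^sub>R mul (cj x) y)" for z
    by (simp add: adjoint[symmetric] mul_scale_left)
  then show ?thesis using vector_eq_ldot by blast
qed

lemma projective_arc:
  assumes "1 \<le> n"
  shows "great_arc (unit_vectors n) (\<lambda>x y. 2 * overlap n x y - 1)
    (\<lambda>s. plane_vector (cos (s / 4) *\<^sub>R one) (sin (s / 4) *\<^sub>R one))"
  unfolding great_arc_def
proof (intro ballI conjI)
  fix s s' :: real
  have one: "one \<bullet> one = 1" using norm_one by (simp add: norm_eq_1)
  show "plane_vector (cos (s / 4) *\<^sub>R one) (sin (s / 4) *\<^sub>R one) \<in> unit_vectors n"
    using assms by (intro plane_vector_unit) (auto simp: one simp flip: power2_eq_square)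
  have "herm n (plane_vector (cos (s / 4) *\<^sub>R one) (sin (s / 4) *\<^sub>R one)) (plane_vector (cos (s' / 4) *\<^sub>R one) (sin (s' / 4) *\<^sub>R one)) =
      cos (s / 4 - s' / 4) *\<^sub>R mul (cj one) one"
    using assms by (simp add: herm_plane plane_vector_def mul_cj_scale mul_scale_right cos_diff algebra_simps)
  then have "overlap n (plane_vector (cos (s / 4) *\<^sub>R one) (sin (s / 4) *\<^sub>R one)) (plane_vector (cos (s' / 4) *\<^sub>R one) (sin (s' / 4) *\<^sub>R one)) =
      (cos (s / 4 - s' / 4))\<^sup>2"
    by (simp add: overlap_def norm_mul norm_cj norm_one power_mult_distrib)
  moreover have "(s - s') / 2 = 2 * (s / 4 - s' / 4)" by simp
  ultimately show "2 * overlap n (plane_vector (cos (s / 4) *\<^sub>R one) (sin (s / 4) *\<^sub>R one)) (plane_vector (cos (s' / 4) *\<^sub>R one) (sin (s' / 4) *\<^sub>R one)) - 1 =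
      cos ((s - s') / 2)"
    by (simp only: cos_double_cos)
qed

end

lemma real_overlap: "real_scalars.overlap n x y = (dot n x y)\<^sup>2"
  by (simp add: real_scalars.overlap_def real_scalars.herm_def dot_def)

section \<open>Octonions\<close>

lemma quat_right_adjoint: "quat_mult x (quat_cnj y) \<bullet> z = x \<bullet> quat_mult z y"
  by (simp add: quat_mult_def quat_cnj_def inner_prod_def inner_complex_def algebra_simps)

text \<open>The octonions form a composition algebra: the mixed terms of the Cayley--Dickson product
  cancel because quaternion multiplication is associative.\<close>

lemma norm_oct_mult: "norm (oct_mult x y) = norm x * norm y"
proof -
  obtain a b c d where xy: "x = (a, b)" "y = (c, d)" by (cases x, cases y)
  have "quat_mult a c \<bullet> quat_mult (quat_cnj d) b = quat_mult d a \<bullet> quat_mult b (quat_cnj c)"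
  proof -
    have "quat_mult a c \<bullet> quat_mult (quat_cnj d) b = quat_mult d (quat_mult a c) \<bullet> b"
      by (simp add: quaternion_scalars.adjoint)
    also have "\<dots> = quat_mult b (quat_cnj c) \<bullet> quat_mult d a"
      using quat_right_adjoint[of b c "quat_mult d a"] by (simp add: quaternion_scalars.mul_assoc inner_commute)
    finally show ?thesis by (simp add: inner_commute)
  qed
  then have "(norm (oct_mult x y))\<^sup>2 = (norm (quat_mult a c))\<^sup>2 + (norm (quat_mult (quat_cnj d) b))\<^sup>2 +
      ((norm (quat_mult d a))\<^sup>2 + (norm (quat_mult b (quat_cnj c)))\<^sup>2)"
    by (simp add: xy oct_mult_def norm_Pair power2_norm_eq_inner inner_diff_left inner_diff_right inner_add_left inner_add_right
        inner_commute[of "quat_mult (quat_cnj d) b" "quat_mult a c"] inner_commute[of "quat_mult b (quat_cnj c)" "quat_mult d a"])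
  also have "\<dots> = (norm x * norm y)\<^sup>2"
    by (simp add: xy norm_Pair norm_quat_mult quaternion_scalars.norm_cj power_mult_distrib algebra_simps)
  finally show ?thesis by (simp add: power2_eq_iff_nonneg)
qed

lemma oct_mult_add: "oct_mult (x + y) z = oct_mult x z + oct_mult y z" "oct_mult x (y + z) = oct_mult x y + oct_mult x z"
  by (auto simp: oct_mult_def quat_mult_def quat_cnj_def algebra_simps)

lemma oct_mult_scaleR: "oct_mult (r *\<^sub>R x) y = r *\<^sub>R oct_mult x y" "oct_mult x (r *\<^sub>R y) = r *\<^sub>R oct_mult x y"
  by (auto simp: oct_mult_def quat_mult_def quat_cnj_def scaleR_prod_def algebra_simps)

lemma oct_mult_one: "oct_mult oct_one x = x" "oct_mult x oct_one = x"
  by (auto simp: oct_mult_def quat_mult_def quat_cnj_def oct_one_def prod_eq_iff)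

lemma oct_mult_zero: "oct_mult 0 x = 0" "oct_mult x 0 = 0"
  using oct_mult_scaleR(1)[of 0 0 x] oct_mult_scaleR(2)[of x 0 0] by simp_all

lemma oct_cnj_inner: "oct_cnj x \<bullet> oct_cnj y = x \<bullet> y"
  by (simp add: oct_cnj_def quat_cnj_def inner_prod_def inner_complex_def)

lemma oct_cnj_cnj: "oct_cnj (oct_cnj x) = x"
  by (simp add: oct_cnj_def quat_cnj_def)

lemma oct_mult_cnj: "oct_mult x (oct_cnj x) = (norm x)\<^sup>2 *\<^sub>R oct_one"
proof -
  obtain a b c d where "x = ((a, b), (c, d))" by (metis surj_pair)
  then show ?thesis
    by (simp add: oct_mult_def oct_cnj_def quat_mult_def quat_cnj_def oct_one_def norm_Pair complex_mult_cnj cmod_power2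
        scaleR_prod_def complex_eq_iff algebra_simps)
qed

lemma oct_one_inner: "oct_one \<bullet> oct_one = 1"
  by (simp add: oct_one_def inner_prod_def inner_complex_def)

lemma norm_oct_one: "norm oct_one = 1"
  using oct_one_inner by (simp add: norm_eq_1)

lemma oct_mult_inner_left: "oct_mult x y \<bullet> oct_mult x z = (norm x)\<^sup>2 * (y \<bullet> z)"
proof -
  have "(norm (oct_mult x (y + z)))\<^sup>2 = (norm x)\<^sup>2 * (norm (y + z))\<^sup>2"
    "(norm (oct_mult x y))\<^sup>2 = (norm x)\<^sup>2 * (norm y)\<^sup>2" "(norm (oct_mult x z))\<^sup>2 = (norm x)\<^sup>2 * (norm z)\<^sup>2"
    by (simp_all add: norm_oct_mult power_mult_distrib)
  then show ?thesis
    unfolding oct_mult_add power2_norm_eq_inner[of "_ + _"] inner_add_left inner_add_right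
    by (simp add: inner_commute[of "oct_mult x z" "oct_mult x y"] inner_commute[of z y] power2_norm_eq_inner algebra_simps)
qed

lemma oct_mult_inner_right: "oct_mult y x \<bullet> oct_mult z x = (y \<bullet> z) * (norm x)\<^sup>2"
proof -
  have "(norm (oct_mult (y + z) x))\<^sup>2 = (norm (y + z))\<^sup>2 * (norm x)\<^sup>2"
    "(norm (oct_mult y x))\<^sup>2 = (norm y)\<^sup>2 * (norm x)\<^sup>2" "(norm (oct_mult z x))\<^sup>2 = (norm z)\<^sup>2 * (norm x)\<^sup>2"
    by (simp_all add: norm_oct_mult power_mult_distrib)
  then show ?thesis
    unfolding oct_mult_add power2_norm_eq_inner[of "_ + _"] inner_add_left inner_add_right
    by (simp add: inner_commute[of "oct_mult z x" "oct_mult y x"] inner_commute[of z y] power2_norm_eq_inner algebra_simps)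
qed

lemma projection_residual:
  fixes a c :: "'b::real_inner"
  assumes "c \<noteq> 0"
  shows "(norm (a - ((a \<bullet> c) / (norm c)\<^sup>2) *\<^sub>R c))\<^sup>2 * (norm c)\<^sup>2 = (norm a)\<^sup>2 * (norm c)\<^sup>2 - (a \<bullet> c)\<^sup>2"
proof -
  define l where "l = (a \<bullet> c) / (norm c)\<^sup>2"
  have l: "l * (c \<bullet> c) = a \<bullet> c" using assms by (simp add: l_def power2_norm_eq_inner)
  have "(norm (a - l *\<^sub>R c))\<^sup>2 = a \<bullet> a - 2 * l * (a \<bullet> c) + l * (l * (c \<bullet> c))"
    by (simp add: power2_norm_eq_inner inner_diff_left inner_diff_right inner_commute[of c a] algebra_simps)
  then have n: "(norm (a - l *\<^sub>R c))\<^sup>2 = a \<bullet> a - l * (a \<bullet> c)" unfolding l by linarith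
  have "(a \<bullet> a - l * (a \<bullet> c)) * (c \<bullet> c) = (a \<bullet> a) * (c \<bullet> c) - (l * (c \<bullet> c)) * (a \<bullet> c)"
    by (simp add: algebra_simps)
  also have "\<dots> = (a \<bullet> a) * (c \<bullet> c) - (a \<bullet> c)\<^sup>2" unfolding l by (simp only: power2_eq_square)
  finally show ?thesis unfolding l_def[symmetric] n by (simp only: power2_norm_eq_inner)
qed

text \<open>Split off from \<open>a\<close> its component along \<open>c\<close> and from \<open>e\<close> its component along \<open>f\<close>. Left and
  right multiplications are similarities, so the main term of \<open>a e \<bullet> c f\<close> is \<open>(a \<bullet> c) (e \<bullet> f)\<close>,
  the mixed terms vanish, and the Cauchy--Schwarz inequality applies to the product of the two
  remainders.\<close>

lemma oct_mult_correlation: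
  "(oct_mult a e \<bullet> oct_mult c f - (a \<bullet> c) * (e \<bullet> f))\<^sup>2 \<le>
     ((norm a)\<^sup>2 * (norm c)\<^sup>2 - (a \<bullet> c)\<^sup>2) * ((norm e)\<^sup>2 * (norm f)\<^sup>2 - (e \<bullet> f)\<^sup>2)"
proof (cases "c = 0 \<or> f = 0")
  case True
  then show ?thesis by (auto simp: oct_mult_zero)
next
  case False
  define a' where "a' = a - ((a \<bullet> c) / (norm c)\<^sup>2) *\<^sub>R c"
  define e' where "e' = e - ((e \<bullet> f) / (norm f)\<^sup>2) *\<^sub>R f"
  have a: "a = ((a \<bullet> c) / (norm c)\<^sup>2) *\<^sub>R c + a'" and e: "e = ((e \<bullet> f) / (norm f)\<^sup>2) *\<^sub>R f + e'"
    by (simp_all add: a'_def e'_def)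
  have cf: "(norm c)\<^sup>2 \<noteq> 0" "(norm f)\<^sup>2 \<noteq> 0" using False by auto
  have "a' \<bullet> c = 0" using cf by (simp add: a'_def inner_diff_left power2_norm_eq_inner)
  have na: "(norm a')\<^sup>2 * (norm c)\<^sup>2 = (norm a)\<^sup>2 * (norm c)\<^sup>2 - (a \<bullet> c)\<^sup>2"
    unfolding a'_def using False by (intro projection_residual) simp
  have ne: "(norm e')\<^sup>2 * (norm f)\<^sup>2 = (norm e)\<^sup>2 * (norm f)\<^sup>2 - (e \<bullet> f)\<^sup>2"
    unfolding e'_def using False by (intro projection_residual) simp
  have "oct_mult a e \<bullet> oct_mult c f = ((a \<bullet> c) / (norm c)\<^sup>2) * (oct_mult c e \<bullet> oct_mult c f) + oct_mult a' e \<bullet> oct_mult c f"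
    by (subst a) (simp add: oct_mult_add oct_mult_scaleR inner_add_left)
  also have "\<dots> = (a \<bullet> c) * (e \<bullet> f) + oct_mult a' e \<bullet> oct_mult c f"
    using cf by (simp add: oct_mult_inner_left)
  also have "oct_mult a' e \<bullet> oct_mult c f = ((e \<bullet> f) / (norm f)\<^sup>2) * (oct_mult a' f \<bullet> oct_mult c f) + oct_mult a' e' \<bullet> oct_mult c f"
    by (subst e) (simp add: oct_mult_add oct_mult_scaleR inner_add_left)
  also have "oct_mult a' f \<bullet> oct_mult c f = 0" using \<open>a' \<bullet> c = 0\<close> by (simp add: oct_mult_inner_right)
  finally have "oct_mult a e \<bullet> oct_mult c f - (a \<bullet> c) * (e \<bullet> f) = oct_mult a' e' \<bullet> oct_mult c f" by simp
  then have "(oct_mult a e \<bullet> oct_mult c f - (a \<bullet> c) * (e \<bullet> f))\<^sup>2 \<le> (oct_mult a' e' \<bullet> oct_mult a' e') * (oct_mult c f \<bullet> oct_mult c f)"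
    by (simp add: Cauchy_Schwarz_ineq)
  also have "\<dots> = ((norm a')\<^sup>2 * (norm c)\<^sup>2) * ((norm e')\<^sup>2 * (norm f)\<^sup>2)"
    by (simp add: norm_oct_mult power_mult_distrib flip: power2_norm_eq_inner)
  finally show ?thesis unfolding na ne .
qed

section \<open>The Cayley plane\<close>

lemma Cayley_pointsD:
  assumes "x \<in> Cayley_points"
  shows "x $ j $ i = oct_cnj (x $ i $ j)" "(\<Sum>k\<in>UNIV. oct_mult (x $ i $ k) (x $ k $ j)) = x $ i $ j"
    "(\<Sum>i\<in>UNIV. x $ i $ i) = oct_one"
  using assms unfolding Cayley_points_def by blast+

definition diagonal :: "octonion ^ 3 ^ 3 \<Rightarrow> 3 \<Rightarrow> real" where
  "diagonal x i = Re (fst (fst (x $ i $ i)))"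

lemma oct_self_conjugate: "oct_cnj z = z \<Longrightarrow> z = Re (fst (fst z)) *\<^sub>R oct_one"
  by (cases z; cases "fst z"; cases "snd z")
    (auto simp: oct_cnj_def quat_cnj_def oct_one_def scaleR_prod_def complex_eq_iff eq_neg_iff_add_eq_0 prod_eq_iff)

lemma Cayley_diagonal: "x \<in> Cayley_points \<Longrightarrow> x $ i $ i = diagonal x i *\<^sub>R oct_one"
  unfolding diagonal_def using Cayley_pointsD(1)[of x i i] by (intro oct_self_conjugate) simp

lemma Cayley_diagonal_norm:
  assumes "x \<in> Cayley_points"
  shows "diagonal x i = (\<Sum>k\<in>UNIV. (norm (x $ i $ k))\<^sup>2)"
proof -
  have "diagonal x i *\<^sub>R oct_one = (\<Sum>k\<in>UNIV. oct_mult (x $ i $ k) (x $ k $ i))"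
    using Cayley_pointsD(2)[OF assms, of i i] Cayley_diagonal[OF assms] by simp
  also have "\<dots> = (\<Sum>k\<in>UNIV. (norm (x $ i $ k))\<^sup>2 *\<^sub>R oct_one)"
    using Cayley_pointsD(1)[OF assms, of _ i] by (intro sum.cong refl) (simp add: oct_mult_cnj)
  also have "\<dots> = (\<Sum>k\<in>UNIV. (norm (x $ i $ k))\<^sup>2) *\<^sub>R oct_one" by (simp only: scaleR_sum_left)
  finally have "diagonal x i *\<^sub>R oct_one \<bullet> oct_one = (\<Sum>k\<in>UNIV. (norm (x $ i $ k))\<^sup>2) *\<^sub>R oct_one \<bullet> oct_one" by (rule arg_cong)
  then show ?thesis by (simp add: oct_one_inner)
qed

lemma Cayley_trace: "x \<in> Cayley_points \<Longrightarrow> (\<Sum>i\<in>UNIV. diagonal x i) = 1"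
  using arg_cong[OF Cayley_pointsD(3)[of x], of "\<lambda>z. z \<bullet> oct_one"] Cayley_diagonal[of x]
  by (simp add: inner_sum_left oct_one_inner)

lemma UNIV_3_distinct: "i \<noteq> j \<Longrightarrow> i \<noteq> k \<Longrightarrow> j \<noteq> k \<Longrightarrow> (UNIV :: 3 set) = {i, j, k}"
  using exhaust_3[of i] exhaust_3[of j] exhaust_3[of k] by (auto simp: UNIV_3)

lemma sum_3_distinct:
  fixes i j k :: 3
  assumes "i \<noteq> j" "i \<noteq> k" "j \<noteq> k"
  shows "(\<Sum>l\<in>UNIV. f l) = f i + f j + (f k :: 'b::comm_monoid_add)"
  unfolding UNIV_3_distinct[OF assms] using assms by (simp add: add.assoc)

context
  fixes i j k :: 3
  assumes distinct: "i \<noteq> j" "i \<noteq> k" "j \<noteq> k"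
begin

text \<open>The entry \<open>i, j\<close> of \<open>x x = x\<close>, together with trace one. In contrast to matrices over an
  associative algebra, this identity is what remains of the description of \<open>x\<close> as a matrix of
  rank one.\<close>

lemma Cayley_off_diagonal:
  assumes x: "x \<in> Cayley_points"
  shows "diagonal x k *\<^sub>R x $ i $ j = oct_mult (x $ i $ k) (oct_cnj (x $ j $ k))"
proof -
  have product: "x $ i $ j = diagonal x i *\<^sub>R x $ i $ j + diagonal x j *\<^sub>R x $ i $ j + oct_mult (x $ i $ k) (x $ k $ j)"
    using Cayley_pointsD(2)[OF x, of i j] Cayley_diagonal[OF x]
    by (simp add: sum_3_distinct[OF distinct] oct_mult_scaleR oct_mult_one)
  have "diagonal x i + diagonal x j + diagonal x k = 1"
    using Cayley_trace[OF x] by (simp add: sum_3_distinct[OF distinct])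
  then have k: "diagonal x k = 1 - diagonal x i - diagonal x j" by simp
  have shift: "z - a - b = c" if "z = a + b + c" for z a b c :: octonion
    using that by simp
  have "diagonal x k *\<^sub>R x $ i $ j = oct_mult (x $ i $ k) (x $ k $ j)"
    unfolding k scaleR_diff_left scaleR_one by (rule shift[OF product])
  then show ?thesis using Cayley_pointsD(1)[OF x, of k j] by simp
qed

text \<open>The three diagonal entries of \<open>x x = x\<close> are linear equations for the squared norms of the
  three off-diagonal entries.\<close>

lemma Cayley_norm:
  assumes x: "x \<in> Cayley_points"
  shows "(norm (x $ i $ j))\<^sup>2 = diagonal x i * diagonal x j"
proof -
  have n: "norm (x $ q $ p) = norm (x $ p $ q)" for p q
    using Cayley_pointsD(1)[OF x, of q p] oct_cnj_inner[of "x $ p $ q" "x $ p $ q"] by (simp add: norm_eq_sqrt_inner)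
  have d: "diagonal x p = (norm (x $ p $ i))\<^sup>2 + (norm (x $ p $ j))\<^sup>2 + (norm (x $ p $ k))\<^sup>2" for p
    using Cayley_diagonal_norm[OF x, of p] by (simp add: sum_3_distinct[OF distinct])
  have s: "(norm (x $ p $ p))\<^sup>2 = (diagonal x p)\<^sup>2" for p
    unfolding Cayley_diagonal[OF x, of p] by (simp add: norm_oct_one)
  have t: "diagonal x i + diagonal x j + diagonal x k = 1"
    using Cayley_trace[OF x] by (simp add: sum_3_distinct[OF distinct])
  define A where "A = (norm (x $ i $ j))\<^sup>2"
  define B where "B = (norm (x $ i $ k))\<^sup>2"
  define C where "C = (norm (x $ j $ k))\<^sup>2"
  have "diagonal x i = (diagonal x i)\<^sup>2 + A + B" "diagonal x j = A + (diagonal x j)\<^sup>2 + C" "diagonal x k = B + C + (diagonal x k)\<^sup>2"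
    using d[of i] d[of j] d[of k] by (simp_all add: s n[of j i] n[of k i] n[of k j] A_def B_def C_def)
  then have "2 * A = diagonal x i - (diagonal x i)\<^sup>2 + (diagonal x j - (diagonal x j)\<^sup>2) - (diagonal x k - (diagonal x k)\<^sup>2)" by linarith
  also have "diagonal x k = 1 - diagonal x i - diagonal x j" using t by simp
  finally show ?thesis unfolding A_def[symmetric] by (simp add: power2_eq_square algebra_simps)
qed

lemma Cayley_inner:
  assumes x: "x \<in> Cayley_points" and y: "y \<in> Cayley_points"
  shows "x \<bullet> y = diagonal x i * diagonal y i + diagonal x j * diagonal y j + diagonal x k * diagonal y k +
    2 * (x $ i $ j \<bullet> y $ i $ j + x $ i $ k \<bullet> y $ i $ k + x $ j $ k \<bullet> y $ j $ k)"
proof -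
  have n: "x $ q $ p \<bullet> y $ q $ p = x $ p $ q \<bullet> y $ p $ q" for p q
    using Cayley_pointsD(1)[OF x, of q p] Cayley_pointsD(1)[OF y, of q p] by (simp add: oct_cnj_inner)
  have d: "x $ p $ p \<bullet> y $ p $ p = diagonal x p * diagonal y p" for p
    using Cayley_diagonal[OF x, of p] Cayley_diagonal[OF y, of p] by (simp add: oct_one_inner)
  show ?thesis
    by (simp add: inner_vec_def sum_3_distinct[OF distinct] n[of j i] n[of k i] n[of k j] d)
qed

end

lemma Cayley_diagonal_nonneg: "x \<in> Cayley_points \<Longrightarrow> 0 \<le> diagonal x i"
  by (simp add: Cayley_diagonal_norm sum_nonneg)

text \<open>Suppose that some diagonal entries \<open>x k k\<close> and \<open>y k k\<close> have a positive product \<open>r\<close>.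
  Multiplying \<open>x \<bullet> y\<close> by \<open>r\<close> allows expressing all entries by the columns \<open>(a, b)\<close> of \<open>x\<close> and
  \<open>(c, d)\<close> of \<open>y\<close>. Were the octonions associative, the result would be the squared norm of a
  Hermitian product. It still is the square \<open>(r + P + Q)\<^sup>2\<close> plus \<open>U + V + 2 w\<close>, where
  \<open>oct_mult_correlation\<close> bounds \<open>w\<^sup>2\<close> by \<open>U V\<close>. If all these products vanish, then so does every
  term of the inner product.\<close>

lemma Cayley_inner_nonneg:
  assumes x: "x \<in> Cayley_points" and y: "y \<in> Cayley_points"
  shows "0 \<le> x \<bullet> y"
proof (cases "\<exists>k. 0 < diagonal x k * diagonal y k")
  case True
  then obtain k where k: "0 < diagonal x k * diagonal y k" by blast
  obtain i j where ij: "i \<noteq> j" "i \<noteq> k" "j \<noteq> k"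
  proof -
    consider "k = 1" | "k = 2" | "k = 3" using exhaust_3[of k] by (elim disjE)
    then show thesis
      by cases (rule that[of 2 3] that[of 1 3] that[of 1 2]; simp; fail)+
  qed
  define r where "r = diagonal x k * diagonal y k"
  define a b c d where abcd: "a = x $ i $ k" "b = x $ j $ k" "c = y $ i $ k" "d = y $ j $ k"
  define P where "P = a \<bullet> c"
  define Q where "Q = b \<bullet> d"
  define w where "w = oct_mult a (oct_cnj b) \<bullet> oct_mult c (oct_cnj d) - P * Q"
  define U where "U = (norm a)\<^sup>2 * (norm c)\<^sup>2 - P\<^sup>2"
  define V where "V = (norm b)\<^sup>2 * (norm d)\<^sup>2 - Q\<^sup>2"
  have UV: "0 \<le> U" "0 \<le> V" unfolding U_def V_def P_def Q_def
    using Cauchy_Schwarz_ineq[of a c] Cauchy_Schwarz_ineq[of b d] by (simp_all add: power2_norm_eq_inner)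
  have nc: "norm (oct_cnj z) = norm z" for z by (simp add: norm_eq_sqrt_inner oct_cnj_inner)
  have "w\<^sup>2 \<le> U * V"
    using oct_mult_correlation[of a "oct_cnj b" c "oct_cnj d"]
    unfolding w_def U_def V_def P_def Q_def by (simp add: oct_cnj_inner nc)
  moreover have "4 * (U * V) \<le> (U + V)\<^sup>2"
    using zero_le_power2[of "U - V"] by (simp add: power2_eq_square algebra_simps)
  ultimately have "(2 * w)\<^sup>2 \<le> (U + V)\<^sup>2" by (simp add: power_mult_distrib)
  then have "\<bar>2 * w\<bar> \<le> \<bar>U + V\<bar>" unfolding abs_le_square_iff .
  then have w: "0 \<le> U + V + 2 * w" using UV by linarith
  have norms: "(norm a)\<^sup>2 = diagonal x i * diagonal x k" "(norm b)\<^sup>2 = diagonal x j * diagonal x k"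
    "(norm c)\<^sup>2 = diagonal y i * diagonal y k" "(norm d)\<^sup>2 = diagonal y j * diagonal y k"
    unfolding abcd using Cayley_norm[of i k j] Cayley_norm[of j k i] ij x y by auto
  have "r * (x $ i $ j \<bullet> y $ i $ j) = (diagonal x k *\<^sub>R x $ i $ j) \<bullet> (diagonal y k *\<^sub>R y $ i $ j)" by (simp add: r_def)
  also have "\<dots> = w + P * Q" unfolding Cayley_off_diagonal[OF ij x] Cayley_off_diagonal[OF ij y] by (simp add: w_def abcd)
  finally have off: "r * (x $ i $ j \<bullet> y $ i $ j) = w + P * Q" .
  have "r * (x \<bullet> y) = r * (diagonal x i * diagonal y i) + r * (diagonal x j * diagonal y j) + r * r + 2 * (r * (x $ i $ j \<bullet> y $ i $ j)) + 2 * (r * P) + 2 * (r * Q)"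
    unfolding Cayley_inner[OF ij x y] by (simp add: r_def P_def Q_def abcd algebra_simps)
  also have "r * (diagonal x i * diagonal y i) = U + P\<^sup>2" by (simp add: U_def norms r_def mult_ac)
  also have "r * (diagonal x j * diagonal y j) = V + Q\<^sup>2" by (simp add: V_def norms r_def mult_ac)
  finally have "r * (x \<bullet> y) = (r + P + Q)\<^sup>2 + (U + V + 2 * w)"
    unfolding off by (simp add: power2_eq_square algebra_simps)
  then have "0 \<le> r * (x \<bullet> y)" using w by simp
  then show ?thesis using k by (simp add: r_def zero_le_mult_iff)
next
  case False
  then have z: "diagonal x k * diagonal y k = 0" for k
    using Cayley_diagonal_nonneg[OF x, of k] Cayley_diagonal_nonneg[OF y, of k] by (meson linorder_neqE_linordered_idom mult_nonneg_nonneg not_less)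
  have off: "x $ p $ q \<bullet> y $ p $ q = 0" if "p \<noteq> q" for p q
  proof -
    obtain l where l: "p \<noteq> l" "q \<noteq> l"
    proof -
      have "card {p, q} < card (UNIV :: 3 set)" using card_insert_le_m1[of 2 "{q}" p] by simp
      then have "{p, q} \<noteq> UNIV" by auto
      then obtain l where "l \<notin> {p, q}" by blast
      then show ?thesis by (intro that[of l]) auto
    qed
    have "(norm (x $ p $ q))\<^sup>2 * (norm (y $ p $ q))\<^sup>2 = (diagonal x p * diagonal y p) * (diagonal x q * diagonal y q)"
      using Cayley_norm[OF \<open>p \<noteq> q\<close> l x] Cayley_norm[OF \<open>p \<noteq> q\<close> l y] by (simp add: mult_ac)
    then have "x $ p $ q = 0 \<or> y $ p $ q = 0" using z by simp
    then show ?thesis by auto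
  qed
  have d: "(1::3) \<noteq> 2" "(1::3) \<noteq> 3" "(2::3) \<noteq> 3" by simp_all
  show ?thesis unfolding Cayley_inner[OF d x y] z off[OF d(1)] off[OF d(2)] off[OF d(3)] by simp
qed

text \<open>The squared norm of \<open>x\<close> is the trace of \<open>x x = x\<close>.\<close>

lemma Cayley_inner_le_1:
  assumes x: "x \<in> Cayley_points" and y: "y \<in> Cayley_points"
  shows "x \<bullet> y \<le> 1"
proof -
  have "norm x = 1" if "x \<in> Cayley_points" for x
  proof -
    have "x \<bullet> x = (\<Sum>i\<in>UNIV. diagonal x i)"
      by (simp add: inner_vec_def Cayley_diagonal_norm[OF that] power2_norm_eq_inner)
    then show ?thesis using Cayley_trace[OF that] by (simp add: norm_eq_1)
  qed
  then show ?thesis using norm_cauchy_schwarz[of x y] x y by simp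
qed

lemma Cayley_model:
  assumes "Cayley_plane X"
  obtains \<psi> where "models X Cayley_points (\<lambda>x y. 2 * (x \<bullet> y) - 1) \<psi>"
proof (rule models_from_isometry[OF assms[unfolded Cayley_plane_def], of "\<lambda>u. u" Cayley_points "\<lambda>x y. 2 * (x \<bullet> y) - 1"])
  fix x y assume xy: "x \<in> Cayley_points" "y \<in> Cayley_points"
  have r: "0 \<le> x \<bullet> y" "x \<bullet> y \<le> 1" using Cayley_inner_nonneg[OF xy] Cayley_inner_le_1[OF xy] by auto
  then show "2 * (x \<bullet> y) - 1 \<in> {-1..1} \<and> Cayley_dist x y = 2 * arccos (2 * (x \<bullet> y) - 1)"
    using four_arccos[of "sqrt (x \<bullet> y)"] by (simp add: Cayley_dist_def)
qed (simp, rule that)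

text \<open>If \<open>r\<^sup>2 + |z|\<^sup>2 = 1\<close>, the upper left block is one half of the sum of the identity and a
  traceless Hermitian matrix with square one, hence idempotent. These points form a projective
  line of the Cayley plane, isometric to the sphere of dimension 8 with coordinates \<open>r\<close> and \<open>z\<close>.\<close>

definition Cayley_line_point :: "real \<Rightarrow> octonion \<Rightarrow> octonion ^ 3 ^ 3" where
  "Cayley_line_point r z = (\<chi> i j.
     if i = 1 \<and> j = 1 then ((1 + r) / 2) *\<^sub>R oct_one
     else if i = 2 \<and> j = 2 then ((1 - r) / 2) *\<^sub>R oct_one
     else if i = 1 \<and> j = 2 then (1 / 2) *\<^sub>R z
     else if i = 2 \<and> j = 1 then (1 / 2) *\<^sub>R oct_cnj z
     else 0)"

lemma oct_cnj_simps: "oct_cnj (r *\<^sub>R z) = r *\<^sub>R oct_cnj z" "oct_cnj oct_one = oct_one" "oct_cnj 0 = 0"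
  by (simp_all add: oct_cnj_def quat_cnj_def oct_one_def scaleR_prod_def zero_prod_def)

lemma oct_cnj_mult: "oct_mult (oct_cnj z) z = (norm z)\<^sup>2 *\<^sub>R oct_one"
  using oct_mult_cnj[of "oct_cnj z"] by (simp add: oct_cnj_cnj norm_eq_sqrt_inner oct_cnj_inner)

lemma Cayley_line_point:
  assumes "r\<^sup>2 + (norm z)\<^sup>2 = 1"
  shows "Cayley_line_point r z \<in> Cayley_points"
proof -
  have z: "(norm z)\<^sup>2 = 1 - r\<^sup>2" using assms by simp
  have d: "(1::3) \<noteq> 2" "(1::3) \<noteq> 3" "(2::3) \<noteq> 3" by simp_all
  let ?x = "Cayley_line_point r z"
  have e: "?x $ 1 $ 1 = ((1 + r) / 2) *\<^sub>R oct_one" "?x $ 2 $ 2 = ((1 - r) / 2) *\<^sub>R oct_one" "?x $ 1 $ 2 = (1 / 2) *\<^sub>R z"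
    "?x $ 2 $ 1 = (1 / 2) *\<^sub>R oct_cnj z" "?x $ 1 $ 3 = 0" "?x $ 2 $ 3 = 0" "?x $ 3 $ 1 = 0" "?x $ 3 $ 2 = 0" "?x $ 3 $ 3 = 0"
    using d by (simp_all add: Cayley_line_point_def)
  have p: "(1 + r) / 2 * ((1 + r) / 2) + (1 / 2 * (1 / 2)) * (1 - r\<^sup>2) = (1 + r) / 2"
    "(1 / 2 * (1 / 2)) * (1 - r\<^sup>2) + (1 - r) / 2 * ((1 - r) / 2) = (1 - r) / 2"
    by (simp_all add: power2_eq_square field_simps)
  have q: "(1 + r) / 2 * (1 / 2) + (1 / 2) * ((1 - r) / 2) = 1 / 2" "(1 / 2) * ((1 + r) / 2) + (1 - r) / 2 * (1 / 2) = 1 / 2"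
    by (simp_all add: field_simps)
  have "?x $ j $ i = oct_cnj (?x $ i $ j)" for i j
    using exhaust_3[of i] exhaust_3[of j] by (auto simp: e oct_cnj_simps oct_cnj_cnj)
  moreover have "(\<Sum>k\<in>UNIV. oct_mult (?x $ i $ k) (?x $ k $ j)) = ?x $ i $ j" for i j
  proof -
    have "oct_mult (?x $ i $ 1) (?x $ 1 $ j) + oct_mult (?x $ i $ 2) (?x $ 2 $ j) = ?x $ i $ j"
      using exhaust_3[of i] exhaust_3[of j] p q
      by (elim disjE) (simp_all only: e oct_mult_scaleR oct_mult_one oct_mult_zero oct_mult_cnj oct_cnj_mult z scaleR_scaleR
          flip: scaleR_add_left, simp_all)
    moreover have "oct_mult (?x $ i $ 3) (?x $ 3 $ j) = 0"
      using exhaust_3[of i] by (auto simp: e oct_mult_zero)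
    ultimately show ?thesis by (simp add: sum_3)
  qed
  moreover have "(\<Sum>i\<in>UNIV. ?x $ i $ i) = oct_one"
    by (simp add: sum_3 e flip: scaleR_add_left) (simp add: field_simps)
  ultimately show ?thesis unfolding Cayley_points_def by blast
qed

lemma Cayley_line_inner: "2 * (Cayley_line_point r z \<bullet> Cayley_line_point r' z') - 1 = r * r' + z \<bullet> z'"
proof -
  have d: "(1::3) \<noteq> 2" "(1::3) \<noteq> 3" "(2::3) \<noteq> 3" by simp_all
  show ?thesis using d
    by (simp add: inner_vec_def sum_3 Cayley_line_point_def oct_one_inner oct_cnj_inner field_simps)
qed

text \<open>A great sphere of dimension 4 in the projective line: it is large enough to be paired with
  the sphere of dimension 2.\<close>

definition S4_embedding :: "(nat \<Rightarrow> real) \<Rightarrow> octonion ^ 3 ^ 3" where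
  "S4_embedding u = Cayley_line_point (u 0) ((Complex (u 1) (u 2), Complex (u 3) (u 4)), 0)"

lemma dot_4: "dot 4 u v = u 0 * v 0 + (u 1 * v 1 + u 2 * v 2 + (u 3 * v 3 + u 4 * v 4))" for u v :: "nat \<Rightarrow> real"
  by (simp add: dot_def eval_nat_numeral)

lemma S4_embedding_inner: "2 * (S4_embedding u \<bullet> S4_embedding v) - 1 = dot 4 u v"
  unfolding S4_embedding_def Cayley_line_inner dot_4 by (simp add: inner_prod_def inner_complex_def)

lemma S4_embedding_mem:
  assumes "u \<in> unit_vectors 4" shows "S4_embedding u \<in> Cayley_points"
  unfolding S4_embedding_def
proof (rule Cayley_line_point)
  have "dot 4 u u = 1" using assms by (simp add: unit_vectors_def)
  then show "(u 0)\<^sup>2 + (norm ((Complex (u 1) (u 2), Complex (u 3) (u 4)), 0 :: quaternion))\<^sup>2 = 1"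
    unfolding dot_4 by (simp add: norm_Pair cmod_power2 flip: power2_eq_square)
qed

text \<open>Restrict the kernel to the four-dimensional sphere and apply \<open>sphere_splits\<close>.\<close>

lemma Cayley_splits: "splits Cayley_points (\<lambda>x y. 2 * (x \<bullet> y) - 1) (unit_vectors 2 :: (nat \<Rightarrow> real) set) (dot 2)"
  unfolding splits_def
proof (intro allI impI)
  fix K assume K: "continuous_on {-1..1} K" and pd: "posdef Cayley_points (\<lambda>x y. K (2 * (x \<bullet> y) - 1))"
  have "S4_embedding ` unit_vectors 4 \<subseteq> Cayley_points" using S4_embedding_mem by blast
  from posdef_image[OF pd this] have "posdef (unit_vectors 4) (\<lambda>x y :: nat \<Rightarrow> real. K (dot 4 x y))"
    by (simp add: S4_embedding_inner)
  then show "\<exists>f\<^sub>1 f\<^sub>2. continuous_on {-1..1} f\<^sub>1 \<and> continuous_on {-1..1} f\<^sub>2 \<and>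
        posdef (unit_vectors 2 :: (nat \<Rightarrow> real) set) (\<lambda>x y. f\<^sub>1 (dot 2 x y)) \<and>
        posdef (unit_vectors 2 :: (nat \<Rightarrow> real) set) (\<lambda>x y. f\<^sub>2 (dot 2 x y)) \<and>
        (\<forall>t\<in>{-1<..<1}. \<exists>D. (K has_real_derivative D) (at t) \<and> (1 - t\<^sup>2) * D = f\<^sub>1 t - f\<^sub>2 t)"
    using sphere_splits[of 4, unfolded splits_def, rule_format, OF _ K] by simp
qed

section \<open>The derivative of a radial part\<close>

theorem theorem1p1:
  fixes d :: nat
    and Md :: "'a metric" and M :: "'b metric"
    and G :: "('a \<Rightarrow> 'a) set" and H :: "('b \<Rightarrow> 'b) set"
    and K :: "'a \<Rightarrow> 'a \<Rightarrow> real"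
  assumes spaces:
      "(d \<ge> 3 \<and> unit_sphere d Md \<and> unit_sphere (d - 2) M) \<or>
       (d \<ge> 3 \<and> real_projective_space d Md \<and> real_projective_space (d - 2) M) \<or>
       (d \<ge> 4 \<and> even d \<and> complex_projective_space d Md \<and> complex_projective_space (d - 2) M) \<or>
       (d \<ge> 8 \<and> 4 dvd d \<and> quaternionic_projective_space d Md \<and>
          ((\<exists>k::nat. d = 8 * k + 8) \<and> complex_projective_space (d div 2 - 2) M \<or>
           (\<exists>k::nat. d = 8 * k + 12) \<and> complex_projective_space (d div 2) M)) \<or>
       (d = 16 \<and> Cayley_plane Md \<and> unit_sphere 2 M)"
    and motions: "motion_group Md G" "motion_group M H"
    and kernel: "continuous_kernel Md K" "positive_definite_kernel Md K" "zonal_kernel Md G K"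
  shows "(\<exists>\<iota>. isometric_embedding M Md \<iota>) \<and>
    radial_part Md K C1_differentiable_on {-1<..<1} \<and>
    (\<exists>f\<^sub>1 f\<^sub>2 K\<^sub>1 K\<^sub>2.
       continuous_kernel M K\<^sub>1 \<and> positive_definite_kernel M K\<^sub>1 \<and> zonal_kernel M H K\<^sub>1 \<and>
       f\<^sub>1 = radial_part M K\<^sub>1 \<and>
       continuous_kernel M K\<^sub>2 \<and> positive_definite_kernel M K\<^sub>2 \<and> zonal_kernel M H K\<^sub>2 \<and>
       f\<^sub>2 = radial_part M K\<^sub>2 \<and>
       (\<forall>t\<in>{-1<..<1}. (1 - t\<^sup>2) * deriv (radial_part Md K) t = f\<^sub>1 t - f\<^sub>2 t))"
    (is ?goal)
proof -
  note finish = conclusion_from_splits[OF _ _ _ _ _ _ motions kernel]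
  have complex_case: ?goal
    if "2 \<le> n" "isometric_to Md (projective_points (*) n) (projective_dist n :: (nat \<Rightarrow> complex) set \<Rightarrow> _)"
      "isometric_to M (projective_points (*) (n - 1)) (projective_dist (n - 1) :: (nat \<Rightarrow> complex) set \<Rightarrow> _)" for n
  proof -
    obtain \<psi> where 1: "models Md (unit_vectors n) (\<lambda>x y. 2 * complex_scalars.overlap n x y - 1) \<psi>"
      by (rule complex_scalars.projective_model[OF \<open>isometric_to Md _ _\<close>])
    obtain \<psi>' where 2: "models M (unit_vectors (n - 1)) (\<lambda>x y. 2 * complex_scalars.overlap (n - 1) x y - 1) \<psi>'"
      by (rule complex_scalars.projective_model[OF \<open>isometric_to M _ _\<close>])
    show ?goal
    proof (rule finish[OF 1 2 complex_scalars.projective_arc])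
      show "1 \<le> n - 1" using \<open>2 \<le> n\<close> by simp
      show "(\<lambda>x. x) ` unit_vectors (n - 1) \<subseteq> (unit_vectors n :: (nat \<Rightarrow> complex) set)"
        using unit_vectors_mono[of "n - 1" n] by simp
      fix u v :: "nat \<Rightarrow> complex" assume "u \<in> unit_vectors (n - 1)"
      then have "complex_scalars.overlap n u v = complex_scalars.overlap (n - 1) u v"
        by (intro complex_scalars.overlap_extend) (auto simp: unit_vectors_def)
      then show "2 * complex_scalars.overlap n u v - 1 = 2 * complex_scalars.overlap (n - 1) u v - 1" by simp
    qed (rule complex_projective_splits[OF \<open>2 \<le> n\<close>])
  qed
  have quaternionic_case: ?goal
    if "2 \<le> n" "1 \<le> m" "m \<le> n" "isometric_to Md (projective_points quat_mult n) (projective_dist n)"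
      "isometric_to M (projective_points (*) m) (projective_dist m :: (nat \<Rightarrow> complex) set \<Rightarrow> _)" for n m
  proof -
    obtain \<psi> where 1: "models Md (unit_vectors n) (\<lambda>x y. 2 * quaternion_scalars.overlap n x y - 1) \<psi>"
      by (rule quaternion_scalars.projective_model[OF \<open>isometric_to Md _ _\<close>])
    obtain \<psi>' where 2: "models M (unit_vectors m) (\<lambda>x y. 2 * complex_scalars.overlap m x y - 1) \<psi>'"
      by (rule complex_scalars.projective_model[OF \<open>isometric_to M _ _\<close>])
    show ?goal
    proof (rule finish[OF 1 2 complex_scalars.projective_arc[OF \<open>1 \<le> m\<close>]])
      show "(\<lambda>x i. (x i, 0)) ` unit_vectors m \<subseteq> (unit_vectors n :: (nat \<Rightarrow> quaternion) set)"
        using unit_vectors_mono[OF \<open>m \<le> n\<close>] quaternion_embedding_unit by blast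
      fix u v :: "nat \<Rightarrow> complex" assume "u \<in> unit_vectors m"
      then have "complex_scalars.overlap n u v = complex_scalars.overlap m u v"
        using \<open>m \<le> n\<close> by (intro complex_scalars.overlap_extend) (auto simp: unit_vectors_def)
      then show "2 * quaternion_scalars.overlap n (\<lambda>i. (u i, 0)) (\<lambda>i. (v i, 0)) - 1 = 2 * complex_scalars.overlap m u v - 1"
        by (simp add: overlap_quaternion_embedding)
    qed (rule quaternionic_projective_splits[OF \<open>2 \<le> n\<close> \<open>m \<le> n\<close>])
  qed
  from spaces show ?goal
  proof (elim disjE conjE exE)
    assume d: "d \<ge> 3" and "unit_sphere d Md" "unit_sphere (d - 2) M"
    obtain \<psi> where 1: "models Md (unit_vectors d :: (nat \<Rightarrow> real) set) (dot d) \<psi>"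
      by (rule sphere_model[OF \<open>unit_sphere d Md\<close>])
    obtain \<psi>' where 2: "models M (unit_vectors (d - 2) :: (nat \<Rightarrow> real) set) (dot (d - 2)) \<psi>'"
      by (rule sphere_model[OF \<open>unit_sphere (d - 2) M\<close>])
    show ?goal
    proof (rule finish[OF 1 2 sphere_arc _ _ sphere_splits[OF d]])
      show "1 \<le> d - 2" using d by simp
      show "(\<lambda>x. x) ` unit_vectors (d - 2) \<subseteq> (unit_vectors d :: (nat \<Rightarrow> real) set)"
        using unit_vectors_mono[of "d - 2" d] by simp
      show "dot d u v = dot (d - 2) u v" if "u \<in> unit_vectors (d - 2)" for u v :: "nat \<Rightarrow> real"
        using that by (intro dot_extend) (auto simp: unit_vectors_def)
    qed
  next
    assume d: "d \<ge> 3" and "real_projective_space d Md" "real_projective_space (d - 2) M"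
    obtain \<psi> where 1: "models Md (unit_vectors d) (\<lambda>x y. 2 * real_scalars.overlap d x y - 1) \<psi>"
      by (rule real_scalars.projective_model[OF \<open>real_projective_space d Md\<close>[unfolded real_projective_space_def]])
    obtain \<psi>' where 2: "models M (unit_vectors (d - 2)) (\<lambda>x y. 2 * real_scalars.overlap (d - 2) x y - 1) \<psi>'"
      by (rule real_scalars.projective_model[OF \<open>real_projective_space (d - 2) M\<close>[unfolded real_projective_space_def]])
    show ?goal
    proof (rule finish[OF 1 2 real_scalars.projective_arc])
      show "1 \<le> d - 2" using d by simp
      show "(\<lambda>x. x) ` unit_vectors (d - 2) \<subseteq> (unit_vectors d :: (nat \<Rightarrow> real) set)"
        using unit_vectors_mono[of "d - 2" d] by simp
      show "2 * real_scalars.overlap d u v - 1 = 2 * real_scalars.overlap (d - 2) u v - 1" if "u \<in> unit_vectors (d - 2)" for u v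
        using that dot_extend[of u "d - 2" d v] by (simp add: real_overlap unit_vectors_def)
    qed (simp add: real_overlap real_projective_splits[OF d])
  next
    assume d: "d \<ge> 4" "even d" and "complex_projective_space d Md" "complex_projective_space (d - 2) M"
    moreover have "(d - 2) div 2 = d div 2 - 1" using d by (elim evenE) simp
    ultimately show ?goal using d
      by (intro complex_case[of "d div 2"]) (auto simp: complex_projective_space_def)
  next
    fix k assume d: "d \<ge> 8" "d = 8 * k + 8" and "quaternionic_projective_space d Md" "complex_projective_space (d div 2 - 2) M"
    moreover have "(d div 2 - 2) div 2 = d div 4 - 1" using d by simp
    ultimately show ?goal using d
      by (intro quaternionic_case[of "d div 4" "d div 4 - 1"])
        (auto simp: complex_projective_space_def quaternionic_projective_space_def)
  next
    fix k assume d: "d \<ge> 8" "d = 8 * k + 12" and "quaternionic_projective_space d Md" "complex_projective_space (d div 2) M"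
    moreover have "d div 2 div 2 = d div 4" using d by simp
    ultimately show ?goal using d
      by (intro quaternionic_case[of "d div 4" "d div 4"])
        (auto simp: complex_projective_space_def quaternionic_projective_space_def)
  next
    assume "Cayley_plane Md" "unit_sphere 2 M"
    obtain \<psi> where 1: "models Md Cayley_points (\<lambda>x y. 2 * (x \<bullet> y) - 1) \<psi>"
      by (rule Cayley_model[OF \<open>Cayley_plane Md\<close>])
    obtain \<psi>' where 2: "models M (unit_vectors 2 :: (nat \<Rightarrow> real) set) (dot 2) \<psi>'"
      by (rule sphere_model[OF \<open>unit_sphere 2 M\<close>])
    show ?goal
    proof (rule finish[OF 1 2 sphere_arc _ _ Cayley_splits])
      show "S4_embedding ` unit_vectors 2 \<subseteq> Cayley_points"
        using S4_embedding_mem unit_vectors_mono[of 2 4] by fastforce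
      show "2 * (S4_embedding u \<bullet> S4_embedding v) - 1 = dot 2 u v" if "u \<in> unit_vectors 2" for u v
        using that dot_extend[of u 2 4 v] by (simp add: S4_embedding_inner unit_vectors_def)
    qed simp
  qed
qed

end
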